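(* Let $n\ge 3$ be a square-free integer and $r\ge 1$ an integer. If $r$ is odd, then $$(-1)^{(r-1)/2}\,\frac{2\pi^r}{n^r(r-1)!}\sum_{m>0,\ (m,n)=1}\mu(m)\frac{\sin(2\pi m^*/n)}{m^r}=\widehat B^{(r)}_{1,1},$$ and if $r$ is even, then $$(-1)^{r/2-1}\,\frac{2\pi^r}{n^r(r-1)!}\sum_{m>0,\ (m,n)=1}\mu(m)\frac{\cos(2\pi m^*/n)}{m^r}=\widehat B^{(r)}_{1,1}.$$
   Context: $\mu$ is the Möbius function. For $m\in\mathbb{Z}$ with $(m,n)=1$, $m^*$ denotes the inverse of $m$ mod $n$, $mm^*\equiv1\pmod n$, $1\le m^*\le n$. For $r=1$ the (conditionally convergent) series is understood as $\lim_{k\to\infty}\sum_{0<m\le k}$. Let $\mathcal{R}=\{j\in\mathbb{Z}:1\le j\le n/2,\ (j,n)=1\}$. Let $B^{(r)}(x)$ be the $r$th Bernoulli polynomial, and $\widetilde n=n-1$ if $r$ is odd, $\widetilde n=n$ if $r$ is even. For $1\le j\le n$, $(j,n)=1$, put $$\widetilde B^{(r)}_j=\frac{(-1)^r2^rn^{r-1}}{r}\sum_{d\mid n}\mu(d)\sum_{\substack{1\le k\le\widetilde n\\ (k,n)=d,\ k\equiv j\ (\mathrm{mod}\ n/d)}}B^{(r)}(k/n).$$ Let $\widetilde B^{(r)}=(\widetilde B^{(r)}_{jk^*})_{j,k\in\mathcal{R}}$, where the subscript $jk^*$ means the representative of $jk^*$ mod $n$ in $\{1,\dots,n\}$. This matrix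 is invertible; $\widehat B^{(r)}=(\widehat B^{(r)}_{j,k})_{j,k\in\mathcal{R}}$ denotes its inverse, and $\widehat B^{(r)}_{1,1}$ is its entry with row and column index $1\in\mathcal{R}$. *)

theory Defs
  imports Complex_Main "HOL-Computational_Algebra.Squarefree" "HOL-Number_Theory.Number_Theory"
begin

definition moebius :: "nat \<Rightarrow> int" where
  "moebius m = (if squarefree m then (-1) ^ card (prime_factors m) else 0)"

(* Bernoulli numbers with the convention bernoulli 1 = -1/2, so that bernpoly 1 x = x - 1/2. *)
fun bernoulli :: "nat \<Rightarrow> real" where
  "bernoulli 0 = 1"
| "bernoulli (Suc r) =
     - (\<Sum>k\<le>r. real ((r + 2) choose k) * bernoulli k) / real (r + 2)"

definition bernpoly :: "nat \<Rightarrow> real \<Rightarrow> real" where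
  "bernpoly r x = (\<Sum>k\<le>r. real (r choose k) * bernoulli k * x ^ (r - k))"

(* For n > 1 and m coprime to n this lies in {1..n-1}; it is the inverse of m mod n in {1..n}. *)
definition inv_mod :: "nat \<Rightarrow> nat \<Rightarrow> nat" where
  "inv_mod n m = nat (modular_inverse (int n) (int m))"

definition index_set :: "nat \<Rightarrow> nat set" where
  "index_set n = {j. 1 \<le> j \<and> real j \<le> real n / 2 \<and> coprime j n}"

definition n_tilde :: "nat \<Rightarrow> nat \<Rightarrow> nat" where
  "n_tilde n r = (if odd r then n - 1 else n)"

definition B_tilde :: "nat \<Rightarrow> nat \<Rightarrow> nat \<Rightarrow> real" where
  "B_tilde n r j =
     (-1) ^ r * 2 ^ r * real n ^ (r - 1) / real r *
     (\<Sum>d | d dvd n. of_int (moebius d) *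
        (\<Sum>k | k \<in> {1..n_tilde n r} \<and> gcd k n = d \<and> [k = j] (mod (n div d)).
           bernpoly r (real k / real n)))"

(* Matrices with rows and columns indexed by a finite set S are functions S x S -> real;
   values outside S x S are irrelevant, except in mat_inverse_on, where they are set to 0
   to make the inverse unique as a function. *)
definition is_mat_inverse_on ::
    "'a set \<Rightarrow> ('a \<Rightarrow> 'a \<Rightarrow> real) \<Rightarrow> ('a \<Rightarrow> 'a \<Rightarrow> real) \<Rightarrow> bool" where
  "is_mat_inverse_on S A M \<longleftrightarrow>
     (\<forall>j\<in>S. \<forall>k\<in>S. (\<Sum>l\<in>S. A j l * M l k) = (if j = k then 1 else 0)) \<and>
     (\<forall>j\<in>S. \<forall>k\<in>S. (\<Sum>l\<in>S. M j l * A l k) = (if j = k then 1 else 0))"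

definition mat_invertible_on :: "'a set \<Rightarrow> ('a \<Rightarrow> 'a \<Rightarrow> real) \<Rightarrow> bool" where
  "mat_invertible_on S A \<longleftrightarrow> (\<exists>M. is_mat_inverse_on S A M)"

definition mat_inverse_on ::
    "'a set \<Rightarrow> ('a \<Rightarrow> 'a \<Rightarrow> real) \<Rightarrow> 'a \<Rightarrow> 'a \<Rightarrow> real" where
  "mat_inverse_on S A =
     (THE M. is_mat_inverse_on S A M \<and> (\<forall>j k. j \<notin> S \<or> k \<notin> S \<longrightarrow> M j k = 0))"

(* (j * inv_mod n k) mod n is never 0 for j, k in index_set n and n > 1,
   so it is the representative in {1..n}. *)
definition B_tilde_mat :: "nat \<Rightarrow> nat \<Rightarrow> nat \<Rightarrow> nat \<Rightarrow> real" where
  "B_tilde_mat n r j k = B_tilde n r ((j * inv_mod n k) mod n)"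

definition B_hat :: "nat \<Rightarrow> nat \<Rightarrow> nat \<Rightarrow> nat \<Rightarrow> real" where
  "B_hat n r = mat_inverse_on (index_set n) (B_tilde_mat n r)"

definition sin_partial_sum :: "nat \<Rightarrow> nat \<Rightarrow> nat \<Rightarrow> real" where
  "sin_partial_sum n r K =
     (\<Sum>m | 0 < m \<and> m \<le> K \<and> coprime m n.
        of_int (moebius m) * (sin (2 * pi * real (inv_mod n m) / real n) / real m ^ r))"

definition cos_partial_sum :: "nat \<Rightarrow> nat \<Rightarrow> nat \<Rightarrow> real" where
  "cos_partial_sum n r K =
     (\<Sum>m | 0 < m \<and> m \<le> K \<and> coprime m n.
        of_int (moebius m) * (cos (2 * pi * real (inv_mod n m) / real n) / real m ^ r))"

end

theory Submission
  imports Defs "HOL-Complex_Analysis.Complex_Analysis"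
begin

text \<open>
  Write $e(x) = \exp(2\pi i x/n)$, let $\varepsilon = (-1)^r$, and for $d \mid n$ let $w_d$ be the
  residue mod $n$ that is $0$ mod $d$ and $1$ mod $n/d$; it exists because $n$ is squarefree. In the
  definition of $\widetilde B_j$ the divisor $d$ contributes at most the single point $k \equiv j w_d$ mod
  $n$. The Fourier series of the Bernoulli polynomials therefore turns $\widetilde B_j$ into a
  constant multiple of
  $A(j) = \sum_{m\ge 1} (E(mj) + \varepsilon E(-mj))/m^r$ with the kernel
  $E(x) = \sum_{d\mid n} \mu(d)\, e(x w_d)$.

  Two properties of the kernel make the matrix $(A(jk^*))$ explicitly invertible. First, $E(x) = 0$
  unless $x$ is coprime to $n$ (kern_eq_0). Secondly, $\sum_x E(ax)\,e(-bx)$ is $n$ or $0$ according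
  as $a \equiv b$ or not, for $b$ coprime to $n$ (sum_kern_e_mod). So $x \mapsto e(-x^*)$ inverts $E$
  for the convolution of the group of units, the Moebius function inverts the factor
  $\sum m^{-r}$, and the inverse of $A$ is, up to the factor $n$, the function
  $B(y) = \sum_l \mu(l)\,(e(-l^*y) + \varepsilon e(l^*y))/l^r$ (series_convolution). The evenness of
  $x \mapsto A(xa)B(xb)$ halves the range of summation to the index set of the matrix, and the entry
  at $(1,1)$ is the sine or cosine series of the theorem.

  For $r \ge 2$ everything converges absolutely. For $r = 1$ the identity is proved for exponents
  $s > 1$ and carried to $s = 1$. On the side of $A$ this is the continuity of a Dirichlet series
  with periodic coefficients of mean zero. On the side of $B$ it needs that $\sum \mu(m) g(m)/m$
  converges, to the limit of $\sum \mu(m) g(m) m^{-s}$ as $s$ decreases to $1$, for every odd function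
  $g$ on the units (moebius_series_regular_odd): a statement of the depth of the prime number
  theorem for arithmetic progressions. Such a $g$ is a combination of odd Dirichlet characters
  $\psi$; for these the sum is $1/L(1,\psi)$ by Newman's Tauberian theorem (Newman_Tauberian), which
  needs $L(1+it,\psi) \neq 0$. Nonvanishing follows from Landau's theorem on Dirichlet series with
  nonnegative coefficients, applied to $\zeta(s)^2 L(s+it,\psi) L(s-it,\overline\psi)$
  (periodic_L_char_nonzero_on_line).
\<close>

section \<open>Dirichlet convolution and the Moebius function\<close>

text \<open>The name is also that of the fractional linear transformations, which do not occur here.\<close>
hide_const (open) Complex_Transcendental.moebius
hide_fact (open) Complex_Transcendental.moebius_def

definition dirichlet_conv :: "(nat \<Rightarrow> complex) \<Rightarrow> (nat \<Rightarrow> complex) \<Rightarrow> nat \<Rightarrow> complex" where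
  "dirichlet_conv f g m = (\<Sum>d | d dvd m. f d * g (m div d))"

definition multfun :: "(nat \<Rightarrow> complex) \<Rightarrow> bool" where
  "multfun f \<longleftrightarrow> f 1 = 1 \<and> (\<forall>a b. 0 < a \<longrightarrow> 0 < b \<longrightarrow> coprime a b \<longrightarrow> f (a * b) = f a * f b)"

text \<open>A divisor of $ab$ splits uniquely as a product of its greatest common divisors with $a$ and $b$.\<close>
lemma sum_divisors_coprime_mult:
  fixes a b :: nat and F :: "nat \<Rightarrow> complex"
  assumes "coprime a b" "0 < a" "0 < b"
  shows "(\<Sum>d | d dvd a * b. F d) = (\<Sum>x | x dvd a. \<Sum>y | y dvd b. F (x * y))"
proof -
  have gx: "gcd (x * y) a = x" if "x dvd a" "y dvd b" for x y
  proof -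
    have "coprime y a"
      using coprime_divisors[OF dvd_refl that(2) assms(1)] by (rule coprime_imp_coprime) auto
    then have "gcd (x * y) a = gcd x a"
      by (rule gcd_mult_left_right_cancel[OF coprime_commute[THEN iffD1]])
    with that show ?thesis by (simp add: gcd_nat.absorb1)
  qed
  have gy: "gcd (x * y) b = y" if "x dvd a" "y dvd b" for x y
  proof -
    have "coprime x b" using coprime_divisors[OF that(1) dvd_refl assms(1)] .
    then have "gcd (x * y) b = gcd y b"
      by (rule gcd_mult_left_left_cancel[OF coprime_commute[THEN iffD1]])
    with that show ?thesis by (simp add: gcd_nat.absorb1)
  qed
  have gd: "gcd d a * gcd d b = d" if d: "d dvd a * b" for d
  proof -
    obtain x y where "d = x * y" "x dvd a" "y dvd b" using division_decomp[OF d] by blast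
    then show ?thesis by (simp add: gx gy)
  qed
  have "(\<Sum>x | x dvd a. \<Sum>y | y dvd b. F (x * y))
      = (\<Sum>(x,y)\<in>{x. x dvd a} \<times> {y. y dvd b}. F (x * y))"
    by (rule sum.cartesian_product)
  also have "\<dots> = (\<Sum>d | d dvd a * b. F d)"
    by (rule sum.reindex_bij_witness[of _ "\<lambda>d. (gcd d a, gcd d b)" "\<lambda>(x,y). x * y"])
       (auto simp: gx gy gd intro: mult_dvd_mono)
  finally show ?thesis ..
qed

lemma multfun_dirichlet_conv:
  assumes f: "multfun f" and g: "multfun g"
  shows "multfun (dirichlet_conv f g)"
proof -
  have "dirichlet_conv f g (a * b) = dirichlet_conv f g a * dirichlet_conv f g b"
    if ab: "0 < a" "0 < b" "coprime a b" for a b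
  proof -
    have "dirichlet_conv f g (a * b) = (\<Sum>x | x dvd a. \<Sum>y | y dvd b. f (x * y) * g ((a * b) div (x * y)))"
      unfolding dirichlet_conv_def by (rule sum_divisors_coprime_mult) (use ab in auto)
    also have "\<dots> = (\<Sum>x | x dvd a. \<Sum>y | y dvd b. (f x * g (a div x)) * (f y * g (b div y)))"
    proof (intro sum.cong refl, clarsimp)
      fix x y assume xy: "x dvd a" "y dvd b"
      from xy obtain x' y' where x': "a = x * x'" and y': "b = y * y'" unfolding dvd_def by blast
      have pos: "x > 0" "y > 0" "x' > 0" "y' > 0" using ab x' y' by auto
      have cp: "coprime x y" "coprime x' y'" using ab(3) unfolding x' y' by auto
      have "(a * b) div (x * y) = x' * y'" using pos nonzero_mult_div_cancel_left[of "x * y" "x' * y'"] unfolding x' y'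
        by (simp add: mult_ac)
      then show "f (x * y) * g (a * b div (x * y)) = f x * g (a div x) * (f y * g (b div y))"
        using f g pos cp unfolding multfun_def by (simp add: x' y')
    qed
    also have "\<dots> = dirichlet_conv f g a * dirichlet_conv f g b"
      unfolding dirichlet_conv_def by (simp add: sum_product)
    finally show ?thesis .
  qed
  moreover have "dirichlet_conv f g 1 = 1" using f g by (simp add: dirichlet_conv_def multfun_def)
  ultimately show ?thesis by (auto simp: multfun_def)
qed

text \<open>Reduces statements about multiplicative functions to prime powers: split off the full power of one
  prime at a time.\<close>
lemma prime_power_coprime_induct [consumes 1, case_names one mult]:
  fixes m :: nat
  assumes "0 < m" and "P 1"
    and "\<And>p k m. prime p \<Longrightarrow> 0 < k \<Longrightarrow> 0 < m \<Longrightarrow> \<not> p dvd m \<Longrightarrow> P m \<Longrightarrow> P (p ^ k * m)"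
  shows "P m"
  using \<open>0 < m\<close>
proof (induction m rule: less_induct)
  case (less m)
  show ?case
  proof (cases "m = 1")
    case False
    then obtain p where p: "prime p" "p dvd m" using prime_factor_nat by blast
    have np: "m \<noteq> 0" "\<not> is_unit p" using less.prems p by (auto simp: prime_nat_iff)
    obtain m' where m': "m = p ^ multiplicity p m * m'" "\<not> p dvd m'"
      using multiplicity_decompose'[OF np] by metis
    have k: "0 < multiplicity p m" using p less.prems
      by (simp add: prime_multiplicity_gt_zero_iff)
    have "m' > 0" using m'(2) by (auto intro: Nat.gr0I)
    have "1 < p ^ multiplicity p m" using k prime_gt_1_nat[OF p(1)] by (rule one_less_power[rotated])
    then have "1 * m' < p ^ multiplicity p m * m'" using \<open>m' > 0\<close> by (intro mult_strict_right_mono)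
    then have "m' < m" using m'(1) by simp
    then show ?thesis using assms(3)[OF p(1) k \<open>m' > 0\<close> m'(2) less.IH[OF \<open>m' < m\<close> \<open>m' > 0\<close>]] m'(1) by simp
  qed (use assms in simp)
qed

lemma multfun_prime_power_mult:
  assumes "multfun f" "prime p" "0 < m" "\<not> p dvd m"
  shows "f (p ^ k * m) = f (p ^ k) * f m"
proof -
  have "coprime (p ^ k) m" using assms by (simp add: prime_imp_coprime)
  then show ?thesis using assms prime_gt_0_nat[of p] by (simp add: multfun_def)
qed

lemma dirichlet_conv_prime_power:
  assumes "prime p"
  shows "dirichlet_conv f g (p ^ k) = (\<Sum>i\<le>k. f (p ^ i) * g (p ^ (k - i)))"
proof -
  have "{d. d dvd p ^ k} = (\<lambda>i. p ^ i) ` {..k}"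
    using assms by (auto simp: divides_primepow_nat)
  moreover have "inj_on (\<lambda>i. p ^ i) {..k}"
    using prime_gt_1_nat[OF assms] by (intro inj_onI) simp
  ultimately have "dirichlet_conv f g (p ^ k) = (\<Sum>i\<le>k. f (p ^ i) * g (p ^ k div p ^ i))"
    by (simp add: dirichlet_conv_def sum.reindex)
  also have "\<dots> = (\<Sum>i\<le>k. f (p ^ i) * g (p ^ (k - i)))"
    using prime_gt_0_nat[OF assms] power_diff[of p _ k] by (intro sum.cong refl) auto
  finally show ?thesis .
qed

lemma moebius_1 [simp]: "moebius (Suc 0) = 1"
  by (simp add: moebius_def)

lemma moebius_prime: "prime p \<Longrightarrow> moebius p = -1"
  by (simp add: moebius_def squarefree_prime prime_factorization_prime)

lemma moebius_coprime_mult: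
  assumes "0 < a" "0 < b" "coprime a b"
  shows "moebius (a * b) = moebius a * moebius b"
proof -
  have pf: "prime_factors (a * b) = prime_factors a \<union> prime_factors b"
    using assms by (simp add: prime_factors_product)
  have disj: "prime_factors a \<inter> prime_factors b = {}"
    using assms(3) by (auto simp: in_prime_factors_iff dest: coprime_common_divisor)
  have "card (prime_factors (a * b)) = card (prime_factors a) + card (prime_factors b)"
    unfolding pf using disj by (intro card_Un_disjoint) auto
  moreover have "squarefree (a * b) \<longleftrightarrow> squarefree a \<and> squarefree b"
    using assms(3) squarefree_mono[of a "a * b"] squarefree_mono[of b "a * b"]
    by (auto intro: squarefree_mult_coprime)
  ultimately show ?thesis by (auto simp: moebius_def power_add)
qed

lemma multfun_moebius: "multfun (\<lambda>m. of_int (moebius m))"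
  by (auto simp: multfun_def moebius_coprime_mult)

lemma abs_moebius_le: "\<bar>moebius m\<bar> \<le> 1"
  by (simp add: moebius_def)

lemma norm_moebius_mult_le: "norm z \<le> B \<Longrightarrow> norm (of_int (moebius m) * z :: complex) \<le> B"
  by (cases "squarefree m") (auto simp: moebius_def norm_mult norm_power intro: order_trans[OF norm_ge_zero])

lemma moebius_prime_power:
  assumes "prime p" "2 \<le> k"
  shows "moebius (p ^ k) = 0"
proof -
  have "p\<^sup>2 dvd p ^ k" using assms by (simp add: le_imp_power_dvd)
  then have "\<not> squarefree (p ^ k)" using assms(1)
    by (auto simp: squarefree_def)
  then show ?thesis by (simp add: moebius_def)
qed

text \<open>Both sides are multiplicative, and at $p^k$ only the divisors $1$ and $p$ contribute, with opposite
  signs.\<close>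
lemma moebius_inversion:
  assumes "0 < m"
  shows "dirichlet_conv (\<lambda>m. of_int (moebius m)) (\<lambda>_. 1) m = (if m = 1 then 1 else 0)"
  using assms
proof (induction m rule: prime_power_coprime_induct)
  case one
  then show ?case by (simp add: dirichlet_conv_def)
next
  case (mult p k m)
  have mf: "multfun (dirichlet_conv (\<lambda>m. of_int (moebius m)) (\<lambda>_. 1))"
    by (rule multfun_dirichlet_conv[OF multfun_moebius]) (simp add: multfun_def)
  have "dirichlet_conv (\<lambda>m. of_int (moebius m)) (\<lambda>_. 1) (p ^ k) = (\<Sum>i\<le>k. of_int (moebius (p ^ i)) :: complex)"
    using mult by (simp add: dirichlet_conv_prime_power)
  also have "\<dots> = (\<Sum>i\<in>{0,1}. of_int (moebius (p ^ i)))"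
    using mult by (intro sum.mono_neutral_right) (auto simp: moebius_prime_power)
  also have "\<dots> = 0" using mult by (simp add: moebius_prime)
  finally have "dirichlet_conv (\<lambda>m. of_int (moebius m)) (\<lambda>_. 1) (p ^ k * m) = 0"
    by (subst multfun_prime_power_mult[OF mf]) (use mult in auto)
  moreover have "p ^ k * m \<noteq> 1" using mult prime_gt_1_nat[of p]
    by (simp)
  ultimately show ?case by simp
qed

text \<open>The terms of the product series are indexed by pairs $(a,b)$; regrouping them by $m = ab$ is
  legitimate because of absolute convergence, and turns the pairs into $(m, d)$ with $d \mid m$.\<close>
lemma dirichlet_conv_summable:
  fixes F H :: "nat \<Rightarrow> complex"
  assumes F: "summable (\<lambda>m. norm (F m))" "F 0 = 0" and H: "summable (\<lambda>m. norm (H m))" "H 0 = 0"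
  shows "summable (\<lambda>m. norm (dirichlet_conv F H m))" and "(\<Sum>m. dirichlet_conv F H m) = (\<Sum>m. F m) * (\<Sum>m. H m)"
proof -
  have Fs: "(\<lambda>a. norm (F a)) summable_on UNIV" and Hs: "(\<lambda>a. norm (H a)) summable_on UNIV"
    using F H by (auto simp: summable_on_UNIV_nonneg_real_iff)
  let ?P = "\<lambda>(a::nat,b::nat). F a * H b"
  have ab: "(\<lambda>x. norm (?P x)) summable_on UNIV \<times> UNIV"
  proof -
    have "(\<lambda>b. norm (F a * H b)) summable_on UNIV" for a
      using summable_on_cmult_right[OF Hs, of "norm (F a)"] by (simp add: norm_mult)
    moreover have "(\<lambda>a. norm (infsum (\<lambda>b. norm (F a * H b)) UNIV)) summable_on UNIV"
      using summable_on_cmult_left[OF Fs, of "infsum (\<lambda>b. norm (H b)) UNIV"]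
      by (simp add: norm_mult infsum_cmult_right' infsum_nonneg)
    ultimately show ?thesis unfolding Infinite_Sum.abs_summable_on_Sigma_iff by simp
  qed
  have hsF: "(F has_sum (\<Sum>m. F m)) UNIV" and hsH: "(H has_sum (\<Sum>m. H m)) UNIV"
    using norm_summable_imp_has_sum[OF F(1) summable_sums] norm_summable_imp_has_sum[OF H(1) summable_sums]
      summable_norm_cancel[OF F(1)] summable_norm_cancel[OF H(1)] by auto
  have prod: "(?P has_sum ((\<Sum>m. F m) * (\<Sum>m. H m))) (UNIV \<times> UNIV)"
  proof (rule has_sum_SigmaI)
    show "((\<lambda>b. ?P (a, b)) has_sum (F a * (\<Sum>m. H m))) UNIV" for a
      using has_sum_cmult_right[OF hsH, of "F a"] by simp
    show "((\<lambda>a. F a * (\<Sum>m. H m)) has_sum ((\<Sum>m. F m) * (\<Sum>m. H m))) UNIV"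
      using has_sum_cmult_left[OF hsF] by simp
    show "?P summable_on UNIV \<times> UNIV" using ab by (rule Infinite_Sum.abs_summable_summable)
  qed
  let ?S = "SIGMA m:{0<..}. {d. d dvd m}"
  let ?Q = "\<lambda>(m::nat,d::nat). F d * H (m div d)"
  have reindex: "(?Q has_sum s) ?S \<longleftrightarrow> (?P has_sum s) ({0<..} \<times> {0<..})" for s
    by (rule has_sum_reindex_bij_witness[of _ "\<lambda>(a,b). (a * b, a)" "\<lambda>(m,d). (d, m div d)"])
       (auto elim!: dvdE)
  have reindexn: "((\<lambda>x. norm (?Q x)) has_sum s) ?S \<longleftrightarrow> ((\<lambda>x. norm (?P x)) has_sum s) ({0<..} \<times> {0<..})" for s
    by (rule has_sum_reindex_bij_witness[of _ "\<lambda>(a,b). (a * b, a)" "\<lambda>(m,d). (d, m div d)"])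
       (auto elim!: dvdE)
  have "(?P has_sum ((\<Sum>m. F m) * (\<Sum>m. H m))) ({0<..} \<times> {0<..})"
    using prod by (rule has_sum_cong_neutral[THEN iffD1, rotated -1]) (auto simp: F H intro!: gr0I)
  then have Q: "(?Q has_sum ((\<Sum>m. F m) * (\<Sum>m. H m))) ?S" by (simp add: reindex)
  have "(\<lambda>x. norm (?P x)) summable_on {0<..} \<times> {0<..}" using ab by (rule summable_on_subset_banach) auto
  then have Qn: "(\<lambda>x. norm (?Q x)) summable_on ?S" using reindexn unfolding summable_on_def by blast
  have d0: "dirichlet_conv F H 0 = 0" by (simp add: dirichlet_conv_def)
  have fin: "finite {d. d dvd m}" if "m > 0" for m :: nat using that by simp
  have 1: "(dirichlet_conv F H has_sum ((\<Sum>m. F m) * (\<Sum>m. H m))) {0<..}"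
  proof (rule has_sum_SigmaD[OF Q])
    show "((\<lambda>d. ?Q (m, d)) has_sum dirichlet_conv F H m) {d. d dvd m}" if "m \<in> {0<..}" for m
      using has_sum_finite[of "{d. d dvd m}" "\<lambda>d. ?Q (m, d)"] fin that by (simp add: dirichlet_conv_def)
  qed
  have 2: "(\<lambda>m. norm (dirichlet_conv F H m)) summable_on {0<..}"
  proof (rule Infinite_Sum.abs_summable_on_comparison_test')
    show "(\<lambda>m. infsum (\<lambda>d. norm (?Q (m,d))) {d. d dvd m}) summable_on {0<..}"
      using Qn unfolding Infinite_Sum.abs_summable_on_Sigma_iff by (simp add: infsum_nonneg)
    show "norm (dirichlet_conv F H m) \<le> infsum (\<lambda>d. norm (?Q (m,d))) {d. d dvd m}" if "m \<in> {0<..}" for m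
      using fin[of m] that norm_sum[of "\<lambda>d. F d * H (m div d)" "{d. d dvd m}"] by (simp add: dirichlet_conv_def)
  qed
  have "(dirichlet_conv F H has_sum ((\<Sum>m. F m) * (\<Sum>m. H m))) UNIV"
    using 1 by (rule has_sum_cong_neutral[THEN iffD1, rotated -1]) (auto simp: d0)
  then show "(\<Sum>m. dirichlet_conv F H m) = (\<Sum>m. F m) * (\<Sum>m. H m)"
    by (auto dest!: has_sum_imp_sums simp: sums_iff)
  have "(\<lambda>m. norm (dirichlet_conv F H m)) summable_on UNIV"
    using 2 by (rule summable_on_cong_neutral[THEN iffD1, rotated -1]) (auto simp: d0)
  then show "summable (\<lambda>m. norm (dirichlet_conv F H m))" by (simp add: summable_on_UNIV_nonneg_real_iff)
qed

section \<open>Dirichlet series with periodic coefficients\<close>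

lemma periodic_mod:
  fixes h :: "nat \<Rightarrow> 'a"
  assumes "\<And>m. h (m + n) = h m"
  shows "h m = h (m mod n)"
proof -
  have "h (k * n + j) = h j" for k j
    using assms by (induction k) (auto simp: add_ac, metis add.commute add.left_commute)
  from this[of "m div n" "m mod n"] show ?thesis by simp
qed

text \<open>The Dirichlet series of a function of period $n$, summed in blocks of length $n$. When the mean of
  $h$ over a period vanishes, each block gains a factor $1/k$, so this form of the series represents
  the continuation to the half-plane of positive real part.\<close>
definition periodic_L :: "(nat \<Rightarrow> complex) \<Rightarrow> nat \<Rightarrow> complex \<Rightarrow> complex" where
  "periodic_L h n s = (\<Sum>k. \<Sum>j=1..n. h j * of_nat (k * n + j) powr (-s))"

lemma norm_of_nat_powr: "0 < m \<Longrightarrow> norm (of_nat m powr s :: complex) = real m powr Re s"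
  using norm_powr_real_powr[of "of_nat m" s] by simp

text \<open>Mean value inequality for $x \mapsto x^{-s}$ on the segment from $y$ to $x$.\<close>
lemma norm_powr_diff_le:
  fixes x y :: nat
  assumes "0 < y" "y \<le> x" "0 \<le> Re s"
  shows "norm (of_nat x powr (-s) - of_nat y powr (-s) :: complex)
           \<le> norm s * real y powr (- Re s - 1) * real (x - y)"
proof -
  let ?S = "closed_segment (complex_of_real (real y)) (complex_of_real (real x))"
  have S: "?S = complex_of_real ` {real y..real x}"
    using assms closed_segment_of_real[of "real y" "real x"] by (simp add: closed_segment_eq_real_ivl)
  have "norm (complex_of_real (real x) powr (-s) - complex_of_real (real y) powr (-s))
      \<le> norm s * real y powr (- Re s - 1) * norm (complex_of_real (real x) - complex_of_real (real y))"
  proof (rule field_differentiable_bound[where S = ?S and f' = "\<lambda>z. -s * z powr (-s - 1)"])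
    show "convex ?S" by simp
    fix z assume "z \<in> ?S"
    then obtain t where t: "z = of_real t" "real y \<le> t" "t \<le> real x" unfolding S by auto
    have tpos: "t > 0" using t assms by linarith
    have nz: "z \<notin> \<real>\<^sub>\<le>\<^sub>0" using t tpos by auto
    show "((\<lambda>z. z powr (-s)) has_field_derivative (-s * z powr (-s - 1))) (at z within ?S)"
      using has_field_derivative_powr[OF nz, of "-s"] by (rule has_field_derivative_at_within)
    have "norm (z powr (-s - 1)) = t powr (- Re s - 1)"
      using t tpos norm_powr_real_powr[of z "-s - 1"] by simp
    also have "\<dots> \<le> real y powr (- Re s - 1)"
      using t assms by (intro powr_mono2') auto
    finally show "norm (-s * z powr (-s - 1)) \<le> norm s * real y powr (- Re s - 1)"
      by (simp add: norm_mult mult_left_mono)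
  qed auto
  moreover have "norm (complex_of_real (real x) - complex_of_real (real y)) = real (x - y)"
    using assms(2) by (metis abs_of_nat norm_of_real of_nat_diff of_real_diff)
  ultimately show ?thesis by simp
qed

text \<open>Since $h$ sums to zero over a period, the constant $(kn+1)^{-s}$ may be subtracted from every power
  in the block.\<close>
lemma periodic_L_block_bound:
  assumes n: "0 < n" and h0: "(\<Sum>j=1..n. h j) = 0" and s: "0 \<le> Re s"
  shows "norm (\<Sum>j=1..n. h j * of_nat (k * n + j) powr (-s))
           \<le> (\<Sum>j=1..n. norm (h j)) * real n * norm s * real (Suc k) powr (- Re s - 1)"
proof -
  let ?c = "of_nat (k * n + 1) powr (-s) :: complex"
  have "(\<Sum>j=1..n. h j * of_nat (k * n + j) powr (-s))
      = (\<Sum>j=1..n. h j * (of_nat (k * n + j) powr (-s) - ?c))"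
    using h0 by (simp add: right_diff_distrib sum_subtractf flip: sum_distrib_right)
  also have "norm \<dots> \<le> (\<Sum>j=1..n. norm (h j) * (real n * norm s * real (Suc k) powr (- Re s - 1)))"
  proof (rule sum_norm_le)
    fix j assume j: "j \<in> {1..n}"
    have "norm (of_nat (k * n + j) powr (-s) - ?c)
        \<le> norm s * real (k * n + 1) powr (- Re s - 1) * real (k * n + j - (k * n + 1))"
      using j s by (intro norm_powr_diff_le) auto
    also have "\<dots> \<le> norm s * real (Suc k) powr (- Re s - 1) * real n"
      using j s n by (intro mult_mono powr_mono2') (auto simp: mult_le_cancel_left1 intro!: add_mono)
    finally show "norm (h j * (of_nat (k * n + j) powr (-s) - ?c))
        \<le> norm (h j) * (real n * norm s * real (Suc k) powr (- Re s - 1))"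
      unfolding norm_mult by (intro mult_left_mono) (simp_all add: mult_ac del: of_nat_add of_nat_mult of_nat_Suc)
  qed
  finally show ?thesis by (simp add: sum_distrib_right[symmetric] mult.assoc del: of_nat_add of_nat_mult of_nat_Suc)
qed

lemma periodic_L_sums_holomorphic:
  assumes n: "0 < n" and h0: "(\<Sum>j=1..n. h j) = 0"
  shows "\<And>s. 0 < Re s \<Longrightarrow> (\<lambda>k. \<Sum>j=1..n. h j * of_nat (k * n + j) powr (-s)) sums periodic_L h n s"
    and "periodic_L h n holomorphic_on {s. 0 < Re s}"
proof -
  let ?f = "\<lambda>k s. \<Sum>j=1..n. h j * of_nat (k * n + j) powr (-s)"
  let ?S = "{s::complex. 0 < Re s}"
  have opn: "open ?S" by (rule open_halfspace_Re_gt)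
  have "\<exists>g g'. \<forall>x\<in>?S. ((\<lambda>k. ?f k x) sums g x) \<and> ((\<lambda>k. deriv (?f k) x) sums g' x) \<and> (g has_field_derivative g' x) (at x)"
  proof (rule series_and_derivative_comparison_local[OF opn])
    show "(?f k has_field_derivative deriv (?f k) x) (at x)" for k x
      by (rule holomorphic_derivI[of _ UNIV]) (auto intro!: holomorphic_intros)
    fix x :: complex assume x: "x \<in> ?S"
    define a where "a = Re x / 2"
    define C where "C = (\<Sum>j=1..n. norm (h j)) * real n * (norm x + a)"
    have a: "a > 0" using x by (simp add: a_def)
    have "summable (\<lambda>k. real (Suc k) powr (- a - 1))"
      using a by (subst summable_Suc_iff[where f = "\<lambda>k. real k powr (- a - 1)"]) (simp add: summable_real_powr_iff)
    then have "summable (\<lambda>k. C * real (Suc k) powr (- a - 1))" by (rule summable_mult)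
    moreover have "norm (?f k y) \<le> C * real (Suc k) powr (- a - 1)" if y: "y \<in> ball x a \<inter> ?S" for k y
    proof -
      have d: "norm (x - y) < a" using y by (simp add: dist_norm)
      have "\<bar>Re x - Re y\<bar> < a" using d abs_Re_le_cmod[of "x - y"] by simp
      then have ry: "Re y \<ge> a" by (simp add: a_def abs_if split: if_splits)
      have ny: "norm y \<le> norm x + a" using d norm_triangle_sub[of y x] by (simp add: norm_minus_commute)
      have "norm (?f k y) \<le> (\<Sum>j=1..n. norm (h j)) * real n * norm y * real (Suc k) powr (- Re y - 1)"
        using y by (intro periodic_L_block_bound[OF n h0]) auto
      also have "\<dots> \<le> (\<Sum>j=1..n. norm (h j)) * real n * (norm x + a) * real (Suc k) powr (- a - 1)"
        using ny ry a by (intro mult_mono powr_mono) (auto intro!: sum_nonneg mult_nonneg_nonneg)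
      finally show ?thesis by (simp add: C_def)
    qed
    ultimately show "\<exists>d g. 0 < d \<and> summable g \<and> (\<forall>\<^sub>F k in sequentially. \<forall>y\<in>ball x d \<inter> ?S. norm (?f k y) \<le> g k)"
      using a by (intro exI[of _ a] exI[of _ "\<lambda>k. C * real (Suc k) powr (- a - 1)"]) auto
  qed
  then obtain g g' where g: "\<And>x. x \<in> ?S \<Longrightarrow> (\<lambda>k. ?f k x) sums g x"
    and g': "\<And>x. x \<in> ?S \<Longrightarrow> (g has_field_derivative g' x) (at x)" by blast
  have eq: "periodic_L h n x = g x" if "x \<in> ?S" for x
    using sums_unique[OF g[OF that]] by (simp add: periodic_L_def)
  show "(\<lambda>k. \<Sum>j=1..n. h j * of_nat (k * n + j) powr (-s)) sums periodic_L h n s" if "0 < Re s" for s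
    using g[of s] eq[of s] that by simp
  have "g holomorphic_on ?S" using g' opn by (auto simp: holomorphic_on_open)
  then show "periodic_L h n holomorphic_on ?S" by (rule holomorphic_transform) (simp add: eq)
qed

lemma sum_blocks:
  fixes a :: "nat \<Rightarrow> 'a::comm_monoid_add"
  shows "(\<Sum>k<K. \<Sum>j=1..n. a (k * n + j)) = (\<Sum>m=1..K * n. a m)"
proof (induction K)
  case (Suc K)
  have "(\<Sum>m=1..K * n + n. a m) = (\<Sum>m=1..K * n. a m) + (\<Sum>m=K * n + 1..K * n + n. a m)"
    by (rule sum.ub_add_nat) simp
  also have "(\<Sum>m=K * n + 1..K * n + n. a m) = (\<Sum>j=1..n. a (K * n + j))"
    using sum.shift_bounds_cl_nat_ivl[of a 1 "K * n" n] by (simp add: add.commute)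
  finally show ?case using Suc by (simp add: add.commute)
qed simp

text \<open>Block sums are a subsequence of the partial sums, so they have the same limit, also at points of
  conditional convergence.\<close>
lemma periodic_L_eq_limit:
  assumes n: "0 < n" and per: "\<And>m. h (m + n) = h m"
    and lim: "(\<lambda>N. \<Sum>m=1..N. h m * of_nat m powr (-s)) \<longlonglongrightarrow> l"
  shows "periodic_L h n s = l"
proof -
  have per': "h (k * n + j) = h j" for k j
    using periodic_mod[of h n "k * n + j"] periodic_mod[of h n j] per by simp
  have "strict_mono (\<lambda>K. K * n)" using n by (simp add: strict_mono_def)
  then have "(\<lambda>K. \<Sum>m=1..K * n. h m * of_nat m powr (-s)) \<longlonglongrightarrow> l"
    using LIMSEQ_subseq_LIMSEQ[OF lim, of "\<lambda>K. K * n"] by (simp add: o_def)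
  then have "(\<lambda>K. \<Sum>k<K. \<Sum>j=1..n. h j * of_nat (k * n + j) powr (-s)) \<longlonglongrightarrow> l"
    using sum_blocks[of "\<lambda>m. h m * of_nat m powr (-s)" n] per' by simp
  then show ?thesis by (simp add: periodic_L_def sums_def sums_unique[symmetric] flip: sums_def)
qed

lemma summable_bounded_dirichlet:
  fixes h :: "nat \<Rightarrow> complex"
  assumes "\<And>m. norm (h m) \<le> B" "1 < Re s"
  shows "summable (\<lambda>m. norm (h m * of_nat m powr (-s)))"
proof (rule summable_comparison_test')
  show "summable (\<lambda>m. B * real m powr (- Re s))"
    using assms by (intro summable_mult) (simp add: summable_real_powr_iff)
  have "B \<ge> 0" using assms(1)[of 0] norm_ge_zero order_trans by blast
  then show "norm (norm (h m * of_nat m powr (-s))) \<le> B * real m powr (- Re s)" if "m \<ge> 0" for m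
    using assms by (cases "m = 0") (auto simp: norm_mult norm_of_nat_powr intro!: mult_right_mono)
qed

lemma sums_imp_LIMSEQ_1:
  fixes a :: "nat \<Rightarrow> 'a::real_normed_vector"
  assumes "a sums l" "a 0 = 0"
  shows "(\<lambda>N. \<Sum>m=1..N. a m) \<longlonglongrightarrow> l"
proof -
  have "(\<Sum>m=1..N. a m) = (\<Sum>m\<le>N. a m)" for N
    using assms(2) by (intro sum.mono_neutral_left) (auto simp: not_less_eq_eq)
  then show ?thesis using assms(1) by (simp add: sums_def_le)
qed

lemma periodic_bounded:
  fixes h :: "nat \<Rightarrow> complex"
  assumes n: "0 < n" and per: "\<And>m. h (m + n) = h m"
  shows "norm (h m) \<le> (\<Sum>j<n. norm (h j))"
proof -
  have "h m = h (m mod n)" using per by (rule periodic_mod)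
  moreover have "norm (h (m mod n)) \<le> (\<Sum>j<n. norm (h j))"
    using n by (intro member_le_sum) auto
  ultimately show ?thesis by simp
qed

lemma periodic_L_eq_suminf:
  assumes n: "0 < n" and per: "\<And>m. h (m + n) = h m" and s: "1 < Re s"
  shows "periodic_L h n s = (\<Sum>m. h m * of_nat m powr (-s))"
proof (rule periodic_L_eq_limit[OF n])
  show "h (m + n) = h m" for m by (rule per)
  have "summable (\<lambda>m. h m * of_nat m powr (-s))"
    using summable_norm_cancel[OF summable_bounded_dirichlet[OF periodic_bounded[where h = h, OF n] s]] per .
  then show "(\<lambda>N. \<Sum>m=1..N. h m * of_nat m powr (-s)) \<longlonglongrightarrow> (\<Sum>m. h m * of_nat m powr (-s))"
    by (intro sums_imp_LIMSEQ_1 summable_sums) auto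
qed

lemma periodic_L_cnj:
  assumes n: "0 < n" and h0: "(\<Sum>j=1..n. h j) = 0" and s: "0 < Re s"
  shows "periodic_L (\<lambda>m. cnj (h m)) n (cnj s) = cnj (periodic_L h n s)"
proof -
  have "(\<lambda>k. cnj (\<Sum>j=1..n. h j * of_nat (k * n + j) powr (-s))) sums cnj (periodic_L h n s)"
    using periodic_L_sums_holomorphic(1)[OF n h0 s] by (simp only: sums_cnj)
  moreover have "cnj (\<Sum>j=1..n. h j * of_nat (k * n + j) powr (-s))
      = (\<Sum>j=1..n. cnj (h j) * of_nat (k * n + j) powr (- cnj s))" for k
    by (simp add: cnj_powr)
  ultimately show ?thesis by (simp add: periodic_L_def sums_iff)
qed

section \<open>Newman's Tauberian theorem\<close>

lemma powr_diff_mvt: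
  fixes p :: real
  assumes "0 < a" "a < b"
  obtains \<xi> where "a < \<xi>" "\<xi> < b" "b powr p - a powr p = (b - a) * (p * \<xi> powr (p - 1))"
proof -
  have "\<exists>\<xi>. a < \<xi> \<and> \<xi> < b \<and> b powr p - a powr p = (b - a) * (p * \<xi> powr (p - 1))"
    using assms by (intro MVT2) (auto intro!: has_real_derivative_powr)
  then show ?thesis using that by blast
qed

text \<open>Each term is at most the increment of $-t^{-x}/x$ over the preceding unit interval, and these
  increments telescope.\<close>
lemma powr_tail_sum_le:
  assumes "0 < x" "0 < N" "N \<le> M"
  shows "(\<Sum>m=N+1..M. real m powr (- x - 1)) \<le> (real N powr (-x) - real M powr (-x)) / x"
  using \<open>N \<le> M\<close>
proof (induction M rule: dec_induct)
  case (step M)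
  have M: "0 < real M" using step assms by simp
  obtain \<xi> where \<xi>: "real M < \<xi>" "\<xi> < real M + 1"
      "(real M + 1) powr (-x) - real M powr (-x) = (real M + 1 - real M) * (-x * \<xi> powr (-x - 1))"
    using powr_diff_mvt[OF M, of "real M + 1" "-x"] by (auto simp del: of_nat_Suc)
  have "(real M + 1) powr (- x - 1) \<le> \<xi> powr (- x - 1)"
    using \<xi> M assms by (intro powr_mono2') auto
  also have "\<dots> = (real M powr (-x) - (real M + 1) powr (-x)) / x"
    using \<xi>(3) assms by (simp add: field_simps)
  finally have "(real M + 1) powr (- x - 1) \<le> (real M powr (-x) - (real M + 1) powr (-x)) / x" .
  then show ?case using step by (simp add: diff_divide_distrib add.commute)
qed simp

text \<open>Comparison with the increments of $t^x/x$. For $x < 1$ the summand decreases and the extra $1/N$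
  is slack; for $x \ge 1$ it increases, the increments bound the sum up to $N-1$, and $1/N$ pays for
  the last term.\<close>
lemma powr_head_sum_le:
  assumes "0 < x" "0 < N"
  shows "(\<Sum>m=1..N. real m powr (x - 1)) \<le> real N powr x * (1 / real N + 1 / x)"
proof (cases "x \<ge> 1")
  case True
  have "(\<Sum>m=1..N. real m powr (x - 1)) \<le> real N powr x / x + real N powr (x - 1)"
    using \<open>0 < N\<close>
  proof (induction N rule: nat_induct_non_zero)
    case (Suc N)
    have N: "0 < real N" using Suc by simp
    obtain \<xi> where \<xi>: "real N < \<xi>" "\<xi> < real N + 1"
        "(real N + 1) powr x - real N powr x = (real N + 1 - real N) * (x * \<xi> powr (x - 1))"
      using powr_diff_mvt[OF N, of "real N + 1" x] by auto
    have "real N powr (x - 1) \<le> \<xi> powr (x - 1)" using \<xi> N True by (intro powr_mono2) auto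
    also have "\<dots> = ((real N + 1) powr x - real N powr x) / x"
      using \<xi>(3) assms by (simp add: field_simps)
    finally show ?case using Suc by (simp add: diff_divide_distrib add.commute)
  qed (use True in simp)
  then show ?thesis using assms by (simp add: field_simps powr_diff)
next
  case False
  have "(\<Sum>m=1..N. real m powr (x - 1)) \<le> real N powr x / x"
    using \<open>0 < N\<close>
  proof (induction N rule: nat_induct_non_zero)
    case (Suc N)
    have N: "0 < real N" using Suc by simp
    obtain \<xi> where \<xi>: "real N < \<xi>" "\<xi> < real N + 1"
        "(real N + 1) powr x - real N powr x = (real N + 1 - real N) * (x * \<xi> powr (x - 1))"
      using powr_diff_mvt[OF N, of "real N + 1" x] by auto
    have "(real N + 1) powr (x - 1) \<le> \<xi> powr (x - 1)" using \<xi> N False by (intro powr_mono2') auto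
    also have "\<dots> = ((real N + 1) powr x - real N powr x) / x"
      using \<xi>(3) assms by (simp add: field_simps)
    finally show ?case using Suc by (simp add: diff_divide_distrib add.commute)
  qed (use False assms in simp)
  also have "\<dots> \<le> real N powr x * (1 / real N + 1 / x)" using assms by (simp add: field_simps)
  finally show ?thesis .
qed

text \<open>Cauchy's formula for a closed contour made of the right half of a circle and a return path $B$
  through the complement of the positive real axis. No winding number has to be computed: the two
  halves contribute $i\pi$ each to $\oint dz/z$, by the primitives $\mathrm{Ln}\, z$ on the right and
  $\mathrm{Ln}(-z)$ on the left, and the rest is Cauchy's theorem for $(H(z) - H(0))/z$.\<close>
lemma Cauchy_formula_two_halves:
  assumes R: "0 < R" and U: "open U" "convex U" "0 \<in> U" and H: "H holomorphic_on U"
    and A: "path_image (part_circlepath 0 R (-(pi/2)) (pi/2)) \<subseteq> U"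
    and B: "valid_path B" "path_image B \<subseteq> U - \<real>\<^sub>\<ge>\<^sub>0" "pathstart B = \<i> * R" "pathfinish B = - \<i> * R"
  shows "contour_integral (part_circlepath 0 R (-(pi/2)) (pi/2)) (\<lambda>z. H z / z) + contour_integral B (\<lambda>z. H z / z)
           = 2 * pi * \<i> * H 0"
proof -
  let ?A = "part_circlepath 0 R (-(pi/2)) (pi/2)"
  have Aends: "pathstart ?A = - \<i> * R" "pathfinish ?A = \<i> * R"
  proof -
    have "exp (\<i> * of_real (pi/2)) = \<i>" "exp (\<i> * of_real (-(pi/2))) = -\<i>"
      unfolding cis_conv_exp[symmetric] by (auto simp: complex_eq_iff)
    then show "pathstart ?A = - \<i> * R" "pathfinish ?A = \<i> * R" by (auto simp: mult.commute)
  qed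
  have Aim: "path_image ?A \<subseteq> - \<real>\<^sub>\<le>\<^sub>0"
  proof
    fix z assume z: "z \<in> path_image ?A"
    then obtain t where t: "-(pi/2) \<le> t" "t \<le> pi/2" "z = R * cis t"
      unfolding path_image_part_circlepath' by (auto simp: closed_segment_eq_real_ivl)
    have "Re z \<ge> 0" using t R by (simp add: cos_ge_zero)
    moreover have "z \<noteq> 0" using t R by auto
    ultimately show "z \<in> - \<real>\<^sub>\<le>\<^sub>0" by (auto simp: complex_nonpos_Reals_iff complex_eq_iff)
  qed
  have "((\<lambda>z. 1 / z) has_contour_integral (Ln (pathfinish ?A) - Ln (pathstart ?A))) ?A"
  proof (rule contour_integral_primitive[OF _ _ Aim])
    show "(Ln has_field_derivative 1 / z) (at z within - \<real>\<^sub>\<le>\<^sub>0)" if "z \<in> - \<real>\<^sub>\<le>\<^sub>0" for z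
      using that by (intro has_field_derivative_at_within[OF has_field_derivative_Ln[THEN DERIV_cong]]) (auto simp: inverse_eq_divide)
  qed simp
  moreover have "((\<lambda>z. 1 / z) has_contour_integral (Ln (- pathfinish B) - Ln (- pathstart B))) B"
  proof (rule contour_integral_primitive[where S = "- \<real>\<^sub>\<ge>\<^sub>0"])
    show "((\<lambda>z. Ln (-z)) has_field_derivative 1 / z) (at z within - \<real>\<^sub>\<ge>\<^sub>0)" if "z \<in> - \<real>\<^sub>\<ge>\<^sub>0" for z
    proof -
      have "-z \<notin> \<real>\<^sub>\<le>\<^sub>0" "z \<noteq> 0" using that by (auto simp: complex_nonpos_Reals_iff complex_nonneg_Reals_iff)
      then show ?thesis by (auto intro!: derivative_eq_intros simp: field_simps)
    qed
  qed (use B in auto)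
  ultimately have one: "((\<lambda>z. 1 / z) has_contour_integral (\<i> * pi + \<i> * pi)) (?A +++ B)"
  proof -
    have 1: "Ln (\<i> * R) = \<i> * pi / 2 + ln R" "Ln (- (\<i> * R)) = - (\<i> * pi / 2) + ln R"
      using R Ln_times_of_real[of R "\<i>"] Ln_times_of_real[of R "-\<i>"] by (auto simp: mult.commute Ln_of_real)
    assume "((\<lambda>z. 1 / z) has_contour_integral (Ln (pathfinish ?A) - Ln (pathstart ?A))) ?A"
      "((\<lambda>z. 1 / z) has_contour_integral (Ln (- pathfinish B) - Ln (- pathstart B))) B"
    from has_contour_integral_join[OF this] B(1) show ?thesis
      unfolding Aends B(3,4) by (simp add: 1)
  qed
  define iA where "iA = contour_integral ?A (\<lambda>z. H z / z)"
  define iB where "iB = contour_integral B (\<lambda>z. H z / z)"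
  have hol: "(\<lambda>z. H z / z) holomorphic_on U - {0}"
    by (intro holomorphic_intros holomorphic_on_subset[OF H]) auto
  have opn: "open (U - {0})" using U by auto
  have A0: "path_image ?A \<subseteq> U - {0}" and B0: "path_image B \<subseteq> U - {0}" using A Aim B by auto
  have "((\<lambda>z. H z / z) has_contour_integral iA) ?A" "((\<lambda>z. H z / z) has_contour_integral iB) B"
    unfolding iA_def iB_def using A0 B0 B(1)
    by (auto intro!: has_contour_integral_integral contour_integrable_holomorphic_simple[OF hol opn])
  from has_contour_integral_join[OF this] B(1)
  have 1: "((\<lambda>z. H z / z) has_contour_integral (iA + iB)) (?A +++ B)" by simp
  have 2: "((\<lambda>z. H z / z - H 0 * (1 / z)) has_contour_integral (iA + iB - H 0 * (\<i> * pi + \<i> * pi))) (?A +++ B)"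
    by (intro has_contour_integral_diff has_contour_integral_lmul 1 one)
  have "(\<lambda>z. if z = 0 then deriv H 0 else H z / z - H 0 / (z - 0)) holomorphic_on U"
    by (rule pole_theorem_open[OF H U(1)]) auto
  then have 3: "((\<lambda>z. if z = 0 then deriv H 0 else H z / z - H 0 / (z - 0)) has_contour_integral 0) (?A +++ B)"
    by (rule Cauchy_theorem_convex_simple) (use U A B Aends in \<open>auto simp: valid_path_join path_image_join\<close>)
  have "((\<lambda>z. H z / z - H 0 * (1 / z)) has_contour_integral 0) (?A +++ B)"
    using A0 B0 Aends B by (intro has_contour_integral_eq[OF 3]) (auto simp: path_image_join)
  from has_contour_integral_unique[OF this 2] show ?thesis
    unfolding iA_def[symmetric] iB_def[symmetric] by (simp add: algebra_simps)
qed


text \<open>On the circle $|z| = R$ Newman's kernel $1/z + z/R^2$ equals $2\,\mathrm{Re}\,z/R^2$. It vanishes at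
  $\pm iR$, which cancels the factor $1/\mathrm{Re}\,z$ in the bounds for the head and the tail of the
  series.\<close>
lemma Newman_kernel:
  assumes "norm z = R" "0 < R"
  shows "norm ((1 + z\<^sup>2 / (of_real R)\<^sup>2) / z) = 2 * \<bar>Re z\<bar> / R\<^sup>2"
proof -
  have z0: "z \<noteq> 0" using assms by auto
  have "z * cnj z = (of_real R)\<^sup>2" using assms complex_norm_square[of z] by simp
  then have "(1 + z\<^sup>2 / (of_real R)\<^sup>2) / z = (z + cnj z) / (of_real R)\<^sup>2"
    using z0 assms by (simp add: field_simps power2_eq_square)
  also have "\<dots> = of_real (2 * Re z / R\<^sup>2)" by (simp add: complex_add_cnj)
  finally show ?thesis by (simp only: norm_of_real) (simp add: abs_mult)
qed

lemma part_circlepath_Re_sign: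
  assumes "0 < R"
  shows "z \<in> path_image (part_circlepath 0 R (-(pi/2)) (pi/2)) \<Longrightarrow> norm z = R \<and> Re z \<ge> 0 \<and> (Re z = 0 \<longrightarrow> z \<in> {\<i> * R, - \<i> * R})"
    and "z \<in> path_image (part_circlepath 0 R (pi/2) (3*pi/2)) \<Longrightarrow> norm z = R \<and> Re z \<le> 0 \<and> (Re z = 0 \<longrightarrow> z \<in> {\<i> * R, - \<i> * R})"
proof -
  have edge: "z \<in> {\<i> * R, - \<i> * R}" if "norm z = R" "Re z = 0" for z
  proof -
    have "\<bar>Im z\<bar> = R" using that by (simp add: cmod_def)
    then show ?thesis using that by (auto simp: complex_eq_iff abs_if split: if_splits)
  qed
  show "norm z = R \<and> Re z \<ge> 0 \<and> (Re z = 0 \<longrightarrow> z \<in> {\<i> * R, - \<i> * R})" if z: "z \<in> path_image (part_circlepath 0 R (-(pi/2)) (pi/2))"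
  proof -
    obtain t where t: "-(pi/2) \<le> t" "t \<le> pi/2" "z = R * cis t"
      using z unfolding path_image_part_circlepath' by (auto simp: closed_segment_eq_real_ivl)
    have "norm z = R" "Re z \<ge> 0" using t assms by (auto simp: norm_mult cos_ge_zero)
    then show ?thesis using edge by blast
  qed
  show "norm z = R \<and> Re z \<le> 0 \<and> (Re z = 0 \<longrightarrow> z \<in> {\<i> * R, - \<i> * R})" if z: "z \<in> path_image (part_circlepath 0 R (pi/2) (3*pi/2))"
  proof -
    obtain t where t: "pi/2 \<le> t" "t \<le> 3*pi/2" "z = R * cis t"
      using z unfolding path_image_part_circlepath' by (auto simp: closed_segment_eq_real_ivl)
    have "cos t \<le> 0" using cos_ge_zero[of "t - pi"] t by (simp add: cos_diff)
    then have "norm z = R" "Re z \<le> 0" using t assms by (auto simp: norm_mult mult_nonneg_nonpos)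
    then show ?thesis using edge by blast
  qed
qed

lemma norm_dirichlet_term_le:
  assumes "norm c \<le> 1" "0 < m"
  shows "norm (c * of_nat m powr (-(1 + z)) :: complex) \<le> real m powr (- Re z - 1)"
proof -
  have "Re (-(1 + z)) = - Re z - 1" by simp
  then have "norm (of_nat m powr (-(1 + z)) :: complex) = real m powr (- Re z - 1)"
    using norm_of_nat_powr[OF assms(2), of "-(1 + z)"] by (simp only:)
  then show ?thesis using assms(1) by (simp only: norm_mult mult_left_le_one_le norm_ge_zero powr_ge_zero)
qed

lemma dirichlet_tail_bound:
  fixes a :: "nat \<Rightarrow> complex"
  assumes a: "\<And>m. norm (a m) \<le> 1" and x: "0 < Re z" and N: "0 < N"
  shows "norm ((\<Sum>m. a m * of_nat m powr (-(1 + z))) - (\<Sum>m=1..N. a m * of_nat m powr (-(1 + z)))) \<le> real N powr (- Re z) / Re z"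
proof -
  let ?t = "\<lambda>m. a m * of_nat m powr (-(1 + z))"
  have "summable (\<lambda>m. norm (?t m))" by (rule summable_bounded_dirichlet[OF a]) (use x in simp)
  then have "summable ?t" by (rule summable_norm_cancel)
  then have lim: "(\<lambda>M. \<Sum>m=1..M. ?t m) \<longlonglongrightarrow> (\<Sum>m. ?t m)"
    by (intro sums_imp_LIMSEQ_1 summable_sums) auto
  have "(\<lambda>M. norm ((\<Sum>m=1..M. ?t m) - (\<Sum>m=1..N. ?t m))) \<longlonglongrightarrow> norm ((\<Sum>m. ?t m) - (\<Sum>m=1..N. ?t m))"
    by (intro tendsto_intros lim)
  moreover have "norm ((\<Sum>m=1..M. ?t m) - (\<Sum>m=1..N. ?t m)) \<le> real N powr (- Re z) / Re z" if "M \<ge> N" for M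
  proof -
    have "(\<Sum>m=1..M. ?t m) = (\<Sum>m=1..N. ?t m) + (\<Sum>m=N+1..M. ?t m)"
      using sum.ub_add_nat[of 1 N ?t "M - N"] that by simp
    then have "norm ((\<Sum>m=1..M. ?t m) - (\<Sum>m=1..N. ?t m)) = norm (\<Sum>m=N+1..M. ?t m)" by simp
    also have "\<dots> \<le> (\<Sum>m=N+1..M. real m powr (- Re z - 1))"
    proof (rule sum_norm_le)
      fix m assume "m \<in> {N+1..M}"
      then show "norm (?t m) \<le> real m powr (- Re z - 1)"
        by (intro norm_dirichlet_term_le a) auto
    qed
    also have "\<dots> \<le> (real N powr (- Re z) - real M powr (- Re z)) / Re z"
      by (rule powr_tail_sum_le[OF x N that])
    also have "\<dots> \<le> real N powr (- Re z) / Re z" using x by (intro divide_right_mono) auto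
    finally show ?thesis .
  qed
  ultimately show ?thesis
    by (intro LIMSEQ_le_const2[of "\<lambda>M. norm ((\<Sum>m=1..M. ?t m) - (\<Sum>m=1..N. ?t m))"]) auto
qed

lemma dirichlet_head_bound:
  fixes a :: "nat \<Rightarrow> complex"
  assumes a: "\<And>m. norm (a m) \<le> 1" and x: "Re z < 0" and N: "0 < N"
  shows "norm (\<Sum>m=1..N. a m * of_nat m powr (-(1 + z))) \<le> real N powr (- Re z) * (1 / real N + 1 / (- Re z))"
proof -
  have "norm (\<Sum>m=1..N. a m * of_nat m powr (-(1 + z))) \<le> (\<Sum>m=1..N. real m powr (- Re z - 1))"
  proof (rule sum_norm_le)
    fix m assume "m \<in> {1..N}"
    then show "norm (a m * of_nat m powr (-(1 + z))) \<le> real m powr (- Re z - 1)"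
      by (intro norm_dirichlet_term_le a) auto
  qed
  also have "\<dots> \<le> real N powr (- Re z) * (1 / real N + 1 / (- Re z))"
    using x N by (intro powr_head_sum_le) auto
  finally show ?thesis .
qed

text \<open>From $u \le e^u$ with $u = t \ln L$.\<close>
lemma Newman_left_decay:
  fixes t L :: real
  assumes "0 \<le> t" "1 < L"
  shows "t * exp (- t * ln L) \<le> 1 / ln L"
proof -
  have "t * ln L \<le> exp (t * ln L)" using exp_ge_add_one_self[of "t * ln L"] by linarith
  then have "t * ln L * exp (- t * ln L) \<le> 1" by (simp add: exp_minus field_simps)
  then show ?thesis using assms by (simp add: field_simps)
qed

text \<open>Write $S_N$ for the partial sum and integrate $F(1+z)\,N^z (1/z + z/R^2)$ over a right half circle
  closed by three segments inside the region of holomorphy, and the same with $S_N(1+z)$ over the full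
  circle. On the right half circle the difference is the tail of the series, on the left half circle
  $S_N$ is the head; both integrands are $O(1/R^2)$, so these parts contribute $O(1/R)$. On the segments the integrand tends to $0$ uniformly as
  $N \to \infty$: away from the imaginary axis because of $N^z$, near $\pm iR$ because the kernel has
  zeros there.\<close>
lemma Newman_estimate:
  fixes a :: "nat \<Rightarrow> complex"
  assumes a: "\<And>m. norm (a m) \<le> 1"
    and F: "F holomorphic_on S" "open S" "{s. 1 \<le> Re s} \<subseteq> S"
    and Feq: "\<And>s. 1 < Re s \<Longrightarrow> F s = (\<Sum>m. a m * of_nat m powr (-s))"
    and R: "0 < R"
  shows "\<exists>E. E \<longlonglongrightarrow> 0 \<and> (\<forall>N\<ge>2. norm (F 1 - (\<Sum>m=1..N. a m * of_nat m powr (-1))) \<le> 2 / R + E N)"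
proof -
  define f where "f = (\<lambda>z. F (1 + z))"
  define T where "T = (\<lambda>z. 1 + z) -` S"
  have opT: "open T" unfolding T_def by (intro open_vimage F(2) continuous_intros)
  have holf: "f holomorphic_on T" unfolding f_def T_def
    by (rule holomorphic_on_compose_gen[OF _ F(1), unfolded o_def]) (auto intro!: holomorphic_intros)
  have T0: "z \<in> T" if "0 \<le> Re z" for z using F(3) that by (auto simp: T_def)
  \<comment> \<open>A whole strip around the segment lies in the region of holomorphy, by compactness.\<close>
  let ?K = "closed_segment (- (R + 1) * \<i>) ((R + 1) * \<i>)"
  have "?K \<subseteq> T" using T0 by (auto simp: closed_segment_same_Re)
  then obtain e where e: "e > 0" "(\<Union>x\<in>?K. ball x e) \<subseteq> T"
    using compact_subset_open_imp_ball_epsilon_subset[OF compact_segment opT] by blast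
  define U where "U = {z. -e < Re z} \<inter> {z. -(R + 1) < Im z} \<inter> {z. Im z < R + 1}"
  have U: "open U" "convex U" "0 \<in> U"
    using R e(1) by (auto simp: U_def intro!: open_Int open_halfspace_Re_gt open_halfspace_Im_gt open_halfspace_Im_lt
        convex_Int convex_halfspace_Re_gt convex_halfspace_Im_gt convex_halfspace_Im_lt)
  have UT: "U \<subseteq> T"
  proof
    fix z assume z: "z \<in> U"
    show "z \<in> T"
    proof (cases "Re z \<ge> 0")
      case False
      have "Complex 0 (Im z) \<in> ?K"
        using z R by (simp add: closed_segment_same_Re closed_segment_eq_real_ivl U_def)
      moreover have "z \<in> ball (Complex 0 (Im z)) e"
      proof -
        have "Complex 0 (Im z) - z = - of_real (Re z)" by (simp add: complex_eq_iff)
        then show ?thesis using z False by (simp add: dist_norm U_def)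
      qed
      ultimately show ?thesis using e(2) by blast
    qed (rule T0)
  qed
  have holfU: "f holomorphic_on U" using holf UT by (rule holomorphic_on_subset)
  define \<delta> where "\<delta> = e / 2"
  have \<delta>: "0 < \<delta>" "\<delta> < e" using e by (auto simp: \<delta>_def)
  define A where "A = part_circlepath 0 R (-(pi/2)) (pi/2)"
  define A' where "A' = part_circlepath 0 R (pi/2) (3*pi/2)"
  \<comment> \<open>The corners of the return path: the segments run from $iR$ through $p$ and $q$ to $-iR$.\<close>
  define p q where "p = Complex (-\<delta>) R" and "q = Complex (-\<delta>) (-R)"
  define B where "B = linepath (\<i> * R) p +++ (linepath p q +++ linepath q (- \<i> * R))"
  have pA: "norm z = R \<and> Re z \<ge> 0 \<and> (Re z = 0 \<longrightarrow> z \<in> {\<i> * R, - \<i> * R})" if "z \<in> path_image A" for z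
    using part_circlepath_Re_sign(1)[OF R] that unfolding A_def by blast
  have pA': "norm z = R \<and> Re z \<le> 0 \<and> (Re z = 0 \<longrightarrow> z \<in> {\<i> * R, - \<i> * R})" if "z \<in> path_image A'" for z
    using part_circlepath_Re_sign(2)[OF R] that unfolding A'_def by blast
  have AU: "path_image A \<subseteq> U"
  proof
    fix z assume "z \<in> path_image A"
    from pA[OF this] show "z \<in> U" using e(1) abs_Im_le_cmod[of z] by (auto simp: U_def)
  qed
  have B_ends: "pathstart B = \<i> * R" "pathfinish B = - \<i> * R" by (simp_all add: B_def)
  have valB: "valid_path B" by (simp add: B_def valid_path_join)
  have s1: "closed_segment (\<i> * R) p = {z. Im z = R \<and> Re z \<in> {-\<delta>..0}}"
    using \<delta> by (subst closed_segment_same_Im) (auto simp: p_def closed_segment_eq_real_ivl)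
  have s2: "closed_segment p q = {z. Re z = -\<delta> \<and> Im z \<in> {-R..R}}"
    using R by (subst closed_segment_same_Re) (auto simp: p_def q_def closed_segment_eq_real_ivl)
  have s3: "closed_segment q (- \<i> * R) = {z. Im z = -R \<and> Re z \<in> {-\<delta>..0}}"
    using \<delta> by (subst closed_segment_same_Im) (auto simp: q_def closed_segment_eq_real_ivl)
  have imB: "path_image B = closed_segment (\<i> * R) p \<union> (closed_segment p q \<union> closed_segment q (- \<i> * R))"
    by (simp add: B_def path_image_join)
  have BU: "path_image B \<subseteq> U - \<real>\<^sub>\<ge>\<^sub>0"
    unfolding imB s1 s2 s3 using \<delta> R by (auto simp: U_def complex_nonneg_Reals_iff)
  have B0: "z \<noteq> 0" if "z \<in> path_image B" for z using BU that by auto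
  have "compact ((\<lambda>z. f z / z) ` path_image B)"
    using BU B0 by (intro compact_continuous_image continuous_intros compact_path_image valid_path_imp_path valB
        holomorphic_on_imp_continuous_on[OF holomorphic_on_subset[OF holfU]]) auto
  then have "bounded ((\<lambda>z. f z / z) ` path_image B)" by (rule compact_imp_bounded)
  then obtain M where M: "M > 0" "\<And>z. z \<in> path_image B \<Longrightarrow> norm (f z / z) \<le> M"
    unfolding bounded_pos by auto
  define \<beta> where "\<beta> = (\<lambda>N::nat. M * ((1 + (\<delta> + R)\<^sup>2 / R\<^sup>2) * real N powr (-\<delta>) + (\<delta> + 2 * R) / R\<^sup>2 * (1 / ln (real N))))"
  have \<beta>0: "\<beta> \<longlonglongrightarrow> 0"
  proof -
    have "(\<lambda>N::nat. real N powr (-\<delta>)) \<longlonglongrightarrow> 0"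
      using \<delta>(1) by (intro tendsto_neg_powr filterlim_real_sequentially) auto
    moreover have "(\<lambda>N::nat. 1 / ln (real N)) \<longlonglongrightarrow> 0" by real_asymp
    ultimately have "\<beta> \<longlonglongrightarrow> M * ((1 + (\<delta> + R)\<^sup>2 / R\<^sup>2) * 0 + (\<delta> + 2 * R) / R\<^sup>2 * 0)"
      unfolding \<beta>_def by (intro tendsto_intros)
    then show ?thesis by simp
  qed
  define S' where "S' = (\<lambda>N z. \<Sum>m=1..N. a m * of_nat m powr (-(1 + z)))"
  define k where "k = (\<lambda>z::complex. 1 + z\<^sup>2 / (of_real R)\<^sup>2)"
  have main: "norm (F 1 - (\<Sum>m=1..N. a m * of_nat m powr (-1))) \<le> 2 / R + (1 / real N + \<beta> N * (2 * \<delta> + 2 * R))"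
    if N: "N \<ge> 2" for N
  proof -
    define H where "H = (\<lambda>z. f z * of_nat N powr z * k z)"
    define G where "G = (\<lambda>z. S' N z * of_nat N powr z * k z)"
    have holH: "H holomorphic_on U" unfolding H_def k_def
      using N R by (intro holomorphic_intros holfU) auto
    have holG: "G holomorphic_on UNIV" unfolding G_def S'_def k_def
      using N R by (intro holomorphic_intros) auto
    have c1: "contour_integral A (\<lambda>z. H z / z) + contour_integral B (\<lambda>z. H z / z) = 2 * pi * \<i> * H 0"
      unfolding A_def
      by (rule Cauchy_formula_two_halves[OF R U holH _ valB BU B_ends]) (use AU in \<open>simp add: A_def\<close>)
    have c2: "contour_integral A (\<lambda>z. G z / z) + contour_integral A' (\<lambda>z. G z / z) = 2 * pi * \<i> * G 0"
      unfolding A_def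
    proof (rule Cauchy_formula_two_halves[OF R open_UNIV convex_UNIV UNIV_I holG])
      show "path_image A' \<subseteq> UNIV - \<real>\<^sub>\<ge>\<^sub>0"
      proof
        fix z assume "z \<in> path_image A'"
        from pA'[OF this] R show "z \<in> UNIV - \<real>\<^sub>\<ge>\<^sub>0"
          by (cases "z = 0") (auto simp: complex_nonneg_Reals_iff complex_eq_iff)
      qed
      have "exp (\<i> * of_real (pi/2)) = \<i>" "exp (\<i> * of_real (3*pi/2)) = -\<i>"
        unfolding cis_conv_exp[symmetric] using cis_mult[of pi "pi/2"] by (auto simp: complex_eq_iff)
      then show "pathstart A' = \<i> * R" "pathfinish A' = - \<i> * R"
        by (auto simp: A'_def mult.commute)
    qed (auto simp: A'_def)
    have H0: "H 0 = F 1" and G0: "G 0 = (\<Sum>m=1..N. a m * of_nat m powr (-1))"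
      using N by (auto simp: H_def G_def k_def f_def S'_def)
    have z0: "0 \<notin> path_image A" "0 \<notin> path_image A'" using pA pA' R by fastforce+
    have intH: "(\<lambda>z. H z / z) contour_integrable_on A"
      by (rule contour_integrable_holomorphic_simple[of _ "U - {0}"])
         (use U AU z0 in \<open>auto intro!: holomorphic_intros holomorphic_on_subset[OF holH] simp: A_def\<close>)
    have intG: "(\<lambda>z. G z / z) contour_integrable_on A" "(\<lambda>z. G z / z) contour_integrable_on A'"
      by (rule contour_integrable_holomorphic_simple[of _ "UNIV - {0}"];
          use z0 in \<open>auto intro!: holomorphic_intros holomorphic_on_subset[OF holG] simp: A_def A'_def\<close>)+
    have intB: "(\<lambda>z. H z / z) contour_integrable_on B"
      by (rule contour_integrable_holomorphic_simple[of _ "U - {0}"])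
         (use U BU valB in \<open>auto intro!: holomorphic_intros holomorphic_on_subset[OF holH]\<close>)
    have nN: "norm (of_nat N powr z :: complex) = real N powr Re z" for z
      using N by (intro norm_of_nat_powr) auto
    \<comment> \<open>The end points of the arc are excluded: there the bound for the tail divides by zero.\<close>
    have bA: "norm (contour_integral A (\<lambda>z. H z / z - G z / z)) \<le> 2 / R\<^sup>2 * R * (pi/2 - (-(pi/2)))"
      unfolding A_def
    proof (rule contour_integral_bound_part_circlepath_strong[where k = "{\<i> * R, - \<i> * R}"])
      show "(\<lambda>z. H z / z - G z / z) contour_integrable_on part_circlepath 0 R (-(pi/2)) (pi/2)"
        using contour_integrable_diff[OF intH intG(1)] by (simp add: A_def)
      fix z assume "z \<in> path_image (part_circlepath 0 R (-(pi/2)) (pi/2)) - {\<i> * R, - \<i> * R}"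
      then have z: "norm z = R" "Re z > 0" using pA[of z] by (auto simp: A_def less_le)
      have "f z = (\<Sum>m. a m * of_nat m powr (-(1 + z)))" unfolding f_def by (rule Feq) (use z in simp)
      then have 1: "norm (f z - S' N z) \<le> real N powr (- Re z) / Re z"
        unfolding S'_def using dirichlet_tail_bound[OF a z(2), of N] N by simp
      have "H z / z - G z / z = (f z - S' N z) * of_nat N powr z * (k z / z)"
        by (simp add: H_def G_def algebra_simps diff_divide_distrib)
      also have "norm \<dots> = norm (f z - S' N z) * real N powr Re z * (2 * Re z / R\<^sup>2)"
      proof -
        have "norm (k z / z) = 2 * Re z / R\<^sup>2" using Newman_kernel[OF z(1) R] z(2) by (simp add: k_def)
        then show ?thesis by (simp only: norm_mult nN)
      qed
      also have "\<dots> \<le> real N powr (- Re z) / Re z * real N powr Re z * (2 * Re z / R\<^sup>2)"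
        using 1 z by (intro mult_right_mono) auto
      also have "\<dots> = 2 / R\<^sup>2" using z N by (simp add: powr_minus field_simps)
      finally show "norm (H z / z - G z / z) \<le> 2 / R\<^sup>2" .
    qed (use R in auto)
    have bA': "norm (contour_integral A' (\<lambda>z. G z / z)) \<le> (2 / R\<^sup>2 + 2 / (real N * R)) * R * (3*pi/2 - pi/2)"
      unfolding A'_def
    proof (rule contour_integral_bound_part_circlepath_strong[where k = "{\<i> * R, - \<i> * R}"])
      show "(\<lambda>z. G z / z) contour_integrable_on part_circlepath 0 R (pi/2) (3*pi/2)"
        using intG(2) by (simp add: A'_def)
      fix z assume "z \<in> path_image (part_circlepath 0 R (pi/2) (3*pi/2)) - {\<i> * R, - \<i> * R}"
      then have z: "norm z = R" "Re z < 0" using pA'[of z] by (auto simp: A'_def less_le)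
      have xR: "- Re z \<le> R" using z abs_Re_le_cmod[of z] by auto
      have 1: "norm (S' N z) \<le> real N powr (- Re z) * (1 / real N + 1 / (- Re z))"
        unfolding S'_def using dirichlet_head_bound[OF a z(2), of N] N by simp
      have "G z / z = S' N z * of_nat N powr z * (k z / z)" by (simp add: G_def)
      also have "norm \<dots> = norm (S' N z) * real N powr Re z * (2 * (- Re z) / R\<^sup>2)"
      proof -
        have "norm (k z / z) = 2 * (- Re z) / R\<^sup>2" using Newman_kernel[OF z(1) R] z(2) by (simp add: k_def)
        then show ?thesis by (simp only: norm_mult nN)
      qed
      also have "\<dots> \<le> real N powr (- Re z) * (1 / real N + 1 / (- Re z)) * real N powr Re z * (2 * (- Re z) / R\<^sup>2)"
        using 1 z by (intro mult_right_mono divide_nonneg_nonneg) auto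
      also have "\<dots> = 2 / R\<^sup>2 + 2 * (- Re z) / (real N * R\<^sup>2)" using z N R
        by (simp add: powr_minus field_simps)
      also have "\<dots> \<le> 2 / R\<^sup>2 + 2 * R / (real N * R\<^sup>2)" using xR R by (intro add_left_mono divide_right_mono) auto
      also have "2 * R / (real N * R\<^sup>2) = 2 / (real N * R)" using R by (simp add: power2_eq_square)
      finally show "norm (G z / z) \<le> 2 / R\<^sup>2 + 2 / (real N * R)" by simp
    qed (use R in auto)
    have lnN: "ln (real N) > 0" using N by simp
    have \<beta>pos: "0 \<le> \<beta> N" unfolding \<beta>_def using M \<delta> R lnN by (intro mult_nonneg_nonneg add_nonneg_nonneg) auto
    have bnd: "norm (H z / z) \<le> \<beta> N" if z: "z \<in> path_image B" for z
    proof -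
      have eq: "norm (H z / z) = norm (f z / z) * (norm (k z) * real N powr Re z)"
        by (simp add: H_def norm_mult norm_divide nN)
      have "norm (k z) * real N powr Re z \<le> (1 + (\<delta> + R)\<^sup>2 / R\<^sup>2) * real N powr (-\<delta>) + (\<delta> + 2 * R) / R\<^sup>2 * (1 / ln (real N))"
      proof (cases "Re z = -\<delta>")
        case True
        then have "\<bar>Im z\<bar> \<le> R" using z unfolding imB s1 s2 s3 using R by auto
        then have "norm z \<le> \<delta> + R" using cmod_le[of z] True \<delta> by simp
        then have "(norm z)\<^sup>2 \<le> (\<delta> + R)\<^sup>2" by (intro power_mono) auto
        then have "norm (z\<^sup>2 / (of_real R)\<^sup>2) \<le> (\<delta> + R)\<^sup>2 / R\<^sup>2" using R
          by (simp add: norm_divide norm_power divide_right_mono)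
        then have "norm (k z) \<le> 1 + (\<delta> + R)\<^sup>2 / R\<^sup>2"
          unfolding k_def by (intro norm_triangle_le) simp
        then have "norm (k z) * real N powr Re z \<le> (1 + (\<delta> + R)\<^sup>2 / R\<^sup>2) * real N powr (-\<delta>)"
          unfolding True by (intro mult_right_mono) auto
        moreover have "0 \<le> (\<delta> + 2 * R) / R\<^sup>2 * (1 / ln (real N))" using \<delta> R lnN by auto
        ultimately show ?thesis by linarith
      next
        case False
        then have z': "Im z = R \<or> Im z = -R" "-\<delta> \<le> Re z" "Re z \<le> 0" using z unfolding imB s1 s2 s3 by auto
        define t where "t = - Re z"
        have t: "0 \<le> t" "t \<le> \<delta>" using z' by (auto simp: t_def)
        have "(z - \<i> * R) * (z + \<i> * R) = z\<^sup>2 + (of_real R)\<^sup>2" by (simp add: algebra_simps power2_eq_square)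
        then have "k z = (z - \<i> * R) * (z + \<i> * R) / (of_real R)\<^sup>2" using R by (simp add: k_def field_simps)
        then have kz: "norm (k z) = norm (z - \<i> * R) * norm (z + \<i> * R) / R\<^sup>2"
          by (simp add: norm_mult norm_divide norm_power)
        have "norm (z - \<i> * R) * norm (z + \<i> * R) \<le> t * (\<delta> + 2 * R)"
        proof (cases "Im z = R")
          case True
          have "norm (z - \<i> * R) \<le> t" using cmod_le[of "z - \<i> * R"] True z' by (simp add: t_def)
          moreover have "norm (z + \<i> * R) \<le> \<delta> + 2 * R" using cmod_le[of "z + \<i> * R"] True z' R by simp
          ultimately show ?thesis using t by (intro mult_mono) auto
        next
          case False
          then have i: "Im z = -R" using z' by simp
          have "norm (z + \<i> * R) \<le> t" using cmod_le[of "z + \<i> * R"] i z' by (simp add: t_def)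
          moreover have "norm (z - \<i> * R) \<le> \<delta> + 2 * R" using cmod_le[of "z - \<i> * R"] i z' R by simp
          ultimately have "norm (z + \<i> * R) * norm (z - \<i> * R) \<le> t * (\<delta> + 2 * R)" using t by (intro mult_mono) auto
          then show ?thesis by (simp add: mult.commute)
        qed
        then have "norm (k z) \<le> t * (\<delta> + 2 * R) / R\<^sup>2" unfolding kz by (intro divide_right_mono) auto
        then have "norm (k z) * real N powr Re z \<le> t * (\<delta> + 2 * R) / R\<^sup>2 * real N powr Re z"
          by (intro mult_right_mono) auto
        also have "\<dots> = (\<delta> + 2 * R) / R\<^sup>2 * (t * exp (- t * ln (real N)))"
          using N by (simp add: powr_def t_def)
        also have "\<dots> \<le> (\<delta> + 2 * R) / R\<^sup>2 * (1 / ln (real N))"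
          using Newman_left_decay[OF t(1), of "real N"] N \<delta> R by (intro mult_left_mono) auto
        finally have "norm (k z) * real N powr Re z \<le> (\<delta> + 2 * R) / R\<^sup>2 * (1 / ln (real N))" .
        moreover have "0 \<le> (1 + (\<delta> + R)\<^sup>2 / R\<^sup>2) * real N powr (-\<delta>)"
          by (intro mult_nonneg_nonneg add_nonneg_nonneg) auto
        ultimately show ?thesis by linarith
      qed
      then show ?thesis unfolding eq \<beta>_def using M z by (intro mult_mono) auto
    qed
    have bB: "norm (contour_integral B (\<lambda>z. H z / z)) \<le> \<beta> N * (2 * \<delta> + 2 * R)"
    proof -
      let ?h = "\<lambda>z. H z / z"
      have i: "?h contour_integrable_on linepath (\<i> * R) p" "?h contour_integrable_on linepath p q"
          "?h contour_integrable_on linepath q (- \<i> * R)"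
        using intB by (auto simp: B_def)
      have "contour_integral B ?h = contour_integral (linepath (\<i> * R) p) ?h
          + (contour_integral (linepath p q) ?h + contour_integral (linepath q (- \<i> * R)) ?h)"
        unfolding B_def using i by simp
      also have "norm \<dots> \<le> \<beta> N * \<delta> + (\<beta> N * (2 * R) + \<beta> N * \<delta>)"
      proof (intro norm_triangle_mono)
        have n1: "p - \<i> * R = of_real (-\<delta>)" and n2: "q - p = of_real (- 2 * R) * \<i>" and n3: "- \<i> * R - q = of_real \<delta>"
          by (simp_all add: p_def q_def complex_eq_iff)
        have "norm (p - \<i> * R) = \<delta>" unfolding n1 norm_of_real using \<delta> by simp
        then show "norm (contour_integral (linepath (\<i> * R) p) ?h) \<le> \<beta> N * \<delta>"
          using contour_integral_bound_linepath[OF i(1) \<beta>pos] bnd imB by auto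
        have "norm (q - p) = 2 * R" unfolding n2 norm_mult norm_of_real using R by simp
        then show "norm (contour_integral (linepath p q) ?h) \<le> \<beta> N * (2 * R)"
          using contour_integral_bound_linepath[OF i(2) \<beta>pos] bnd imB by auto
        have "norm (- \<i> * R - q) = \<delta>" unfolding n3 norm_of_real using \<delta> by simp
        then show "norm (contour_integral (linepath q (- \<i> * R)) ?h) \<le> \<beta> N * \<delta>"
          using contour_integral_bound_linepath[OF i(3) \<beta>pos] bnd imB by auto
      qed
      finally show ?thesis by (simp add: algebra_simps)
    qed
    have "2 * pi * \<i> * (H 0 - G 0) = contour_integral A (\<lambda>z. H z / z - G z / z) + contour_integral B (\<lambda>z. H z / z)
        - contour_integral A' (\<lambda>z. G z / z)"
      unfolding right_diff_distrib c1[symmetric] c2[symmetric] contour_integral_diff[OF intH intG(1)] by simp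
    then have "norm (2 * pi * \<i> * (H 0 - G 0)) \<le> norm (contour_integral A (\<lambda>z. H z / z - G z / z))
        + norm (contour_integral B (\<lambda>z. H z / z)) + norm (contour_integral A' (\<lambda>z. G z / z))"
      using norm_triangle_ineq norm_triangle_ineq4 by (smt (verit))
    also have "\<dots> \<le> 2 / R\<^sup>2 * R * (pi/2 - (-(pi/2))) + \<beta> N * (2 * \<delta> + 2 * R) + (2 / R\<^sup>2 + 2 / (real N * R)) * R * (3*pi/2 - pi/2)"
      by (intro add_mono bA bB bA')
    also have "\<dots> = 2 * pi * (2 / R + 1 / real N) + \<beta> N * (2 * \<delta> + 2 * R)"
      using R by (simp add: field_simps power2_eq_square)
    finally have "2 * pi * norm (H 0 - G 0) \<le> 2 * pi * (2 / R + 1 / real N) + \<beta> N * (2 * \<delta> + 2 * R)"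
      by (simp add: norm_mult)
    also have "\<dots> \<le> 2 * pi * (2 / R + 1 / real N) + 2 * pi * (\<beta> N * (2 * \<delta> + 2 * R))"
    proof -
      have "0 \<le> \<beta> N * (2 * \<delta> + 2 * R)" using \<beta>pos \<delta> R by auto
      then have "1 * (\<beta> N * (2 * \<delta> + 2 * R)) \<le> 2 * pi * (\<beta> N * (2 * \<delta> + 2 * R))"
        using pi_gt3 by (intro mult_right_mono) auto
      then show ?thesis by simp
    qed
    finally have "2 * pi * norm (H 0 - G 0) \<le> 2 * pi * (2 / R + 1 / real N + \<beta> N * (2 * \<delta> + 2 * R))"
      by (simp only: distrib_left)
    then show ?thesis unfolding H0 G0 by (simp add: add.assoc)
  qed
  have "(\<lambda>N. 1 / real N + \<beta> N * (2 * \<delta> + 2 * R)) \<longlonglongrightarrow> 0 + 0 * (2 * \<delta> + 2 * R)"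
    by (intro tendsto_intros \<beta>0)
  then show ?thesis using main by (intro exI[of _ "\<lambda>N. 1 / real N + \<beta> N * (2 * \<delta> + 2 * R)"]) auto
qed

text \<open>Let first $N$ and then $R$ tend to infinity in the estimate.\<close>
theorem Newman_Tauberian:
  fixes a :: "nat \<Rightarrow> complex"
  assumes a: "\<And>m. norm (a m) \<le> 1"
    and F: "F holomorphic_on S" "open S" "{s. 1 \<le> Re s} \<subseteq> S"
    and Feq: "\<And>s. 1 < Re s \<Longrightarrow> F s = (\<Sum>m. a m * of_nat m powr (-s))"
  shows "(\<lambda>N. \<Sum>m=1..N. a m * of_nat m powr (-1)) \<longlonglongrightarrow> F 1"
proof (rule LIMSEQ_I)
  fix \<epsilon> :: real assume \<epsilon>: "0 < \<epsilon>"
  obtain E where E: "E \<longlonglongrightarrow> 0" "\<And>N. N \<ge> 2 \<Longrightarrow> norm (F 1 - (\<Sum>m=1..N. a m * of_nat m powr (-1))) \<le> 2 / (4 / \<epsilon>) + E N"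
    using Newman_estimate[OF a F Feq, of "4 / \<epsilon>"] \<epsilon> by auto
  obtain N0 where N0: "\<And>N. N \<ge> N0 \<Longrightarrow> norm (E N - 0) < \<epsilon> / 2"
    using LIMSEQ_D[OF E(1), of "\<epsilon> / 2"] \<epsilon> by auto
  show "\<exists>no. \<forall>N\<ge>no. norm ((\<Sum>m=1..N. a m * of_nat m powr (-1)) - F 1) < \<epsilon>"
  proof (intro exI allI impI)
    fix N assume "N \<ge> max N0 2"
    then show "norm ((\<Sum>m=1..N. a m * of_nat m powr (-1)) - F 1) < \<epsilon>"
      using E(2)[of N] N0[of N] \<epsilon> by (simp add: norm_minus_commute)
  qed
qed

section \<open>Landau's theorem and a nonnegative fourfold convolution\<close>

text \<open>With $a_k = 1 + z + \dots + z^k$ and $|z| = 1$ this is the coefficientwise form of Ramanujan's identity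
  \[ \frac{1}{(1-x)^2 (1-zx)(1-\bar z x)} = \frac{1}{1-x^2} \sum_k |a_k|^2 x^k . \]
  The proof multiplies out $a_{i+1} - 1 = z a_i$ with its conjugate, and does the same for $|a_k|^2$.\<close>
lemma Ramanujan_recurrence:
  fixes z :: complex and k :: nat
  assumes z: "norm z = 1"
  defines "a \<equiv> \<lambda>k. \<Sum>i\<le>k. z ^ i"
  defines "c \<equiv> \<lambda>k. \<Sum>i\<le>k. a i * cnj (a (k - i))"
  shows "c (k + 2) = c k + of_real ((norm (a (k + 2)))\<^sup>2)"
proof -
  have zz: "z * cnj z = 1" using z complex_norm_square[of z] by simp
  have aS: "a (Suc i) = 1 + z * a i" for i
    by (simp add: a_def sum_distrib_left sum.atMost_Suc_shift del: sum.atMost_Suc)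
  have prod: "a (Suc i) * cnj (a (Suc j)) = a i * cnj (a j) + a (Suc i) + cnj (a (Suc j)) - 1" for i j
  proof -
    have "(a (Suc i) - 1) * (cnj (a (Suc j)) - 1) = (z * cnj z) * (a i * cnj (a j))"
      by (simp add: aS)
    then show ?thesis by (simp add: zz algebra_simps)
  qed
  have "c (Suc (Suc k)) = a 0 * cnj (a (Suc (Suc k))) + (\<Sum>i\<le>k. a (Suc i) * cnj (a (Suc k - i))) + a (Suc (Suc k)) * cnj (a 0)"
    unfolding c_def by (subst sum.atMost_Suc, subst sum.atMost_Suc_shift) simp
  also have "(\<Sum>i\<le>k. a (Suc i) * cnj (a (Suc k - i))) = (\<Sum>i\<le>k. a i * cnj (a (k - i)) + a (Suc i) + cnj (a (Suc (k - i))) - 1)"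
    by (intro sum.cong refl) (simp add: Suc_diff_le prod)
  also have "\<dots> = c k + (\<Sum>i\<le>k. a (Suc i)) + (\<Sum>i\<le>k. cnj (a (Suc (k - i)))) - (\<Sum>i\<le>k. 1)"
    by (simp add: sum.distrib sum_subtractf c_def)
  also have "(\<Sum>i\<le>k. cnj (a (Suc (k - i)))) = (\<Sum>i\<le>k. cnj (a (Suc i)))"
    by (rule sum.reindex_bij_witness[of _ "\<lambda>i. k - i" "\<lambda>i. k - i"]) auto
  finally have 1: "c (k + 2) - c k = a (k + 2) + cnj (a (k + 2)) + (\<Sum>i\<le>k. a (Suc i) + cnj (a (Suc i)) - 1)"
    by (simp add: a_def sum.distrib sum_subtractf)
  have step: "a (Suc j) * cnj (a (Suc j)) = a j * cnj (a j) + (a (Suc j) + cnj (a (Suc j)) - 1)" for j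
    using prod[of j j] by simp
  have 2: "a (Suc j) * cnj (a (Suc j)) = a (Suc j) + cnj (a (Suc j)) + (\<Sum>i<j. a (Suc i) + cnj (a (Suc i)) - 1)" for j
  proof (induction j)
    case 0
    show ?case using step[of 0] by (simp add: a_def)
  next
    case (Suc j)
    have "a (Suc (Suc j)) * cnj (a (Suc (Suc j)))
        = a (Suc j) * cnj (a (Suc j)) + (a (Suc (Suc j)) + cnj (a (Suc (Suc j))) - 1)" by (rule step)
    also have "\<dots> = a (Suc (Suc j)) + cnj (a (Suc (Suc j))) + (\<Sum>i<Suc j. a (Suc i) + cnj (a (Suc i)) - 1)"
      unfolding Suc by simp
    finally show ?case .
  qed
  have "c (k + 2) - c k = a (k + 2) * cnj (a (k + 2))"
    using 1 2[of "Suc k"] by (simp add: lessThan_Suc_atMost)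
  then show ?thesis using complex_norm_square[of "a (k + 2)"] by (simp add: algebra_simps)
qed

lemma Ramanujan_coeff_nonneg:
  fixes z :: complex
  assumes z: "norm z = 1 \<or> z = 0"
  defines "a \<equiv> \<lambda>k. \<Sum>i\<le>k. z ^ i"
  shows "\<exists>x::real. (\<Sum>i\<le>k. a i * cnj (a (k - i))) = of_real x \<and> 0 \<le> x \<and> (even k \<longrightarrow> 1 \<le> x)"
proof (cases "z = 0")
  case True
  then have "a i = 1" for i
    by (auto simp: a_def power_0_left sum.delta' if_distrib cong: if_cong)
  then show ?thesis by (intro exI[of _ "real (Suc k)"]) auto
next
  case False
  then have nz: "norm z = 1" using z by simp
  show ?thesis
  proof (induction k rule: less_induct)
    case (less k)
    consider "k = 0" | "k = 1" | j where "k = j + 2" by (metis One_nat_def Suc_1 add_2_eq_Suc' not0_implies_Suc)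
    then show ?case
    proof cases
      case 1
      then show ?thesis by (intro exI[of _ 1]) (simp add: a_def)
    next
      case 2
      have "\<bar>Re z\<bar> \<le> 1" using abs_Re_le_cmod[of z] nz by simp
      then show ?thesis using 2 by (intro exI[of _ "2 + 2 * Re z"]) (auto simp: a_def complex_eq_iff)
    next
      case 3
      obtain x where "(\<Sum>i\<le>j. a i * cnj (a (j - i))) = of_real x" "0 \<le> x" "even j \<longrightarrow> 1 \<le> x"
        using less[of j] 3 by auto
      moreover have "(\<Sum>i\<le>j + 2. a i * cnj (a (j + 2 - i)))
          = (\<Sum>i\<le>j. a i * cnj (a (j - i))) + of_real ((norm (a (j + 2)))\<^sup>2)"
        using Ramanujan_recurrence[OF nz, of j] by (simp only: a_def)
      ultimately show ?thesis unfolding 3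
        by (intro exI[of _ "x + (norm (a (j + 2)))\<^sup>2"]) (auto intro: add_increasing2 simp del: sum.atMost_Suc add_2_eq_Suc')
    qed
  qed
qed

text \<open>The Dirichlet coefficients $1 * 1 * f * \bar f$ of $\zeta(s)^2 L(s,f) L(s,\bar f)$.\<close>
definition landau_coeff :: "(nat \<Rightarrow> complex) \<Rightarrow> nat \<Rightarrow> complex" where
  "landau_coeff f = dirichlet_conv (dirichlet_conv f (\<lambda>_. 1)) (dirichlet_conv (\<lambda>m. cnj (f m)) (\<lambda>_. 1))"

text \<open>Multiplicativity reduces both claims to prime powers, where the coefficient is that of $x^k$ in
  Ramanujan's identity. The lower bound on squares is what prevents the series from converging at
  $s = 1/2$.\<close>
lemma landau_coeff_nonneg:
  assumes f1: "f 1 = 1" and fm: "\<And>a b. f (a * b) = f a * f b"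
    and fn: "\<And>m. 0 < m \<Longrightarrow> norm (f m) = 1 \<or> f m = 0" and m: "0 < m"
  shows "\<exists>x::real. landau_coeff f m = of_real x \<and> 0 \<le> x"
    and "\<exists>x::real. landau_coeff f (m ^ 2) = of_real x \<and> 1 \<le> x"
proof -
  have mult: "multfun (landau_coeff f)" unfolding landau_coeff_def
    by (intro multfun_dirichlet_conv) (auto simp: multfun_def fm f1[simplified])
  have fpow: "f (p ^ i) = f p ^ i" for p i
    by (induction i) (use fm f1 in auto)
  have pp: "\<exists>x::real. landau_coeff f (p ^ k) = of_real x \<and> 0 \<le> x \<and> (even k \<longrightarrow> 1 \<le> x)" if "prime p" for p k
    using Ramanujan_coeff_nonneg[of "f p" k] fn[of p] prime_gt_0_nat[OF that]
    by (simp add: landau_coeff_def dirichlet_conv_prime_power[OF that] fpow)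
  have one: "landau_coeff f 1 = 1" using mult by (simp add: multfun_def)
  show "\<exists>x::real. landau_coeff f m = of_real x \<and> 0 \<le> x"
    using m
  proof (induction m rule: prime_power_coprime_induct)
    case one
    then show ?case using \<open>landau_coeff f 1 = 1\<close> by (intro exI[of _ 1]) auto
  next
    case (mult p k m)
    then obtain x y :: real where "landau_coeff f (p ^ k) = of_real x" "0 \<le> x" "landau_coeff f m = of_real y" "0 \<le> y"
      using pp[of p k] by blast
    then show ?case using multfun_prime_power_mult[OF \<open>multfun (landau_coeff f)\<close>, of p m k] mult
      by (intro exI[of _ "x * y"]) auto
  qed
  show "\<exists>x::real. landau_coeff f (m ^ 2) = of_real x \<and> 1 \<le> x"
    using m
  proof (induction m rule: prime_power_coprime_induct)
    case one
    then show ?case using \<open>landau_coeff f 1 = 1\<close> by (intro exI[of _ 1]) auto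
  next
    case (mult p k m)
    obtain x :: real where x: "landau_coeff f (p ^ (2 * k)) = of_real x" "1 \<le> x"
      using pp[of p "2 * k"] mult by auto
    obtain y :: real where y: "landau_coeff f (m ^ 2) = of_real y" "1 \<le> y" using mult by blast
    have eq: "(p ^ k * m) ^ 2 = p ^ (2 * k) * m ^ 2" by (simp add: power_mult_distrib mult.commute flip: power_mult)
    have "\<not> p dvd m ^ 2" using mult by (simp add: prime_dvd_power_iff)
    then have "landau_coeff f ((p ^ k * m) ^ 2) = of_real (x * y)"
      unfolding eq using multfun_prime_power_mult[OF \<open>multfun (landau_coeff f)\<close>, of p "m^2" "2 * k"] mult x y by simp
    moreover have "1 \<le> x * y" using x y mult_mono[of 1 x 1 y] by simp
    ultimately show ?case by blast
  qed
qed

text \<open>The Taylor coefficients of $u \mapsto G(2-u)$ at $0$ are $b_k = \sum_m e_{m,k}$ with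
  $e_{m,k} = c_m m^{-2} (\ln m)^k / k! \ge 0$. The Taylor series converges at $u = 3/2$ by holomorphy, and there
  all terms of the double series are nonnegative, so it may be summed over $k$ first; this gives
  $\sum_m c_m m^{-2} e^{(3/2)\ln m}$.\<close>
lemma Landau_Dirichlet:
  fixes c :: "nat \<Rightarrow> real"
  assumes nonneg: "\<And>m. 0 \<le> c m"
    and summ: "\<And>s. 1 < s \<Longrightarrow> summable (\<lambda>m. c m * real m powr (-s))"
    and G: "G holomorphic_on ball 2 2"
    and Geq: "\<And>s. s \<in> ball 2 1 \<Longrightarrow> G s = (\<Sum>m. of_real (c m) * of_nat m powr (-s))"
  shows "summable (\<lambda>m. c m * real m powr (-(1/2)))"
proof -
  \<comment> \<open>The powers of $\ln m$ come from $m^{-(2-u)} = m^{-2} e^{u \ln m}$.\<close>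
  define e where "e = (\<lambda>m k. c m * real m powr (-2) * ln (real m) ^ k / fact k)"
  have e0: "0 \<le> e m k" for m k
  proof (cases "m = 0")
    case False
    then show ?thesis unfolding e_def using nonneg[of m] by (intro divide_nonneg_nonneg mult_nonneg_nonneg) auto
  qed (simp add: e_def)
  have expo: "(\<lambda>k. complex_of_real (e m k) * u ^ k) sums (of_real (c m) * of_nat m powr (-(2 - u)))" for m u
  proof (cases "m = 0")
    case False
    have "(\<lambda>k. (u * of_real (ln (real m))) ^ k /\<^sub>R fact k) sums exp (u * of_real (ln (real m)))"
      by (rule exp_converges)
    from sums_mult[OF this, of "of_real (c m * real m powr (-2))"]
    have "(\<lambda>k. complex_of_real (e m k) * u ^ k) sums (of_real (c m * real m powr (-2)) * exp (u * of_real (ln (real m))))"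
      by (simp add: e_def scaleR_conv_of_real power_mult_distrib field_simps)
    also have "of_real (c m * real m powr (-2)) * exp (u * of_real (ln (real m))) = of_real (c m) * of_nat m powr (-(2 - u))"
    proof -
      have "complex_of_real (real m powr (-2)) = of_nat m powr (-2)" using powr_of_real[of "real m" "-2"] by simp
      moreover have "exp (u * of_real (ln (real m))) = of_nat m powr u" using False by (simp add: powr_def Ln_of_nat)
      moreover have "of_nat m powr (-2) * of_nat m powr u = (of_nat m :: complex) powr (-(2 - u))"
        by (simp add: powr_add[symmetric])
      ultimately show ?thesis by (simp add: mult.assoc)
    qed
    finally show ?thesis .
  qed (simp add: e_def)
  have expo_real: "(\<lambda>k. e m k * u ^ k) sums (c m * real m powr (-(2 - u)))" for m u
  proof -
    have "(\<lambda>k. complex_of_real (e m k * u ^ k)) sums complex_of_real (c m * real m powr (-(2 - u)))"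
      using expo[of m "of_real u"] powr_of_real[of "real m" "-(2-u)"] by simp
    then show ?thesis by (simp only: sums_of_real_iff)
  qed
  define t where "t = (\<lambda>u. \<lambda>(m,k). complex_of_real (e m k) * u ^ k)"
  have abs: "(\<lambda>x. norm (t u x)) summable_on UNIV \<times> UNIV" if u: "norm u < 1" for u
  proof -
    have inner: "((\<lambda>k. norm (t u (m,k))) has_sum (c m * real m powr (-(2 - norm u)))) UNIV" for m
    proof -
      have "(\<lambda>k. norm (t u (m,k))) sums (c m * real m powr (-(2 - norm u)))"
        using expo_real[of m "norm u"] e0[of m] by (simp add: t_def norm_mult norm_power)
      then show ?thesis by (intro norm_summable_imp_has_sum) (auto simp: sums_iff)
    qed
    have "summable (\<lambda>m. c m * real m powr (-(2 - norm u)))" using summ[of "2 - norm u"] u by simp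
    then have "(\<lambda>m. c m * real m powr (-(2 - norm u))) summable_on UNIV"
      using nonneg by (simp add: summable_on_UNIV_nonneg_real_iff)
    moreover have "(\<Sum>\<^sub>\<infinity>k. norm (t u (m,k))) = c m * real m powr (-(2 - norm u))" for m
      using inner[of m] by (rule infsumI)
    ultimately show ?thesis unfolding Infinite_Sum.abs_summable_on_Sigma_iff
      using inner nonneg by (auto simp: summable_on_def)
  qed
  define b where "b = (\<lambda>k. \<Sum>\<^sub>\<infinity>m. e m k)"
  have esum: "(\<lambda>m. e m k) summable_on UNIV" for k
  proof -
    have "t (1/2) summable_on UNIV \<times> UNIV" using abs[of "1/2"] by (intro Infinite_Sum.abs_summable_summable[of "t (1/2)"]) simp
    then have "(\<lambda>(k,m). t (1/2) (m,k)) summable_on UNIV \<times> UNIV" using summable_on_swap by blast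
    then have "(\<lambda>m. t (1/2) (m,k)) summable_on UNIV"
      using summable_on_SigmaD1[of "\<lambda>k m. t (1/2) (m,k)" UNIV "\<lambda>_. UNIV" k] by simp
    from summable_on_cmult_left[OF this, of "2 ^ k"] have "(\<lambda>m. complex_of_real (e m k)) summable_on UNIV"
      by (simp add: t_def power_divide)
    then show ?thesis using summable_on_Re[of "\<lambda>m. complex_of_real (e m k)"] by simp
  qed
  have bsums: "(\<lambda>k. of_real (b k) * u ^ k) sums G (2 - u)" if u: "norm u < 1" for u
  proof -
    have "t u summable_on UNIV \<times> UNIV" using abs[OF u] by (rule Infinite_Sum.abs_summable_summable)
    then obtain S where S: "(t u has_sum S) (UNIV \<times> UNIV)" by (auto simp: summable_on_def)
    have hs: "((\<lambda>k. t u (m,k)) has_sum (of_real (c m) * of_nat m powr (-(2 - u)))) UNIV" for m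
    proof -
      have "summable (\<lambda>k. norm (t u (m,k)))"
        using expo_real[of m "norm u"] e0[of m] by (simp add: t_def norm_mult norm_power sums_iff)
      then show ?thesis using expo[of m u] by (intro norm_summable_imp_has_sum) (auto simp: t_def)
    qed
    have "((\<lambda>m. of_real (c m) * of_nat m powr (-(2 - u))) has_sum S) UNIV"
      by (rule has_sum_SigmaD[OF S]) (use hs in auto)
    then have "(\<lambda>m. of_real (c m) * of_nat m powr (-(2 - u))) sums S" by (rule has_sum_imp_sums)
    moreover have "G (2 - u) = (\<Sum>m. of_real (c m) * of_nat m powr (-(2 - u)))" using u by (intro Geq) (simp add: dist_norm)
    ultimately have SG: "S = G (2 - u)" by (simp add: sums_iff)
    have S': "((\<lambda>(k,m). t u (m,k)) has_sum S) (UNIV \<times> UNIV)" using S by (rule has_sum_swap[THEN iffD1])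
    have "((\<lambda>k. of_real (b k) * u ^ k) has_sum S) UNIV"
    proof (rule has_sum_SigmaD[OF S'])
      fix k
      have "((\<lambda>m. e m k) has_sum b k) UNIV" unfolding b_def using esum by (rule has_sum_infsum)
      then have "((\<lambda>m. complex_of_real (e m k)) has_sum of_real (b k)) UNIV" by (rule has_sum_of_real)
      from has_sum_cmult_left[OF this, of "u ^ k"]
      show "((\<lambda>m. case (k, m) of (k, m) \<Rightarrow> t u (m, k)) has_sum of_real (b k) * u ^ k) UNIV" by (simp add: t_def)
    qed
    then show ?thesis unfolding SG by (rule has_sum_imp_sums)
  qed
  define h where "h = (\<lambda>u. G (2 - u))"
  have hol: "h holomorphic_on ball 0 2" unfolding h_def
    by (rule holomorphic_on_compose_gen[OF _ G, unfolded o_def]) (auto intro!: holomorphic_intros simp: dist_norm)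
  define B where "B = (\<lambda>k. (deriv ^^ k) h 0 / fact k)"
  have Bsums: "(\<lambda>k. B k * u ^ k) sums h u" if "norm u < 2" for u
    using holomorphic_power_series[OF hol, of u] that by (simp add: B_def)
  have "Abs_fps (\<lambda>k. complex_of_real (b k)) = Abs_fps B"
  proof (rule eval_fps_eqD)
    have "conv_radius (\<lambda>k. complex_of_real (b k)) \<ge> norm (1/2 :: complex)"
      using bsums[of "1/2"] by (intro conv_radius_geI) (auto simp: sums_iff)
    then show "0 < fps_conv_radius (Abs_fps (\<lambda>k. complex_of_real (b k)))"
      unfolding fps_conv_radius_def by (auto intro: less_le_trans[of _ "ereal (norm (1/2 :: complex))"])
    have "conv_radius B \<ge> norm (1/2 :: complex)"
      using Bsums[of "1/2"] by (intro conv_radius_geI) (auto simp: sums_iff)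
    then show "0 < fps_conv_radius (Abs_fps B)"
      unfolding fps_conv_radius_def by (auto intro: less_le_trans[of _ "ereal (norm (1/2 :: complex))"])
    have "\<forall>\<^sub>F u in nhds (0::complex). u \<in> ball 0 1" by (rule eventually_nhds_in_open) auto
    then show "\<forall>\<^sub>F u in nhds 0. eval_fps (Abs_fps (\<lambda>k. complex_of_real (b k))) u = eval_fps (Abs_fps B) u"
    proof eventually_elim
      case (elim u)
      have "(\<Sum>k. of_real (b k) * u ^ k) = h u" "(\<Sum>k. B k * u ^ k) = h u"
        using bsums[of u] Bsums[of u] elim by (auto simp: h_def sums_iff)
      then show ?case by (simp add: eval_fps_def)
    qed
  qed
  then have bB: "complex_of_real (b k) = B k" for k by (metis fps_nth_Abs_fps)
  have "(\<lambda>k. complex_of_real (b k * (3/2) ^ k)) sums h (3/2)"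
    using Bsums[of "3/2"] by (simp add: bB[symmetric])
  then have sb: "summable (\<lambda>k. b k * (3/2) ^ k)" by (simp only: sums_iff summable_complex_of_real)
  show ?thesis
  proof (rule summableI_nonneg_bounded[where x = "\<Sum>k. b k * (3/2) ^ k"])
    show "0 \<le> c m * real m powr (-(1/2))" for m using nonneg by simp
    fix M
    have "(\<lambda>k. \<Sum>m<M. e m k * (3/2) ^ k) sums (\<Sum>m<M. c m * real m powr (-(2 - 3/2)))"
      by (intro sums_sum expo_real)
    moreover have "(\<Sum>m<M. e m k * (3/2) ^ k) \<le> b k * (3/2) ^ k" for k
    proof -
      have "(\<Sum>m<M. e m k) \<le> b k" unfolding b_def
        by (rule finite_sum_le_infsum[OF esum]) (simp_all add: e0)
      then show ?thesis by (simp add: sum_distrib_right[symmetric])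
    qed
    ultimately have "(\<Sum>m<M. c m * real m powr (-(2 - 3/2))) \<le> (\<Sum>k. b k * (3/2) ^ k)"
      by (rule sums_le[OF _ _ summable_sums[OF sb], rotated])
    then show "(\<Sum>m<M. c m * real m powr (-(1/2))) \<le> (\<Sum>k. b k * (3/2) ^ k)" by simp
  qed
qed

section \<open>Dirichlet characters and nonvanishing on the line of real part one\<close>

definition dirichlet_char :: "nat \<Rightarrow> (nat \<Rightarrow> complex) \<Rightarrow> bool" where
  "dirichlet_char n \<psi> \<longleftrightarrow> \<psi> 1 = 1 \<and> (\<forall>a b. \<psi> (a * b) = \<psi> a * \<psi> b) \<and>
     (\<forall>a. \<psi> a = 0 \<longleftrightarrow> \<not> coprime a n) \<and> (\<forall>a. \<psi> (a + n) = \<psi> a)"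

lemma dirichlet_charD:
  assumes "dirichlet_char n \<psi>"
  shows "\<psi> 1 = 1" "\<psi> (a * b) = \<psi> a * \<psi> b" "\<psi> a = 0 \<longleftrightarrow> \<not> coprime a n" "\<psi> (a + n) = \<psi> a"
  using assms by (auto simp: dirichlet_char_def)

lemma dirichlet_char_power: "dirichlet_char n \<psi> \<Longrightarrow> \<psi> (a ^ k) = \<psi> a ^ k"
  by (induction k) (auto simp: dirichlet_char_def)

lemma dirichlet_char_cong:
  assumes "dirichlet_char n \<psi>" "[a = b] (mod n)"
  shows "\<psi> a = \<psi> b"
proof -
  have "\<psi> m = \<psi> (m mod n)" for m by (rule periodic_mod) (rule dirichlet_charD(4)[OF assms(1)])
  from this[of a] this[of b] show ?thesis using assms(2)[unfolded unique_euclidean_semiring_class.cong_def] by metis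
qed

lemma norm_dirichlet_char:
  assumes \<psi>: "dirichlet_char n \<psi>" and n: "0 < n"
  shows "norm (\<psi> a) = (if coprime a n then 1 else 0)"
proof (cases "coprime a n")
  case True
  have "\<psi> a ^ totient n = 1"
    using dirichlet_char_cong[OF \<psi> euler_theorem[OF True]] dirichlet_char_power[OF \<psi>, of a "totient n"]
      dirichlet_charD(1)[OF \<psi>] by simp
  then have "norm (\<psi> a) ^ totient n = 1" by (metis norm_one norm_power)
  moreover have "totient n > 0" using n by simp
  ultimately have "norm (\<psi> a) = 1"
    using power_eq_imp_eq_base[of "norm (\<psi> a)" "totient n" 1] by simp
  then show ?thesis using True by simp
qed (use dirichlet_charD(3)[OF \<psi>] in auto)

lemma dirichlet_char_cnj: "dirichlet_char n \<psi> \<Longrightarrow> dirichlet_char n (\<lambda>m. cnj (\<psi> m))"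
  by (auto simp: dirichlet_char_def)

lemma dirichlet_conv_twist:
  "dirichlet_conv (\<lambda>m. f m * of_nat m powr s) (\<lambda>m. g m * of_nat m powr s) m = dirichlet_conv f g m * of_nat m powr s"
proof (cases "m = 0")
  case False
  have "f d * of_nat d powr s * (g (m div d) * of_nat (m div d) powr s) = f d * g (m div d) * of_nat m powr s"
    if "d dvd m" for d
  proof -
    have "(of_nat m :: complex) powr s = (of_nat d * of_nat (m div d)) powr s"
      using that by (simp flip: of_nat_mult)
    also have "\<dots> = of_nat d powr s * of_nat (m div d) powr s" by (rule powr_times_real) auto
    finally show ?thesis by simp
  qed
  then show ?thesis unfolding dirichlet_conv_def sum_distrib_right by (intro sum.cong refl) auto
qed (simp add: dirichlet_conv_def)

lemma dirichlet_series_mult: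
  assumes "summable (\<lambda>m. norm (f m * of_nat m powr s))" "summable (\<lambda>m. norm (g m * of_nat m powr s))"
  shows "summable (\<lambda>m. norm (dirichlet_conv f g m * of_nat m powr s))"
    and "(\<Sum>m. dirichlet_conv f g m * of_nat m powr s) = (\<Sum>m. f m * of_nat m powr s) * (\<Sum>m. g m * of_nat m powr s)"
  using dirichlet_conv_summable[OF assms(1) _ assms(2)] by (simp_all add: dirichlet_conv_twist)

text \<open>$\mu\psi$ is the convolution inverse of the completely multiplicative $\psi$.\<close>
lemma periodic_L_times_moebius_series:
  assumes \<psi>: "dirichlet_char n \<psi>" and n: "0 < n" and s: "1 < Re s"
  shows "periodic_L \<psi> n s * (\<Sum>m. of_int (moebius m) * \<psi> m * of_nat m powr (-s)) = 1"
proof -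
  have b: "norm (\<psi> m) \<le> 1" for m using norm_dirichlet_char[OF \<psi> n] by simp
  have bm: "norm (of_int (moebius m) * \<psi> m) \<le> 1" for m by (rule norm_moebius_mult_le[OF b])
  have conv: "dirichlet_conv (\<lambda>m. of_int (moebius m) * \<psi> m) \<psi> m * of_nat m powr (-s) = (if m = 1 then 1 else 0)" for m
  proof (cases "m = 0")
    case False
    have "dirichlet_conv (\<lambda>m. of_int (moebius m) * \<psi> m) \<psi> m = \<psi> m * dirichlet_conv (\<lambda>m. of_int (moebius m)) (\<lambda>_. 1) m"
      unfolding dirichlet_conv_def sum_distrib_left
    proof (intro sum.cong refl)
      fix d assume d: "d \<in> {d. d dvd m}"
      have "\<psi> m = \<psi> d * \<psi> (m div d)"
        using d dirichlet_charD(2)[OF \<psi>, of d "m div d"] by simp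
      then show "of_int (moebius d) * \<psi> d * \<psi> (m div d) = \<psi> m * (of_int (moebius d) * 1)" by simp
    qed
    then show ?thesis using False moebius_inversion[of m] dirichlet_charD(1)[OF \<psi>] by simp
  qed simp
  have "(\<Sum>m. of_int (moebius m) * \<psi> m * of_nat m powr (-s)) * (\<Sum>m. \<psi> m * of_nat m powr (-s))
      = (\<Sum>m. dirichlet_conv (\<lambda>m. of_int (moebius m) * \<psi> m) \<psi> m * of_nat m powr (-s))"
    by (rule dirichlet_series_mult(2)[OF summable_bounded_dirichlet[OF bm s] summable_bounded_dirichlet[OF b s], symmetric])
  also have "\<dots> = (\<Sum>m. if m = 1 then 1 else 0)" by (simp only: conv)
  also have "\<dots> = 1" using sums_single[of 1 "\<lambda>_. 1::complex"] by (simp add: sums_iff)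
  finally have 1: "(\<Sum>m. of_int (moebius m) * \<psi> m * of_nat m powr (-s)) * (\<Sum>m. \<psi> m * of_nat m powr (-s)) = 1" .
  have "periodic_L \<psi> n s = (\<Sum>m. \<psi> m * of_nat m powr (-s))"
    by (rule periodic_L_eq_suminf[OF n _ s]) (rule dirichlet_charD(4)[OF \<psi>])
  then show ?thesis using 1 by (simp add: mult.commute)
qed

text \<open>The coefficients of $(1 - 2^{1-s})\zeta(s)$. They have period $2$ and mean zero, so that $\zeta$ is
  available beyond its pole as a quotient.\<close>
definition altern :: "nat \<Rightarrow> complex" where
  "altern m = (if odd m then 1 else -1)"

lemma altern_sum: "(\<Sum>j=1..2. altern j) = 0"
  by (simp add: altern_def numeral_2_eq_2)

lemma altern_periodic_L:
  assumes s: "1 < Re s"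
  shows "periodic_L altern 2 s = (1 - 2 powr (1 - s)) * (\<Sum>m. of_nat m powr (-s))"
proof -
  have summ: "summable (\<lambda>m. (of_nat m :: complex) powr (-s))"
    using summable_norm_cancel[OF summable_bounded_dirichlet[of "\<lambda>_. 1" 1 s]] s by simp
  define Z where "Z = (\<Sum>m. (of_nat m :: complex) powr (-s))"
  have Z: "(\<lambda>m. (of_nat m :: complex) powr (-s)) sums Z" unfolding Z_def using summ by (rule summable_sums)
  have "(\<lambda>k. (of_nat (2 * k) :: complex) powr (-s)) sums (2 powr (-s) * Z)"
    using sums_mult[OF Z, of "2 powr (-s)"] powr_times_real[of 2 "of_nat _" "-s"] by simp
  then have "(\<lambda>m. if even m then (of_nat m :: complex) powr (-s) else 0) sums (2 powr (-s) * Z)"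
    using sums_mono_reindex[of "\<lambda>k. 2 * k" "\<lambda>m. if even m then (of_nat m :: complex) powr (-s) else 0" "2 powr (-s) * Z"]
    by (simp add: strict_mono_def image_def dvd_def)
  from sums_diff[OF Z sums_mult[OF this, of 2]]
  have "(\<lambda>m. altern m * of_nat m powr (-s)) sums (Z - 2 * (2 powr (-s) * Z))"
    by (rule sums_cong[THEN iffD1, rotated]) (auto simp: altern_def)
  moreover have "periodic_L altern 2 s = (\<Sum>m. altern m * of_nat m powr (-s))"
    by (rule periodic_L_eq_suminf[OF _ _ s]) (auto simp: altern_def)
  ultimately have "periodic_L altern 2 s = Z - 2 * (2 powr (-s) * Z)" by (simp add: sums_iff)
  also have "2 powr (1 - s) = 2 * (2::complex) powr (-s)" by (simp add: powr_diff powr_minus divide_inverse)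
  ultimately show ?thesis unfolding Z_def[symmetric] by (simp add: algebra_simps)
qed

text \<open>The zeros of $1 - 2^{1-s}$ are the points $1 + 2\pi i k/\ln 2$. Only $s = 1$ lies in the disc, since
  $2\pi/\ln 2 > 2$, and it is a simple zero.\<close>
lemma divide_by_zeta_factor:
  assumes g: "g holomorphic_on ball 2 2" "g 1 = 0"
  obtains k where "k holomorphic_on ball (2::complex) 2" "\<And>s. s \<in> ball 2 2 - {1} \<Longrightarrow> k s = g s / (1 - 2 powr (1 - s))"
proof -
  define D where "D = (\<lambda>s::complex. 1 - 2 powr (1 - s))"
  have D: "(D has_field_derivative of_real (ln 2) * 2 powr (1 - s)) (at s)" for s
  proof -
    have "((\<lambda>z. 2 powr (1 - z)) has_field_derivative (Ln 2 * 2 powr (1 - s)) * (0 - 1)) (at s)"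
      by (rule DERIV_chain2[of "\<lambda>z. 2 powr z"]) (auto intro!: derivative_eq_intros has_field_derivative_powr_right)
    from DERIV_diff[OF DERIV_const[of 1] this] show ?thesis
      unfolding D_def using Ln_of_real[of 2] by simp
  qed
  have holD: "D holomorphic_on ball 2 2" using D by (auto simp: holomorphic_on_open)
  have D0: "D s \<noteq> 0" if s: "s \<in> ball 2 2" "s \<noteq> 1" for s
  proof
    assume "D s = 0"
    then have "exp ((1 - s) * of_real (ln 2)) = 1" by (simp add: D_def powr_def Ln_of_real[of 2, simplified])
    then obtain k :: int where k: "Re ((1 - s) * of_real (ln 2)) = 0" "Im ((1 - s) * of_real (ln 2)) = real_of_int (2 * k) * pi"
      unfolding exp_eq_1 by auto
    have "\<bar>Im s\<bar> < 2" using s abs_Im_le_cmod[of "s - 2"] by (simp add: dist_norm norm_minus_commute)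
    moreover have l2: "0 < ln (2::real)" "ln (2::real) < 1" using ln_2_less_1 by auto
    ultimately have "\<bar>Im s\<bar> * ln 2 < 2 * 1" by (intro mult_strict_mono) auto
    moreover have "\<bar>Im ((1 - s) * of_real (ln 2))\<bar> = \<bar>Im s\<bar> * ln 2" using l2 by (simp add: abs_mult)
    ultimately have "\<bar>real_of_int (2 * k) * pi\<bar> < 2" unfolding k(2) by simp
    moreover have "2 * pi * \<bar>real_of_int k\<bar> = \<bar>real_of_int (2 * k) * pi\<bar>" by (simp add: abs_mult)
    ultimately have "2 * pi * \<bar>real_of_int k\<bar> < 2" by linarith
    moreover have "2 * 1 \<le> 2 * pi * \<bar>real_of_int k\<bar>" if "k \<noteq> 0"
    proof -
      have "1 \<le> \<bar>real_of_int k\<bar>" using that by linarith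
      then show ?thesis using pi_gt3 by (intro mult_mono) auto
    qed
    ultimately have "k = 0" by force
    then have "s = 1" using k l2 by (auto simp: complex_eq_iff)
    then show False using s by simp
  qed
  define g1 where "g1 = (\<lambda>s. if s = 1 then deriv g 1 else g s / (s - 1) - g 1 / (s - 1))"
  \<comment> \<open>Removing the zero at $1$ from numerator and denominator makes the quotient holomorphic.\<close>
  define D1 where "D1 = (\<lambda>s. if s = 1 then deriv D 1 else D s / (s - 1) - D 1 / (s - 1))"
  have "g1 holomorphic_on ball 2 2" unfolding g1_def by (rule pole_theorem_open[OF g(1)]) auto
  moreover have "D1 holomorphic_on ball 2 2" unfolding D1_def by (rule pole_theorem_open[OF holD]) auto
  moreover have "D1 s \<noteq> 0" if "s \<in> ball 2 2" for s
    using D0[OF that] DERIV_imp_deriv[OF D, of 1] by (auto simp: D1_def) (auto simp: D_def)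
  ultimately have "(\<lambda>s. g1 s / D1 s) holomorphic_on ball 2 2" by (intro holomorphic_intros)
  moreover have "g1 s / D1 s = g s / (1 - 2 powr (1 - s))" if "s \<in> ball 2 2 - {1}" for s
    using that g(2) by (simp add: g1_def D1_def) (simp add: D_def)
  ultimately show ?thesis using that by blast
qed

text \<open>A zero of $L$ at $1 + it$ gives a zero of $L(s, \overline\psi)$ at $1 - it$. Together these two
  zeros cancel the double pole of $\zeta(s)^2 L(s+it,\psi) L(s-it,\overline\psi)$ at $s = 1$. By Landau's
  theorem the series of this function then converges at $s = 1/2$; but its coefficients at squares
  are at least $1$, and $\sum_m (m^2)^{-1/2}$ diverges. The argument covers real characters and
  $t = 0$ as well.\<close>
theorem periodic_L_char_nonzero_on_line:
  assumes \<psi>: "dirichlet_char n \<psi>" and n: "0 < n" and mean: "(\<Sum>j=1..n. \<psi> j) = 0"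
  shows "periodic_L \<psi> n (1 + \<i> * of_real t) \<noteq> 0"
proof
  assume zero: "periodic_L \<psi> n (1 + \<i> * of_real t) = 0"
  let ?\<psi>' = "\<lambda>m. cnj (\<psi> m)"
  have \<psi>': "dirichlet_char n ?\<psi>'" using \<psi> by (rule dirichlet_char_cnj)
  have mean': "(\<Sum>j=1..n. ?\<psi>' j) = 0" using mean by (metis cnj_sum complex_cnj_zero)
  have zero': "periodic_L ?\<psi>' n (1 - \<i> * of_real t) = 0"
    using periodic_L_cnj[OF n mean, of "1 + \<i> * of_real t"] zero by simp
  define f where "f = (\<lambda>m. \<psi> m * of_nat m powr (- (\<i> * of_real t)))"
  have f1: "f 1 = 1" using dirichlet_charD(1)[OF \<psi>] by (simp add: f_def)
  have fm: "f (a * b) = f a * f b" for a b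
    using dirichlet_charD(2)[OF \<psi>] by (simp add: f_def powr_times_real)
  have fn: "norm (f m) = 1 \<or> f m = 0" if "0 < m" for m
    using norm_dirichlet_char[OF \<psi> n, of m] norm_of_nat_powr[OF that, of "- (\<i> * of_real t)"] that dirichlet_charD(3)[OF \<psi>, of m]
    by (auto simp: f_def norm_mult)
  have fle: "norm (f m) \<le> 1" for m using fn[of m] by (cases "m = 0") (auto simp: f_def)
  define c where "c = (\<lambda>m. Re (landau_coeff f m))"
  have R0: "landau_coeff f 0 = 0" by (simp add: landau_coeff_def dirichlet_conv_def)
  have cc: "landau_coeff f m = of_real (c m)" for m
    using landau_coeff_nonneg(1)[where f = f, OF f1 fm fn, of m] R0 by (cases "m = 0") (auto simp: c_def)
  have c0: "0 \<le> c m" for m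
    using landau_coeff_nonneg(1)[where f = f, OF f1 fm fn, of m] R0 by (cases "m = 0") (auto simp: c_def)
  have c1: "1 \<le> c (m ^ 2)" if "0 < m" for m
    using landau_coeff_nonneg(2)[where f = f, OF f1 fm fn that] by (auto simp: c_def)
  let ?Z = "\<lambda>s. \<Sum>m. (of_nat m :: complex) powr (-s)"
  have series: "summable (\<lambda>m. norm (landau_coeff f m * of_nat m powr (-s))) \<and>
      (\<Sum>m. landau_coeff f m * of_nat m powr (-s)) = (?Z s * periodic_L \<psi> n (s + \<i> * of_real t)) * (?Z s * periodic_L ?\<psi>' n (s - \<i> * of_real t))"
    if s: "1 < Re s" for s
  proof -
    have cle: "norm (cnj (f m)) \<le> 1" for m using fle by simp
    have F: "summable (\<lambda>m. norm (f m * of_nat m powr (-s)))" by (rule summable_bounded_dirichlet[OF fle s])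
    have F': "summable (\<lambda>m. norm (cnj (f m) * of_nat m powr (-s)))" by (rule summable_bounded_dirichlet[OF cle s])
    have O: "summable (\<lambda>m. norm (1 * (of_nat m :: complex) powr (-s)))" by (rule summable_bounded_dirichlet[OF _ s]) auto
    have "f m * of_nat m powr (-s) = \<psi> m * of_nat m powr (- (s + \<i> * of_real t))" for m
      by (simp add: f_def powr_add[symmetric] algebra_simps)
    then have e1: "(\<Sum>m. f m * of_nat m powr (-s)) = periodic_L \<psi> n (s + \<i> * of_real t)"
      using periodic_L_eq_suminf[OF n, of \<psi> "s + \<i> * of_real t"] dirichlet_charD(4)[OF \<psi>] s by simp
    have "cnj (f m) * of_nat m powr (-s) = ?\<psi>' m * of_nat m powr (- (s - \<i> * of_real t))" for m
      by (simp add: f_def cnj_powr powr_add[symmetric] algebra_simps)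
    then have e2: "(\<Sum>m. cnj (f m) * of_nat m powr (-s)) = periodic_L ?\<psi>' n (s - \<i> * of_real t)"
      using periodic_L_eq_suminf[OF n, of ?\<psi>' "s - \<i> * of_real t"] dirichlet_charD(4)[OF \<psi>'] s by simp
    show ?thesis
      using dirichlet_series_mult[OF dirichlet_series_mult(1)[OF F O] dirichlet_series_mult(1)[OF F' O]]
        dirichlet_series_mult(2)[OF F O] dirichlet_series_mult(2)[OF F' O]
      by (simp add: landau_coeff_def e1 e2 mult_ac)
  qed
  have Re_pos: "0 < Re s" if "s \<in> ball 2 2" for s
    using that abs_Re_le_cmod[of "2 - s"] by (auto simp: dist_norm)
  have holA: "(\<lambda>s. periodic_L altern 2 s) holomorphic_on ball 2 2"
    by (rule holomorphic_on_subset[OF periodic_L_sums_holomorphic(2)[OF _ altern_sum]]) (use Re_pos in auto)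
  have hol1: "(\<lambda>s. periodic_L altern 2 s * periodic_L \<psi> n (s + \<i> * of_real t)) holomorphic_on ball 2 2"
    by (intro holomorphic_intros holA holomorphic_on_compose_gen[OF _ periodic_L_sums_holomorphic(2)[OF n mean], unfolded o_def])
       (use Re_pos in auto)
  have hol2: "(\<lambda>s. periodic_L altern 2 s * periodic_L ?\<psi>' n (s - \<i> * of_real t)) holomorphic_on ball 2 2"
    by (intro holomorphic_intros holA holomorphic_on_compose_gen[OF _ periodic_L_sums_holomorphic(2)[OF n mean'], unfolded o_def])
       (use Re_pos in auto)
  obtain k1 where k1: "k1 holomorphic_on ball 2 2"
    "\<And>s. s \<in> ball 2 2 - {1} \<Longrightarrow> k1 s = (periodic_L altern 2 s * periodic_L \<psi> n (s + \<i> * of_real t)) / (1 - 2 powr (1 - s))"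
    using divide_by_zeta_factor[OF hol1] zero by auto
  obtain k2 where k2: "k2 holomorphic_on ball 2 2"
    "\<And>s. s \<in> ball 2 2 - {1} \<Longrightarrow> k2 s = (periodic_L altern 2 s * periodic_L ?\<psi>' n (s - \<i> * of_real t)) / (1 - 2 powr (1 - s))"
    using divide_by_zeta_factor[OF hol2] zero' by auto
  have "summable (\<lambda>m. c m * real m powr (-(1/2)))"
  proof (rule Landau_Dirichlet[OF c0])
    show "(\<lambda>s. k1 s * k2 s) holomorphic_on ball 2 2" using k1(1) k2(1) by (intro holomorphic_intros)
    show "summable (\<lambda>m. c m * real m powr (-s))" if s: "1 < s" for s
    proof -
      have "norm (landau_coeff f m * of_nat m powr (- of_real s)) = c m * real m powr (-s)" for m
        using c0[of m] norm_of_nat_powr[of m "- of_real s"] by (cases "m = 0") (auto simp: cc norm_mult)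
      then show ?thesis using series[of "of_real s"] s by simp
    qed
    fix s :: complex assume s: "s \<in> ball 2 1"
    have re: "1 < Re s" using s abs_Re_le_cmod[of "2 - s"] by (auto simp: dist_norm)
    have s': "s \<in> ball 2 2 - {1}" using s re by auto
    have D: "1 - 2 powr (1 - s) \<noteq> 0"
    proof
      assume "1 - 2 powr (1 - s) = 0"
      then have "norm ((2::complex) powr (1 - s)) = 1" by (metis norm_one right_minus_eq)
      then have "(2::real) powr (1 - Re s) = 1" using norm_of_nat_powr[of 2 "1 - s"] by simp
      then show False using re by (simp add: powr_eq_one_iff_gen)
    qed
    have "k1 s * k2 s = (?Z s * periodic_L \<psi> n (s + \<i> * of_real t)) * (?Z s * periodic_L ?\<psi>' n (s - \<i> * of_real t))"
      unfolding k1(2)[OF s'] k2(2)[OF s'] altern_periodic_L[OF re] using D by simp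
    then show "k1 s * k2 s = (\<Sum>m. of_real (c m) * of_nat m powr (-s))" using series[OF re] by (simp add: cc)
  qed
  then have "(\<lambda>m. c m * real m powr (-(1/2))) summable_on UNIV"
    using c0 by (subst summable_on_UNIV_nonneg_real_iff) auto
  then have "(\<lambda>m. c m * real m powr (-(1/2))) summable_on range (\<lambda>m. m ^ 2)" by (rule summable_on_subset_banach) auto
  moreover have "inj (\<lambda>m::nat. m ^ 2)" by (auto simp: inj_def)
  ultimately have "(\<lambda>m. c (m ^ 2) * real (m ^ 2) powr (-(1/2))) summable_on UNIV"
    by (simp add: summable_on_reindex o_def)
  then have "summable (\<lambda>m. c (m ^ 2) * real (m ^ 2) powr (-(1/2)))" by (rule summable_on_imp_summable)
  then have "summable (\<lambda>m. real m powr (-1))"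
  proof (rule summable_comparison_test')
    fix m :: nat assume "0 \<le> m"
    show "norm (real m powr (-1)) \<le> c (m ^ 2) * real (m ^ 2) powr (-(1/2))"
    proof (cases "m = 0")
      case False
      have "real (m ^ 2) powr (-(1/2)) = real m powr (-1)"
        using False powr_powr[of "real m" 2 "-(1/2)"] by simp
      then show ?thesis using c1[of m] False by (simp add: powr_minus divide_right_mono inverse_eq_divide)
    qed simp
  qed
  then show False by (simp only: summable_real_powr_iff)
qed

text \<open>Newman's theorem applies to $1/L(s,\psi)$, whose coefficients $\mu(m)\psi(m)$ are bounded by $1$ and
  which is holomorphic on a neighbourhood of the closed half-plane.\<close>
theorem moebius_char_series_converges:
  assumes \<psi>: "dirichlet_char n \<psi>" and n: "0 < n" and mean: "(\<Sum>j=1..n. \<psi> j) = 0"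
  shows "(\<lambda>N. \<Sum>m=1..N. of_int (moebius m) * \<psi> m * of_nat m powr (-1)) \<longlonglongrightarrow> 1 / periodic_L \<psi> n 1"
    and "((\<lambda>s. \<Sum>m. of_int (moebius m) * \<psi> m * of_nat m powr (- of_real s)) \<longlongrightarrow> 1 / periodic_L \<psi> n 1) (at_right (1::real))"
proof -
  let ?H = "{s::complex. 0 < Re s}"
  define S where "S = ?H \<inter> (periodic_L \<psi> n -` (- {0}))"
  have opH: "open ?H" by (rule open_halfspace_Re_gt)
  have hol: "periodic_L \<psi> n holomorphic_on ?H" by (rule periodic_L_sums_holomorphic(2)[OF n mean])
  have opS: "open S" unfolding S_def
    by (rule continuous_open_preimage[OF holomorphic_on_imp_continuous_on[OF hol] opH]) auto
  have nz: "periodic_L \<psi> n s \<noteq> 0" if "1 \<le> Re s" for s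
  proof (cases "Re s = 1")
    case True
    then have "s = 1 + \<i> * of_real (Im s)" by (simp add: complex_eq_iff)
    then show ?thesis using periodic_L_char_nonzero_on_line[OF \<psi> n mean, of "Im s"] by metis
  next
    case False
    then show ?thesis using periodic_L_times_moebius_series[OF \<psi> n, of s] that by auto
  qed
  have sub: "{s. 1 \<le> Re s} \<subseteq> S" using nz by (auto simp: S_def)
  have holF: "(\<lambda>s. 1 / periodic_L \<psi> n s) holomorphic_on S"
    by (intro holomorphic_intros holomorphic_on_subset[OF hol]) (auto simp: S_def)
  have eq: "1 / periodic_L \<psi> n s = (\<Sum>m. of_int (moebius m) * \<psi> m * of_nat m powr (-s))" if "1 < Re s" for s
    using periodic_L_times_moebius_series[OF \<psi> n that] nz[of s] that by (simp add: field_simps)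
  have bm: "norm (of_int (moebius m) * \<psi> m) \<le> 1" for m
    by (rule norm_moebius_mult_le) (simp add: norm_dirichlet_char[OF \<psi> n])
  show "(\<lambda>N. \<Sum>m=1..N. of_int (moebius m) * \<psi> m * of_nat m powr (-1)) \<longlonglongrightarrow> 1 / periodic_L \<psi> n 1"
    by (rule Newman_Tauberian[OF bm holF opS sub eq])
  have "isCont (\<lambda>s. 1 / periodic_L \<psi> n s) 1"
  proof -
    have "(1::complex) \<in> S" using sub by auto
    then show ?thesis using holomorphic_on_imp_continuous_on[OF holF] opS by (simp add: continuous_on_eq_continuous_at)
  qed
  then have "((\<lambda>s. 1 / periodic_L \<psi> n s) \<longlongrightarrow> 1 / periodic_L \<psi> n 1) (at 1)" by (simp add: isCont_def)
  moreover have "filterlim (\<lambda>s::real. complex_of_real s) (at 1) (at_right 1)"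
    by (auto simp: filterlim_at eventually_at_filter intro!: tendsto_eq_intros)
  ultimately have "((\<lambda>s. 1 / periodic_L \<psi> n (of_real s)) \<longlongrightarrow> 1 / periodic_L \<psi> n 1) (at_right 1)"
    by (rule filterlim_compose)
  then show "((\<lambda>s. \<Sum>m. of_int (moebius m) * \<psi> m * of_nat m powr (- of_real s)) \<longlongrightarrow> 1 / periodic_L \<psi> n 1) (at_right (1::real))"
  proof (rule Lim_transform_eventually)
    show "\<forall>\<^sub>F s in at_right 1. 1 / periodic_L \<psi> n (of_real s) = (\<Sum>m. of_int (moebius m) * \<psi> m * of_nat m powr (- of_real s))"
      using eventually_at_right_less[of "1::real"] by eventually_elim (rule eq, simp)
  qed
qed

section \<open>Moebius series with odd periodic coefficients\<close>

text \<open>Compose a primitive root logarithm mod $p$ with an injective character of the cyclic group of order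
  $p - 1$. This character separates all residues mod $p$ that are coprime to $p$.\<close>
lemma primroot_char_exists:
  assumes p: "prime p" "p dvd n" and a: "coprime a n" and b: "coprime b n" and ab: "\<not> [a = b] (mod p)"
  shows "\<exists>\<psi>. dirichlet_char n \<psi> \<and> \<psi> a \<noteq> \<psi> b"
proof -
  have "p \<in> cyclic_moduli"
  proof (cases "odd p")
    case True
    then have "p = p ^ 1" "prime p" "odd p" "(1::nat) > 0" using p by auto
    then show ?thesis unfolding cyclic_moduli_def by blast
  next
    case False
    then have "p = 2" using p(1) primes_dvd_imp_eq two_is_prime_nat by blast
    then show ?thesis by (simp add: cyclic_moduli_def)
  qed
  then obtain g where g: "residue_primroot p g" using residue_primroot_iff_in_cyclic_moduli by blast
  have p1: "p > 1" using p(1) by (rule prime_gt_1_nat)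
  define \<phi> where "\<phi> = totient p"
  have \<phi>: "\<phi> > 0" using p1 by (simp add: \<phi>_def)
  have cg: "coprime p g" and og: "ord p g = \<phi>" using g by (auto simp: residue_primroot_def \<phi>_def)
  have exi: "\<exists>i<\<phi>. [g ^ i = x] (mod p)" if "coprime x p" for x
  proof -
    have c: "coprime (x mod p) p" using that p1 by simp
    have "x mod p \<noteq> 0"
    proof
      assume "x mod p = 0"
      then show False using c p1 by simp
    qed
    then have "x mod p \<in> totatives p" using c p1 by (simp add: in_totatives_iff less_imp_le)
    then have "x mod p \<in> (\<lambda>i. g ^ i mod p) ` {..<\<phi>}"
      using residue_primroot_is_generator[OF p1 g] by (simp add: bij_betw_def \<phi>_def)
    then show ?thesis by (auto simp: unique_euclidean_semiring_class.cong_def)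
  qed
  define ind where "ind = (\<lambda>x. SOME i. i < \<phi> \<and> [g ^ i = x] (mod p))"
  have ind: "ind x < \<phi>" "[g ^ ind x = x] (mod p)" if "coprime x p" for x
    using someI_ex[OF exi[OF that]] unfolding ind_def by auto
  have uniq: "[i = j] (mod \<phi>)" if "[g ^ i = g ^ j] (mod p)" for i j
    using that order_divides_expdiff[OF cg, of i j] by (simp add: og)
  define \<omega> where "\<omega> = (\<lambda>i::nat. cis (2 * pi * real i / real \<phi>))"
  have \<omega>_add: "\<omega> (i + j) = \<omega> i * \<omega> j" for i j
    by (simp add: \<omega>_def cis_mult add_divide_distrib distrib_left)
  have "\<omega> \<phi> = 1" using \<phi> by (simp add: \<omega>_def)
  then have "\<omega> i = \<omega> (i mod \<phi>)" for i by (intro periodic_mod) (simp add: \<omega>_add)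
  then have \<omega>_cong: "\<omega> i = \<omega> j" if "[i = j] (mod \<phi>)" for i j
    using that unfolding unique_euclidean_semiring_class.cong_def by metis
  have \<omega>_inj: "i = j" if "\<omega> i = \<omega> j" "i < \<phi>" "j < \<phi>" for i j
    using Complex.bij_betw_roots_unity[OF \<phi>] that unfolding bij_betw_def inj_on_def \<omega>_def by auto
  define \<psi> where "\<psi> = (\<lambda>x. if coprime x n then \<omega> (ind x) else 0)"
  have cp: "coprime x p" if "coprime x n" for x using coprime_divisors[OF dvd_refl p(2) that] .
  have "dirichlet_char n \<psi>"
    unfolding dirichlet_char_def
  proof (intro conjI allI)
    show "\<psi> 1 = 1"
    proof -
      have "[g ^ ind 1 = g ^ 0] (mod p)" using ind(2)[of 1] by simp
      from \<omega>_cong[OF uniq[OF this]] show ?thesis by (simp add: \<psi>_def) (simp add: \<omega>_def)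
    qed
    fix x y
    show "\<psi> (x * y) = \<psi> x * \<psi> y"
    proof (cases "coprime x n \<and> coprime y n")
      case True
      then have c: "coprime x n" "coprime y n" "coprime (x * y) n" by auto
      have "[g ^ ind (x * y) = x * y] (mod p)" using ind(2)[OF cp[OF c(3)]] .
      moreover have "[g ^ (ind x + ind y) = x * y] (mod p)"
        unfolding power_add by (intro cong_mult ind cp c)
      ultimately have "[g ^ ind (x * y) = g ^ (ind x + ind y)] (mod p)" by (rule cong_trans[OF _ cong_sym])
      from \<omega>_cong[OF uniq[OF this]] show ?thesis using c by (simp add: \<psi>_def \<omega>_add)
    qed (auto simp: \<psi>_def)
    show "\<psi> x = 0 \<longleftrightarrow> \<not> coprime x n" by (auto simp: \<psi>_def \<omega>_def)
    have shift: "coprime (x + n) n \<longleftrightarrow> coprime x n" unfolding coprime_iff_gcd_eq_1 by (rule arg_cong[of _ _ "\<lambda>d. d = 1"]) (rule gcd_add1)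
    show "\<psi> (x + n) = \<psi> x"
    proof (cases "coprime x n")
      case True
      obtain q where q: "n = p * q" using p(2) unfolding dvd_def by blast
      have "[x + n = x] (mod p)" unfolding q unique_euclidean_semiring_class.cong_def by simp
      have "coprime (x + n) n" using True shift by simp
      then have "[g ^ ind (x + n) = g ^ ind x] (mod p)"
        using cong_trans[OF cong_trans[OF ind(2)[OF cp] \<open>[x + n = x] (mod p)\<close>] cong_sym[OF ind(2)[OF cp[OF True]]]] by blast
      from \<omega>_cong[OF uniq[OF this]] show ?thesis using True shift by (simp add: \<psi>_def)
    qed (use shift in \<open>simp add: \<psi>_def\<close>)
  qed
  moreover have "\<psi> a \<noteq> \<psi> b"
  proof
    assume "\<psi> a = \<psi> b"
    then have "ind a = ind b" using \<omega>_inj ind(1) cp a b by (auto simp: \<psi>_def)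
    then have "[a = b] (mod p)" using cong_trans[OF cong_sym[OF ind(2)[OF cp[OF a]]]] ind(2)[OF cp[OF b]] by simp
    then show False using ab by simp
  qed
  ultimately show ?thesis by blast
qed

text \<open>For squarefree $n$, two residues that differ mod $n$ differ modulo some prime factor of $n$.\<close>
lemma dirichlet_char_separates:
  assumes n: "squarefree n" and a: "coprime a n" and b: "coprime b n" and ab: "\<not> [a = b] (mod n)"
  shows "\<exists>\<psi>. dirichlet_char n \<psi> \<and> \<psi> a \<noteq> \<psi> b"
proof -
  have n0: "n \<noteq> 0" using n by (cases "n = 0") auto
  define d where "d = nat \<bar>int a - int b\<bar>"
  have cd: "[a = b] (mod k) \<longleftrightarrow> k dvd d" for k
    using cong_int_iff[of a b k] cong_iff_dvd_diff[of "int a" "int b" "int k"] dvd_nat_abs_iff[of k "int a - int b"]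
    by (simp add: d_def)
  have "\<exists>p. prime p \<and> p dvd n \<and> \<not> p dvd d"
  proof (rule ccontr)
    assume H: "\<nexists>p. prime p \<and> p dvd n \<and> \<not> p dvd d"
    have "d \<noteq> 0"
    proof
      assume "d = 0"
      then show False using ab cd[of n] by simp
    qed
    have "n dvd d"
    proof (rule multiplicity_le_imp_dvd[OF n0])
      fix p :: nat assume p: "prime p"
      show "multiplicity p n \<le> multiplicity p d"
      proof (cases "p dvd n")
        case True
        then have "p dvd d" using H p by auto
        then have "1 \<le> multiplicity p d" using p \<open>d \<noteq> 0\<close> by (simp add: prime_multiplicity_gt_zero_iff Suc_le_eq)
        moreover have "multiplicity p n \<le> 1" using n p squarefree_factorial_semiring''[OF n0] by simp
        ultimately show ?thesis by simp
      qed (simp add: not_dvd_imp_multiplicity_0)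
    qed
    then show False using ab cd by simp
  qed
  then obtain p where "prime p" "p dvd n" "\<not> [a = b] (mod p)" using cd by auto
  then show ?thesis using primroot_char_exists[OF _ _ a b] by simp
qed

text \<open>The linear span of the Dirichlet characters. It is an algebra, because products of characters are
  characters.\<close>
inductive char_span :: "nat \<Rightarrow> (nat \<Rightarrow> complex) \<Rightarrow> bool" for n where
  char: "dirichlet_char n \<psi> \<Longrightarrow> char_span n \<psi>"
| add: "char_span n f \<Longrightarrow> char_span n g \<Longrightarrow> char_span n (\<lambda>m. f m + g m)"
| scale: "char_span n f \<Longrightarrow> char_span n (\<lambda>m. c * f m)"

definition principal_char :: "nat \<Rightarrow> nat \<Rightarrow> complex" where
  "principal_char n m = (if coprime m n then 1 else 0)"

lemma dirichlet_char_principal: "dirichlet_char n (principal_char n)"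
proof -
  have "coprime (a + n) n \<longleftrightarrow> coprime a n" for a
    unfolding coprime_iff_gcd_eq_1 by (rule arg_cong[of _ _ "\<lambda>d. d = 1"]) (rule gcd_add1)
  then show ?thesis by (auto simp: dirichlet_char_def principal_char_def)
qed

lemma char_span_mult:
  assumes "char_span n f" "char_span n g"
  shows "char_span n (\<lambda>m. f m * g m)"
  using assms
proof (induction f)
  case (char \<psi>)
  from \<open>char_span n g\<close> show ?case
  proof (induction g)
    case (char \<psi>')
    then show ?case using \<open>dirichlet_char n \<psi>\<close>
      by (intro char_span.char) (auto simp: dirichlet_char_def)
  next
    case (add f g)
    then show ?case using char_span.add[of n "\<lambda>m. \<psi> m * f m" "\<lambda>m. \<psi> m * g m"] by (simp add: distrib_left)
  next
    case (scale f c)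
    then show ?case using char_span.scale[of n "\<lambda>m. \<psi> m * f m" c] by (simp add: mult.left_commute)
  qed
next
  case (add f1 f2)
  then show ?case using char_span.add[of n "\<lambda>m. f1 m * g m" "\<lambda>m. f2 m * g m"] by (simp add: distrib_right)
next
  case (scale f c)
  then show ?case using char_span.scale[of n "\<lambda>m. f m * g m" c] by (simp add: mult.assoc)
qed

lemma char_span_sum:
  assumes "finite A" "\<And>x. x \<in> A \<Longrightarrow> char_span n (F x)"
  shows "char_span n (\<lambda>m. \<Sum>x\<in>A. F x m)"
  using assms
proof (induction A rule: finite_induct)
  case empty
  show ?case using char_span.scale[OF char_span.char[OF dirichlet_char_principal], of n 0] by simp
next
  case (insert x A)
  then show ?case using char_span.add[of n "F x" "\<lambda>m. \<Sum>x\<in>A. F x m"] by simp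
qed

text \<open>Lagrange interpolation: the factor for $b$ is $1$ at $a$ and $0$ at $b$, by a character that separates
  $a$ from $b$.\<close>
lemma char_span_class_indicator:
  assumes n: "squarefree n" and a: "coprime a n"
  shows "char_span n (\<lambda>m. if [m = a] (mod n) then 1 else 0)"
proof -
  have n0: "n > 0" using n by (cases "n = 0") auto
  have "\<forall>b. \<exists>\<psi>. coprime b n \<and> \<not> [b = a] (mod n) \<longrightarrow> dirichlet_char n \<psi> \<and> \<psi> b \<noteq> \<psi> a"
    using dirichlet_char_separates[OF n _ a] by auto
  from choice[OF this]
  have "\<exists>\<psi>. \<forall>b. coprime b n \<and> \<not> [b = a] (mod n) \<longrightarrow> dirichlet_char n (\<psi> b) \<and> \<psi> b b \<noteq> \<psi> b a" .
  then obtain \<psi> where \<psi>: "\<And>b. coprime b n \<Longrightarrow> \<not> [b = a] (mod n) \<Longrightarrow> dirichlet_char n (\<psi> b) \<and> \<psi> b b \<noteq> \<psi> b a"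
    by blast
  define B where "B = {b. b < n \<and> coprime b n \<and> \<not> [b = a] (mod n)}"
  have fin: "finite B" by (simp add: B_def)
  let ?F = "\<lambda>b m. (\<psi> b m - \<psi> b b) / (\<psi> b a - \<psi> b b) * principal_char n m"
  have Fspan: "char_span n (?F b)" if "b \<in> B" for b
  proof -
    have \<psi>b: "dirichlet_char n (\<psi> b)" using \<psi> that by (simp add: B_def)
    have "char_span n (\<lambda>m. \<psi> b m + (- \<psi> b b) * principal_char n m)"
      by (intro char_span.add char_span.scale char_span.char \<psi>b dirichlet_char_principal)
    from char_span.scale[OF this, of "1 / (\<psi> b a - \<psi> b b)"]
    have "char_span n (\<lambda>m. (\<psi> b m - \<psi> b b * principal_char n m) / (\<psi> b a - \<psi> b b))" by simp
    moreover have "(\<psi> b m - \<psi> b b * principal_char n m) / (\<psi> b a - \<psi> b b) = ?F b m" for m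
      using dirichlet_charD(3)[OF \<psi>b, of m] by (auto simp: principal_char_def)
    ultimately show ?thesis by simp
  qed
  have "char_span n (\<lambda>m. principal_char n m * (\<Prod>b\<in>C. ?F b m))" if "C \<subseteq> B" for C
    using finite_subset[OF that fin] that
  proof (induction C rule: finite_induct)
    case empty
    show ?case using char_span.char[OF dirichlet_char_principal] by simp
  next
    case (insert b C)
    have "char_span n (\<lambda>m. (principal_char n m * (\<Prod>b\<in>C. ?F b m)) * ?F b m)"
      by (rule char_span_mult) (use insert Fspan in auto)
    then show ?case using insert by (simp add: mult_ac)
  qed
  then have "char_span n (\<lambda>m. principal_char n m * (\<Prod>b\<in>B. ?F b m))" by blast
  moreover have "principal_char n m * (\<Prod>b\<in>B. ?F b m) = (if [m = a] (mod n) then 1 else 0)" for m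
  proof (cases "[m = a] (mod n)")
    case True
    have cm: "coprime m n" using cong_imp_coprime[OF cong_sym[OF True] a] .
    have "?F b m = 1" if "b \<in> B" for b
    proof -
      have \<psi>b: "dirichlet_char n (\<psi> b)" "\<psi> b b \<noteq> \<psi> b a" using \<psi> that by (auto simp: B_def)
      show ?thesis using dirichlet_char_cong[OF \<psi>b(1) True] \<psi>b(2) cm by (simp add: principal_char_def)
    qed
    then show ?thesis using True cm by (simp add: principal_char_def)
  next
    case False
    show ?thesis
    proof (cases "coprime m n")
      case True
      have mB: "m mod n \<in> B" using True False n0 by (auto simp: B_def unique_euclidean_semiring_class.cong_def)
      then have "dirichlet_char n (\<psi> (m mod n))" using \<psi> by (auto simp: B_def)
      then have "\<psi> (m mod n) m = \<psi> (m mod n) (m mod n)" by (rule dirichlet_char_cong) (simp add: unique_euclidean_semiring_class.cong_def)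
      then have "?F (m mod n) m = 0" by simp
      then have "(\<Prod>b\<in>B. ?F b m) = 0" using mB fin by (meson prod_zero)
      then show ?thesis using False by simp
    qed (use False in \<open>simp add: principal_char_def\<close>)
  qed
  ultimately show ?thesis by simp
qed

lemma char_span_periodic:
  assumes n: "squarefree n" and per: "\<And>m. g (m + n) = g m" and supp: "\<And>m. \<not> coprime m n \<Longrightarrow> g m = 0"
  shows "char_span n g"
proof -
  have n0: "n > 0" using n by (cases "n = 0") auto
  let ?A = "{a. a < n \<and> coprime a n}"
  have "char_span n (\<lambda>m. \<Sum>a\<in>?A. g a * (if [m = a] (mod n) then 1 else 0))"
    by (intro char_span_sum char_span.scale char_span_class_indicator n) auto
  moreover have "(\<Sum>a\<in>?A. g a * (if [m = a] (mod n) then 1 else 0)) = g m" for m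
  proof -
    have "(\<Sum>a\<in>?A. g a * (if [m = a] (mod n) then 1 else 0)) = (\<Sum>a\<in>?A. if a = m mod n then g (m mod n) else 0)"
      by (intro sum.cong refl) (auto simp: unique_euclidean_semiring_class.cong_def)
    also have "\<dots> = g (m mod n)" using n0 supp[of "m mod n"] by (simp add: sum.delta)
    also have "\<dots> = g m" using periodic_mod[of g n m] per by simp
    finally show ?thesis .
  qed
  ultimately show ?thesis by simp
qed

text \<open>The partial sums of $\sum \mu(m) g(m)/m$ converge, and their limit is also the limit of
  $\sum \mu(m) g(m) m^{-s}$ as $s$ decreases to $1$ (the conclusion of Abel's theorem).\<close>
definition moebius_series_regular :: "(nat \<Rightarrow> complex) \<Rightarrow> bool" where
  "moebius_series_regular g \<longleftrightarrow> (\<exists>l. (\<lambda>N. \<Sum>m=1..N. of_int (moebius m) * g m * of_nat m powr (-1)) \<longlonglongrightarrow> l \<and>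
     ((\<lambda>s. \<Sum>m. of_int (moebius m) * g m * of_nat m powr (- of_real s)) \<longlongrightarrow> l) (at_right (1::real)))"

text \<open>The reflection $j \mapsto n - j$ changes the sign of the sum.\<close>
lemma odd_mean_zero:
  fixes h :: "nat \<Rightarrow> complex"
  assumes "1 \<le> n" "h n = 0" "\<And>j. 1 \<le> j \<Longrightarrow> j < n \<Longrightarrow> h (n - j) = - h j"
  shows "(\<Sum>j=1..n. h j) = 0"
proof -
  have "(\<Sum>j=1..n-1. h j) = (\<Sum>j=1..n-1. h (n - j))"
    by (rule sum.reindex_bij_witness[of _ "\<lambda>j. n - j" "\<lambda>j. n - j"]) auto
  also have "\<dots> = (\<Sum>j=1..n-1. - h j)" by (intro sum.cong refl assms(3)) auto
  finally have "(\<Sum>j=1..n-1. h j) = 0" by (simp add: sum_negf)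
  moreover have "(\<Sum>j=1..n. h j) = (\<Sum>j=1..n-1. h j) + h n"
    using assms(1) sum.cl_ivl_Suc[of h 1 "n - 1"] by simp
  ultimately show ?thesis using assms(2) by simp
qed

lemma dirichlet_char_odd_mean_zero:
  assumes \<psi>: "dirichlet_char n \<psi>" and n: "n \<ge> 2" and odd: "\<psi> (n - 1) = -1"
  shows "(\<Sum>j=1..n. \<psi> j) = 0"
proof (rule odd_mean_zero)
  show "1 \<le> n" "\<psi> n = 0" using dirichlet_charD(3)[OF \<psi>, of n] n by auto
  fix j assume j: "1 \<le> j" "j < n"
  obtain d where d: "n = j + d" using j le_Suc_ex[of j n] by auto
  obtain i where i: "j = Suc i" using j by (cases j) auto
  have "(n - 1) * j = (n - j) + (j - 1) * n" unfolding d i by (simp add: algebra_simps)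
  then have "[n - j = (n - 1) * j] (mod n)" by (simp add: unique_euclidean_semiring_class.cong_def)
  from dirichlet_char_cong[OF \<psi> this] show "\<psi> (n - j) = - \<psi> j"
    using dirichlet_charD(2)[OF \<psi>, of "n - 1" j] odd by simp
qed

lemma moebius_series_summable:
  fixes g :: "nat \<Rightarrow> complex"
  assumes "\<And>m. norm (g m) \<le> B" "1 < s"
  shows "summable (\<lambda>m. of_int (moebius m) * g m * of_nat m powr (- of_real s))"
proof -
  have "norm (of_int (moebius m) * g m) \<le> B" for m by (rule norm_moebius_mult_le[OF assms(1)])
  from summable_bounded_dirichlet[OF this, of "of_real s"] show ?thesis
    using assms(2) by (intro summable_norm_cancel[of "\<lambda>m. of_int (moebius m) * g m * of_nat m powr (- of_real s)"]) simp
qed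

lemma moebius_series_regular_add:
  assumes f: "moebius_series_regular f" "\<And>m. norm (f m) \<le> A"
    and g: "moebius_series_regular g" "\<And>m. norm (g m) \<le> B"
  shows "moebius_series_regular (\<lambda>m. f m + g m)"
proof -
  obtain k l where k: "(\<lambda>N. \<Sum>m=1..N. of_int (moebius m) * f m * of_nat m powr (-1)) \<longlonglongrightarrow> k"
      "((\<lambda>s. \<Sum>m. of_int (moebius m) * f m * of_nat m powr (- of_real s)) \<longlongrightarrow> k) (at_right (1::real))"
    and l: "(\<lambda>N. \<Sum>m=1..N. of_int (moebius m) * g m * of_nat m powr (-1)) \<longlonglongrightarrow> l"
      "((\<lambda>s. \<Sum>m. of_int (moebius m) * g m * of_nat m powr (- of_real s)) \<longlongrightarrow> l) (at_right (1::real))"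
    using f(1) g(1) unfolding moebius_series_regular_def by blast
  have "(\<lambda>N. \<Sum>m=1..N. of_int (moebius m) * (f m + g m) * of_nat m powr (-1)) \<longlonglongrightarrow> k + l"
    using tendsto_add[OF k(1) l(1)] by (simp add: sum.distrib[symmetric] algebra_simps)
  moreover have "((\<lambda>s. \<Sum>m. of_int (moebius m) * (f m + g m) * of_nat m powr (- of_real s)) \<longlongrightarrow> k + l) (at_right (1::real))"
  proof (rule Lim_transform_eventually[OF tendsto_add[OF k(2) l(2)]])
    show "\<forall>\<^sub>F s in at_right (1::real). (\<Sum>m. of_int (moebius m) * f m * of_nat m powr (- of_real s)) + (\<Sum>m. of_int (moebius m) * g m * of_nat m powr (- of_real s))
        = (\<Sum>m. of_int (moebius m) * (f m + g m) * of_nat m powr (- of_real s))"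
      using eventually_at_right_less[of "1::real"]
    proof eventually_elim
      case (elim s)
      have "summable (\<lambda>m. of_int (moebius m) * f m * of_nat m powr (- of_real s))"
        "summable (\<lambda>m. of_int (moebius m) * g m * of_nat m powr (- of_real s))"
        using elim by (auto intro!: moebius_series_summable f(2) g(2))
      from suminf_add[OF this] show ?case by (simp add: algebra_simps)
    qed
  qed
  ultimately show ?thesis unfolding moebius_series_regular_def by blast
qed

lemma moebius_series_regular_scale:
  assumes f: "moebius_series_regular f" "\<And>m. norm (f m) \<le> A"
  shows "moebius_series_regular (\<lambda>m. c * f m)"
proof -
  obtain k where k: "(\<lambda>N. \<Sum>m=1..N. of_int (moebius m) * f m * of_nat m powr (-1)) \<longlonglongrightarrow> k"
      "((\<lambda>s. \<Sum>m. of_int (moebius m) * f m * of_nat m powr (- of_real s)) \<longlongrightarrow> k) (at_right (1::real))"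
    using f(1) unfolding moebius_series_regular_def by blast
  have "(\<lambda>N. \<Sum>m=1..N. of_int (moebius m) * (c * f m) * of_nat m powr (-1)) \<longlonglongrightarrow> c * k"
    using tendsto_mult[OF tendsto_const k(1), of c] by (simp add: sum_distrib_left mult_ac)
  moreover have "((\<lambda>s. \<Sum>m. of_int (moebius m) * (c * f m) * of_nat m powr (- of_real s)) \<longlongrightarrow> c * k) (at_right (1::real))"
  proof (rule Lim_transform_eventually[OF tendsto_mult[OF tendsto_const k(2)]])
    show "\<forall>\<^sub>F s in at_right (1::real). c * (\<Sum>m. of_int (moebius m) * f m * of_nat m powr (- of_real s))
        = (\<Sum>m. of_int (moebius m) * (c * f m) * of_nat m powr (- of_real s))"
      using eventually_at_right_less[of "1::real"]
    proof eventually_elim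
      case (elim s)
      have "summable (\<lambda>m. of_int (moebius m) * f m * of_nat m powr (- of_real s))"
        using elim by (auto intro!: moebius_series_summable f(2))
      from suminf_mult[OF this, of c] show ?case by (simp add: mult_ac)
    qed
  qed
  ultimately show ?thesis unfolding moebius_series_regular_def by blast
qed

text \<open>The map that sends $f$ to $f(m) - f(-m)$ kills the even characters and doubles the odd ones. The
  principal character, whose Moebius series is not covered by the mean zero theory, is even.\<close>
lemma moebius_series_regular_char_span:
  assumes "char_span n f" and n: "n \<ge> 2"
  shows "(\<exists>B. \<forall>m. norm (f m) \<le> B) \<and> moebius_series_regular (\<lambda>m. f m - f (m * (n - 1)))"
  using assms(1)
proof (induction f)
  case (char \<psi>)
  have n0: "n > 0" using n by simp
  have b: "norm (\<psi> m) \<le> 1" for m using norm_dirichlet_char[OF char n0, of m] by simp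
  moreover have "moebius_series_regular (\<lambda>m. \<psi> m - \<psi> (m * (n - 1)))"
  proof -
    have "\<psi> (n - 1) ^ 2 = 1"
    proof -
      obtain e where e: "n = 2 + e" using n le_Suc_ex by blast
      have "(n - 1) * (n - 1) = 1 + (n - 2) * n" unfolding e by (simp add: algebra_simps)
      then have "[(n - 1) * (n - 1) = 1] (mod n)"
        unfolding unique_euclidean_semiring_class.cong_def by (simp only: mod_mult_self1)
      from dirichlet_char_cong[OF char this] show ?thesis
        using dirichlet_charD(1,2)[OF char] by (simp add: power2_eq_square)
    qed
    then consider "\<psi> (n - 1) = 1" | "\<psi> (n - 1) = -1" by (auto simp: power2_eq_1_iff)
    then show ?thesis
    proof cases
      case 1
      then have "\<psi> m - \<psi> (m * (n - 1)) = 0" for m using dirichlet_charD(2)[OF char] by simp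
      then show ?thesis unfolding moebius_series_regular_def by (intro exI[of _ 0]) simp
    next
      case 2
      have "\<psi> m - \<psi> (m * (n - 1)) = 2 * \<psi> m" for m using 2 dirichlet_charD(2)[OF char] by simp
      moreover have "moebius_series_regular \<psi>" unfolding moebius_series_regular_def
        using moebius_char_series_converges[OF char n0 dirichlet_char_odd_mean_zero[OF char n 2]] by blast
      ultimately show ?thesis
        using moebius_series_regular_scale[where f = \<psi> and A = 1 and c = 2] b by (simp only:)
    qed
  qed
  ultimately show ?case by blast
next
  case (add f g)
  then obtain A B where AB: "\<And>m. norm (f m) \<le> A" "\<And>m. norm (g m) \<le> B" by blast
  have b: "norm (f m - f (m * (n - 1))) \<le> A + A" "norm (g m - g (m * (n - 1))) \<le> B + B" for m
    using norm_triangle_ineq4 add_mono AB by (meson order_trans)+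
  have "moebius_series_regular (\<lambda>m. (f m - f (m * (n - 1))) + (g m - g (m * (n - 1))))"
    using add.IH by (intro moebius_series_regular_add[OF _ b(1) _ b(2)]) blast+
  moreover have "norm (f m + g m) \<le> A + B" for m using AB by (intro norm_triangle_mono)
  ultimately show ?case by (auto simp: algebra_simps)
next
  case (scale f c)
  then obtain A where A: "\<And>m. norm (f m) \<le> A" by blast
  have b: "norm (f m - f (m * (n - 1))) \<le> A + A" for m
    using norm_triangle_ineq4 add_mono A by (meson order_trans)
  have "moebius_series_regular (\<lambda>m. c * (f m - f (m * (n - 1))))"
    using scale.IH by (intro moebius_series_regular_scale[OF _ b]) blast
  moreover have "norm (c * f m) \<le> norm c * A" for m using A by (simp add: norm_mult mult_left_mono)
  ultimately show ?case by (auto simp: algebra_simps)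
qed

theorem moebius_series_regular_odd:
  assumes n: "squarefree n" "n \<ge> 2" and per: "\<And>m. g (m + n) = g m"
    and supp: "\<And>m. \<not> coprime m n \<Longrightarrow> g m = 0" and odd: "\<And>m. g (m * (n - 1)) = - g m"
  shows "moebius_series_regular g"
proof -
  have "char_span n (\<lambda>m. g m / 2)"
    using char_span.scale[of n g "1/2"] char_span_periodic[of n g] n(1) per supp by simp
  from moebius_series_regular_char_span[OF this n(2)]
  have "moebius_series_regular (\<lambda>m. g m / 2 - g (m * (n - 1)) / 2)" by blast
  then show ?thesis by (simp only: odd) simp
qed

section \<open>Fourier series of the Bernoulli polynomials\<close>

text \<open>Summation by parts: multiplication by $1 - z$ replaces the coefficients $1/m$ by their differences,
  which sum absolutely to $O(1/N)$, uniformly in the closed disc. The claim keeps track of the boundary term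
  $z^{M+1}/(M+1)$, which makes the induction on $M$ exact.\<close>
lemma log_series_block_bound:
  fixes z :: complex
  assumes z: "norm z \<le> 1" and NM: "N \<le> M"
  shows "norm ((1 - z) * (\<Sum>m=N+1..M. z ^ m / of_nat m) + z ^ Suc M / of_nat (M + 1)) \<le> 2 / real (N + 1) - 1 / real (M + 1)"
  using NM
proof (induction M rule: dec_induct)
  case base
  have "norm (z ^ Suc N / of_nat (N + 1)) = norm z ^ Suc N / real (N + 1)"
    by (simp only: norm_divide norm_power norm_of_nat)
  also have "\<dots> \<le> 1 / real (N + 1)" using z by (intro divide_right_mono power_le_one) auto
  finally show ?case by (simp add: diff_divide_distrib[symmetric] del: power_Suc)
next
  case (step M)
  let ?S = "\<lambda>M. (1 - z) * (\<Sum>m=N+1..M. z ^ m / of_nat m) + z ^ Suc M / of_nat (M + 1)"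
  define w where "w = z ^ Suc (Suc M)"
  have w: "norm w \<le> 1" unfolding w_def norm_power using z by (intro power_le_one) auto
  have alg: "(1 - z) * (P + v / a) + z * v / b = ((1 - z) * P + v / a) + - (z * v) * (1 / a - 1 / b)"
    for P v a b :: complex by (simp add: algebra_simps diff_divide_distrib)
  have sm: "(\<Sum>m=N+1..Suc M. z ^ m / of_nat m) = (\<Sum>m=N+1..M. z ^ m / of_nat m) + z ^ Suc M / of_nat (M + 1)"
    using step by simp
  have "?S (Suc M) = ?S M + - w * (1 / of_nat (M + 1) - 1 / of_nat (M + 2))"
    unfolding sm w_def using alg[of "\<Sum>m=N+1..M. z ^ m / of_nat m" "z ^ Suc M" "of_nat (M + 1)" "of_nat (M + 2)"]
    by simp
  then have eq: "?S (Suc M) = ?S M + - w * of_real (1 / real (M + 1) - 1 / real (M + 2))" by simp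
  have "norm (- w * of_real (1 / real (M + 1) - 1 / real (M + 2))) \<le> 1 * (1 / real (M + 1) - 1 / real (M + 2))"
    unfolding norm_mult norm_of_real norm_minus_cancel using w
    by (intro mult_mono) (auto simp: abs_of_nonneg frac_le)
  then have "norm (?S (Suc M)) \<le> (2 / real (N + 1) - 1 / real (M + 1)) + (1 / real (M + 1) - 1 / real (M + 2))"
    unfolding eq mult_1 using step.IH by (rule order_trans[OF norm_triangle_ineq add_mono, rotated])
  then show ?case by (simp add: add.commute)
qed

lemma log_series_disc_bound:
  assumes z: "norm z < 1"
  shows "norm (1 - z) * norm ((\<Sum>m=1..N. z ^ m / of_nat m) + Ln (1 - z)) \<le> 2 / real (N + 1)"
proof -
  let ?S = "\<lambda>M. \<Sum>m=1..M. z ^ m / of_nat m"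
  have "(\<lambda>m. z ^ m / of_nat m) sums (- Ln (1 - z))"
    using sums_minus[OF Ln_series'[of "-z"]] z by simp
  then have S: "?S \<longlonglongrightarrow> - Ln (1 - z)" by (rule sums_imp_LIMSEQ_1) simp
  have L1: "(\<lambda>M. (1 - z) * (?S M - ?S N) + z ^ Suc M / of_nat (M + 1)) \<longlonglongrightarrow> (1 - z) * (- Ln (1 - z) - ?S N) + 0"
  proof (intro tendsto_add tendsto_mult tendsto_const tendsto_diff S)
    show "(\<lambda>M. z ^ Suc M / of_nat (M + 1)) \<longlonglongrightarrow> 0"
    proof (rule tendsto_norm_zero_cancel, rule tendsto_sandwich[OF _ _ tendsto_const LIMSEQ_inverse_real_of_nat])
      have "norm (z ^ Suc M / of_nat (M + 1)) \<le> inverse (real (Suc M))" for M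
      proof -
        have "norm (z ^ Suc M / of_nat (M + 1)) = norm z ^ Suc M / real (M + 1)"
          by (simp only: norm_divide norm_power norm_of_nat)
        also have "\<dots> \<le> 1 / real (M + 1)" using z by (intro divide_right_mono power_le_one) auto
        finally show ?thesis by (simp add: inverse_eq_divide)
      qed
      then show "\<forall>\<^sub>F M in sequentially. norm (z ^ Suc M / of_nat (M + 1)) \<le> inverse (real (Suc M))" by simp
    qed simp
  qed
  have "norm ((1 - z) * (- Ln (1 - z) - ?S N) + 0) \<le> 2 / real (N + 1)"
  proof (rule LIMSEQ_le_const2[OF tendsto_norm[OF L1]], intro exI[of _ N] allI impI)
    fix M assume NM: "N \<le> M"
    have "?S M = ?S N + (\<Sum>m=N+1..M. z ^ m / of_nat m)"
      using sum.ub_add_nat[of 1 N "\<lambda>m. z ^ m / of_nat m" "M - N"] NM by simp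
    then have "norm ((1 - z) * (?S M - ?S N) + z ^ Suc M / of_nat (M + 1)) \<le> 2 / real (N + 1) - 1 / real (M + 1)"
      using log_series_block_bound[OF less_imp_le[OF z] NM] by simp
    also have "\<dots> \<le> 2 / real (N + 1)" by simp
    finally show "norm ((1 - z) * (?S M - ?S N) + z ^ Suc M / of_nat (M + 1)) \<le> 2 / real (N + 1)" .
  qed
  moreover have "norm ((1 - z) * (- Ln (1 - z) - ?S N) + 0) = norm (1 - z) * norm (?S N + Ln (1 - z))"
  proof -
    have "- Ln (1 - z) - ?S N = - (?S N + Ln (1 - z))" by simp
    then show ?thesis by (simp only: norm_mult norm_minus_cancel add_0_right)
  qed
  ultimately show ?thesis by simp
qed

text \<open>Radial limit of the bound inside the disc. This replaces Abel's theorem and is uniform on arcs that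
  stay away from $1$.\<close>
lemma log_series_circle_bound:
  assumes z: "norm z = 1" "z \<noteq> 1"
  shows "norm (1 - z) * norm ((\<Sum>m=1..N. z ^ m / of_nat m) + Ln (1 - z)) \<le> 2 / real (N + 1)"
proof -
  have nz: "1 - z \<notin> \<real>\<^sub>\<le>\<^sub>0"
  proof
    assume "1 - z \<in> \<real>\<^sub>\<le>\<^sub>0"
    then have "Re z \<ge> 1" "Im z = 0" by (auto simp: complex_nonpos_Reals_iff)
    moreover have "Re z \<le> 1" using complex_Re_le_cmod[of z] z by simp
    ultimately have "z = 1" by (simp add: complex_eq_iff)
    then show False using z by simp
  qed
  have "((\<lambda>t. norm (1 - of_real t * z) * norm ((\<Sum>m=1..N. (of_real t * z) ^ m / of_nat m) + Ln (1 - of_real t * z)))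
      \<longlongrightarrow> norm (1 - of_real 1 * z) * norm ((\<Sum>m=1..N. (of_real 1 * z) ^ m / of_nat m) + Ln (1 - of_real 1 * z))) (at_left (1::real))"
    using nz by (intro tendsto_intros) auto
  moreover have "\<forall>\<^sub>F t in at_left (1::real). norm (1 - of_real t * z) * norm ((\<Sum>m=1..N. (of_real t * z) ^ m / of_nat m) + Ln (1 - of_real t * z)) \<le> 2 / real (N + 1)"
  proof -
    have "\<forall>\<^sub>F t in at_left (1::real). t \<in> {0<..<1}" by (rule eventually_at_left_real) simp
    then show ?thesis
      by eventually_elim (rule log_series_disc_bound, use z in \<open>simp add: norm_mult\<close>)
  qed
  ultimately show ?thesis using tendsto_upperbound[of _ _ "at_left (1::real)" "2 / real (N + 1)"] by simp
qed

text \<open>The right-hand sides come from $1 - e^{2\pi i x} = 2\sin(\pi x)\, e^{i\pi(x - 1/2)}$; the exponent lies in the strip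
  of the principal branch.\<close>
lemma Ln_one_minus_cis:
  assumes x: "0 < x" "x < 1"
  shows "Ln (1 - cis (2 * pi * x)) = of_real (ln (2 * sin (pi * x))) + \<i> * of_real (pi * (x - 1/2))"
    and "Ln (1 - cis (- (2 * pi * x))) = of_real (ln (2 * sin (pi * x))) - \<i> * of_real (pi * (x - 1/2))"
proof -
  have s: "sin (pi * x) > 0" using x by (intro sin_gt_zero) auto
  have c: "cos (2 * pi * x) = 1 - 2 * (sin (pi * x))\<^sup>2" using cos_double_sin[of "pi * x"] by (simp add: mult.assoc)
  have d: "sin (2 * pi * x) = 2 * sin (pi * x) * cos (pi * x)" using sin_double[of "pi * x"] by (simp add: mult.assoc)
  have cs: "cos (pi * (x - 1/2)) = sin (pi * x)" "sin (pi * (x - 1/2)) = - cos (pi * x)"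
    using cos_diff[of "pi * x" "pi / 2"] sin_diff[of "pi * x" "pi / 2"] by (simp_all add: right_diff_distrib)
  have "pi * (- 1) < pi * (x - 1/2)" by (rule mult_strict_left_mono) (use x in auto)
  moreover have "pi * (x - 1/2) < pi * 1" by (rule mult_strict_left_mono) (use x in auto)
  ultimately have im: "- pi < pi * (x - 1/2)" "pi * (x - 1/2) < pi" by auto
  let ?a = "of_real (ln (2 * sin (pi * x))) + \<i> * of_real (pi * (x - 1/2))"
  let ?b = "of_real (ln (2 * sin (pi * x))) - \<i> * of_real (pi * (x - 1/2))"
  have E: "exp (complex_of_real (ln (2 * sin (pi * x)))) = of_real (2 * sin (pi * x))"
    using s by (simp add: exp_of_real)
  have "exp ?a = of_real (2 * sin (pi * x)) * cis (pi * (x - 1/2))"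
    unfolding exp_add E cis_conv_exp by simp
  also have "\<dots> = 1 - cis (2 * pi * x)"
    by (auto simp: complex_eq_iff cs c d power2_eq_square)
  finally have "Ln (1 - cis (2 * pi * x)) = Ln (exp ?a)" by simp
  also have "\<dots> = ?a" using im by (intro Ln_exp) auto
  finally show "Ln (1 - cis (2 * pi * x)) = ?a" .
  have "exp ?b = of_real (2 * sin (pi * x)) * cis (- (pi * (x - 1/2)))"
    unfolding exp_diff E cis_conv_exp by (simp add: exp_minus field_simps)
  also have "\<dots> = 1 - cis (- (2 * pi * x))"
    by (auto simp: complex_eq_iff cs c d power2_eq_square)
  finally have "Ln (1 - cis (- (2 * pi * x))) = Ln (exp ?b)" by simp
  also have "\<dots> = ?b" using im by (intro Ln_exp) auto
  finally show "Ln (1 - cis (- (2 * pi * x))) = ?b" .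
qed

lemma norm_one_minus_cis: "norm (1 - cis (2 * pi * x)) = 2 * \<bar>sin (pi * x)\<bar>"
proof -
  have "1 - cis (2 * pi * x) = (- 2 * \<i>) * cis (pi * x) * of_real (sin (pi * x))"
    using cos_double_sin[of "pi * x"] sin_double[of "pi * x"]
    by (auto simp: complex_eq_iff mult.assoc power2_eq_square)
  then show ?thesis by (simp add: norm_mult)
qed

text \<open>For odd $r$ the partial sum vanishes at $x = 1$. This is why $k = n$ has to be left out of the range
  of $k$ for $r = 1$, where the Bernoulli polynomial does not vanish at $1$.\<close>
definition bernoulli_fourier :: "nat \<Rightarrow> nat \<Rightarrow> real \<Rightarrow> complex" where
  "bernoulli_fourier r K x = (\<Sum>m=1..K. (cis (2 * pi * real m * x) + (-1) ^ r * cis (- (2 * pi * real m * x))) / of_nat m ^ r)"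

definition scaled_bernpoly :: "nat \<Rightarrow> real \<Rightarrow> complex" where
  "scaled_bernpoly r x = - ((2 * pi * \<i>) ^ r / fact r) * of_real (bernpoly r x)"

lemma bernpoly_1: "bernpoly 1 x = x - 1 / 2"
  by (simp add: bernpoly_def)

lemma bernoulli_fourier_1_bound:
  assumes x: "0 < x" "x < 1"
  shows "norm (bernoulli_fourier 1 K x - scaled_bernpoly 1 x) * (2 * sin (pi * x)) \<le> 4 / real (K + 1)"
proof -
  let ?z = "cis (2 * pi * x)" and ?w = "cis (- (2 * pi * x))"
  have s: "sin (pi * x) > 0" using x by (intro sin_gt_zero) auto
  have nz: "norm (1 - ?z) = 2 * sin (pi * x)" using norm_one_minus_cis[of x] s by simp
  have nw: "norm (1 - ?w) = 2 * sin (pi * x)" using norm_one_minus_cis[of "-x"] s by simp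
  have z1: "?z \<noteq> 1" "?w \<noteq> 1" using nz nw s by auto
  have zp: "?z ^ m = cis (2 * pi * real m * x)" "?w ^ m = cis (- (2 * pi * real m * x))" for m
    unfolding Complex.DeMoivre by (simp_all add: mult_ac)
  define A B where "A = (\<Sum>m=1..K. ?z ^ m / of_nat m)" and "B = (\<Sum>m=1..K. ?w ^ m / of_nat m)"
  have "bernoulli_fourier 1 K x = A - B"
    by (simp add: bernoulli_fourier_def A_def B_def zp sum_subtractf diff_divide_distrib)
  moreover have "scaled_bernpoly 1 x = Ln (1 - ?w) - Ln (1 - ?z)"
    unfolding Ln_one_minus_cis[OF x] scaled_bernpoly_def bernpoly_1 by (simp add: algebra_simps)
  ultimately have "bernoulli_fourier 1 K x - scaled_bernpoly 1 x = (A + Ln (1 - ?z)) - (B + Ln (1 - ?w))" by simp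
  then have "norm (bernoulli_fourier 1 K x - scaled_bernpoly 1 x) \<le> norm (A + Ln (1 - ?z)) + norm (B + Ln (1 - ?w))"
    using norm_triangle_ineq4 by metis
  then have "norm (bernoulli_fourier 1 K x - scaled_bernpoly 1 x) * (2 * sin (pi * x))
     \<le> (norm (A + Ln (1 - ?z)) + norm (B + Ln (1 - ?w))) * (2 * sin (pi * x))" using s by (intro mult_right_mono) auto
  also have "\<dots> = norm (1 - ?z) * norm (A + Ln (1 - ?z)) + norm (1 - ?w) * norm (B + Ln (1 - ?w))"
    unfolding nz nw by (simp add: algebra_simps)
  also have "\<dots> \<le> 2 / real (K + 1) + 2 / real (K + 1)"
    unfolding A_def B_def using z1 by (intro add_mono log_series_circle_bound) auto
  finally show ?thesis by simp
qed

lemma bernoulli_fourier_1_uniform: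
  assumes ab: "0 < a" "b < 1"
  shows "uniform_limit {a..b} (bernoulli_fourier 1) (scaled_bernpoly 1) sequentially"
proof (cases "a \<le> b")
  case True
  define c where "c = min (sin (pi * a)) (sin (pi * b))"
  have c: "c > 0" unfolding c_def using ab True by (auto intro!: sin_gt_zero)
  have sc: "c \<le> sin (pi * x)" if x: "x \<in> {a..b}" for x
  proof (cases "x \<le> 1/2")
    case True
    have "sin (pi * a) \<le> sin (pi * x)"
      using x ab True by (subst sin_mono_le_eq) (auto intro: order_trans[of _ 0])
    then show ?thesis by (simp add: c_def)
  next
    case False
    have "sin (pi * b) = sin (pi * (1 - b))" "sin (pi * x) = sin (pi * (1 - x))"
      by (simp_all add: right_diff_distrib sin_diff)
    moreover have "sin (pi * (1 - b)) \<le> sin (pi * (1 - x))"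
      using x ab False by (subst sin_mono_le_eq) (auto intro: order_trans[of _ 0])
    ultimately show ?thesis by (simp add: c_def)
  qed
  show ?thesis
  proof (rule uniform_limitI)
    fix e :: real assume e: "e > 0"
    have "(\<lambda>K. 2 / c * inverse (real (Suc K))) \<longlonglongrightarrow> 2 / c * 0" by (intro tendsto_intros LIMSEQ_inverse_real_of_nat)
    then have "\<forall>\<^sub>F K in sequentially. 2 / c * inverse (real (Suc K)) < e" using e by (auto dest: order_tendstoD(2))
    then show "\<forall>\<^sub>F K in sequentially. \<forall>x\<in>{a..b}. dist (bernoulli_fourier 1 K x) (scaled_bernpoly 1 x) < e"
    proof eventually_elim
      case (elim K)
      show ?case
      proof
        fix x assume x: "x \<in> {a..b}"
        have "norm (bernoulli_fourier 1 K x - scaled_bernpoly 1 x) * (2 * c) \<le> norm (bernoulli_fourier 1 K x - scaled_bernpoly 1 x) * (2 * sin (pi * x))"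
          using sc[OF x] by (intro mult_left_mono) auto
        also have "\<dots> \<le> 4 / real (K + 1)" using x ab by (intro bernoulli_fourier_1_bound) auto
        finally have f: "norm (bernoulli_fourier 1 K x - scaled_bernpoly 1 x) * (2 * c) \<le> 4 / real (K + 1)" .
        have "norm (bernoulli_fourier 1 K x - scaled_bernpoly 1 x) \<le> 4 / real (K + 1) / (2 * c)"
          by (rule pos_le_divide_eq[THEN iffD2, OF _ f]) (use c in simp)
        also have "\<dots> = 2 / c * inverse (real (Suc K))" by (simp add: inverse_eq_divide)
        finally show "dist (bernoulli_fourier 1 K x) (scaled_bernpoly 1 x) < e" using elim by (simp add: dist_norm)
      qed
    qed
  qed
qed simp

text \<open>The defining recurrence of the Bernoulli numbers, solved for zero.\<close>
lemma bernoulli_sum_zero: "(\<Sum>k\<le>Suc r. real ((r + 2) choose k) * bernoulli k) = 0"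
proof -
  have "(r + 2) choose (Suc r) = r + 2" using binomial_symmetric[of "Suc r" "r + 2"] by simp
  then show ?thesis by simp
qed

lemma bernpoly_0: "bernpoly r 0 = bernoulli r"
proof -
  have "bernpoly r 0 = (\<Sum>k\<le>r. if k = r then bernoulli r else 0)"
    unfolding bernpoly_def by (intro sum.cong refl) auto
  then show ?thesis by simp
qed

lemma bernpoly_at_1: "2 \<le> r \<Longrightarrow> bernpoly r 1 = bernpoly r 0"
proof -
  assume "2 \<le> r"
  then obtain q where q: "r = Suc (Suc q)" by (metis add_2_eq_Suc le_Suc_ex)
  have "bernpoly r 1 = (\<Sum>k\<le>Suc q. real ((q + 2) choose k) * bernoulli k) + bernoulli (q + 2)"
    unfolding bernpoly_def q by simp
  then show ?thesis unfolding bernoulli_sum_zero bernpoly_0 q by simp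
qed

lemma bernpoly_has_derivative: "(bernpoly (Suc r) has_real_derivative (real (Suc r) * bernpoly r x)) (at x)"
proof -
  have "((\<lambda>x. \<Sum>k\<le>Suc r. real (Suc r choose k) * bernoulli k * x ^ (Suc r - k)) has_real_derivative
      (\<Sum>k\<le>Suc r. real (Suc r choose k) * bernoulli k * (real (Suc r - k) * x ^ (Suc r - k - 1)))) (at x)"
    by (intro DERIV_sum DERIV_cmult) (auto intro!: derivative_eq_intros)
  also have "(\<Sum>k\<le>Suc r. real (Suc r choose k) * bernoulli k * (real (Suc r - k) * x ^ (Suc r - k - 1))) = real (Suc r) * bernpoly r x"
  proof -
    have "(\<Sum>k\<le>Suc r. real (Suc r choose k) * bernoulli k * (real (Suc r - k) * x ^ (Suc r - k - 1)))
        = (\<Sum>k\<le>r. real (Suc r choose k) * bernoulli k * (real (Suc r - k) * x ^ (Suc r - k - 1)))" by simp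
    also have "\<dots> = (\<Sum>k\<le>r. real (Suc r) * (real (r choose k) * bernoulli k * x ^ (r - k)))"
    proof (intro sum.cong refl)
      fix k assume "k \<in> {..r}"
      have "real (Suc r - k) * real (Suc r choose k) = real (Suc r) * real (r choose k)"
        using binomial_absorb_comp[of "Suc r" k] by (metis diff_Suc_1 of_nat_mult)
      moreover have "Suc r - k - 1 = r - k" by simp
      ultimately show "real (Suc r choose k) * bernoulli k * (real (Suc r - k) * x ^ (Suc r - k - 1)) = real (Suc r) * (real (r choose k) * bernoulli k * x ^ (r - k))"
        by (metis (no_types, lifting) mult.assoc mult.commute mult.left_commute)
    qed
    finally show ?thesis by (simp add: bernpoly_def sum_distrib_left)
  qed
  finally show ?thesis by (simp add: bernpoly_def[abs_def])
qed

lemma scaled_bernpoly_has_derivative: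
  "(scaled_bernpoly (Suc r) has_vector_derivative (2 * pi * \<i>) * scaled_bernpoly r x) (at x within S)"
proof -
  have "((\<lambda>x. complex_of_real (bernpoly (Suc r) x)) has_vector_derivative of_real (real (Suc r) * bernpoly r x)) (at x within S)"
    using has_field_derivative_at_within[OF bernpoly_has_derivative[of r x]]
    by (intro has_vector_derivative_of_real) (simp only: has_real_derivative_iff_has_vector_derivative)
  from has_vector_derivative_mult_right[OF this, of "- ((2 * pi * \<i>) ^ Suc r / fact (Suc r))"]
  have "(scaled_bernpoly (Suc r) has_vector_derivative - ((2 * pi * \<i>) ^ Suc r / fact (Suc r)) * of_real (real (Suc r) * bernpoly r x)) (at x within S)"
    by (simp add: scaled_bernpoly_def[abs_def])
  also have "- ((2 * pi * \<i>) ^ Suc r / fact (Suc r)) * of_real (real (Suc r) * bernpoly r x) = (2 * pi * \<i>) * scaled_bernpoly r x"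
    by (simp add: scaled_bernpoly_def fact_Suc field_simps del: of_nat_Suc)
  finally show ?thesis .
qed

lemma cis_has_derivative:
  "((\<lambda>x. cis (c * x)) has_vector_derivative (of_real c * \<i> * cis (c * x))) (at x within S)"
proof -
  have "((\<lambda>z. exp (\<i> * of_real c * z)) has_field_derivative (\<i> * of_real c * exp (\<i> * of_real c * of_real x))) (at (of_real x))"
    by (auto intro!: derivative_eq_intros)
  from has_vector_derivative_real_field[OF this] show ?thesis
    by (simp add: cis_conv_exp mult_ac)
qed

lemma bernoulli_fourier_has_derivative:
  "(bernoulli_fourier (Suc r) K has_vector_derivative (2 * pi * \<i>) * bernoulli_fourier r K x) (at x within S)"
proof -
  have "((\<lambda>x. \<Sum>m=1..K. (1 / of_nat m ^ Suc r) * (cis ((2 * pi * real m) * x) + (-1) ^ Suc r * cis ((- (2 * pi * real m)) * x)))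
      has_vector_derivative (\<Sum>m=1..K. (1 / of_nat m ^ Suc r) * (of_real (2 * pi * real m) * \<i> * cis ((2 * pi * real m) * x)
         + (-1) ^ Suc r * (of_real (- (2 * pi * real m)) * \<i> * cis ((- (2 * pi * real m)) * x))))) (at x within S)"
    by (intro has_vector_derivative_sum has_vector_derivative_mult_right has_vector_derivative_add cis_has_derivative)
  also have "(\<lambda>x. \<Sum>m=1..K. (1 / of_nat m ^ Suc r) * (cis ((2 * pi * real m) * x) + (-1) ^ Suc r * cis ((- (2 * pi * real m)) * x)))
      = bernoulli_fourier (Suc r) K"
    by (auto simp: bernoulli_fourier_def intro!: ext sum.cong)
  also have "(\<Sum>m=1..K. (1 / of_nat m ^ Suc r) * (of_real (2 * pi * real m) * \<i> * cis ((2 * pi * real m) * x)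
         + (-1) ^ Suc r * (of_real (- (2 * pi * real m)) * \<i> * cis ((- (2 * pi * real m)) * x))))
      = (2 * pi * \<i>) * bernoulli_fourier r K x"
    unfolding bernoulli_fourier_def sum_distrib_left
  proof (intro sum.cong refl)
    fix m assume "m \<in> {1..K}"
    then have m: "of_nat m \<noteq> (0::complex)" by simp
    have alg: "(1 / (M * P)) * (2 * p * M * j * A + - s * (- (2 * p * M) * j * B)) = 2 * p * j * ((A + s * B) / P)"
      if "M \<noteq> 0" for M P p j A B s :: complex
      using that by (cases "P = 0") (auto simp: field_simps)
    show "(1 / of_nat m ^ Suc r) * (of_real (2 * pi * real m) * \<i> * cis ((2 * pi * real m) * x)
         + (-1) ^ Suc r * (of_real (- (2 * pi * real m)) * \<i> * cis ((- (2 * pi * real m)) * x)))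
       = 2 * pi * \<i> * ((cis (2 * pi * real m * x) + (-1) ^ r * cis (- (2 * pi * real m * x))) / of_nat m ^ r)"
      using alg[OF m, of "of_nat m ^ r" "of_real pi" \<i> "cis (2 * pi * real m * x)" "(-1) ^ r" "cis (- (2 * pi * real m * x))"]
      by simp
  qed
  finally show ?thesis .
qed

lemma bernoulli_fourier_continuous: "continuous_on S (bernoulli_fourier r K)"
  unfolding bernoulli_fourier_def[abs_def] cis_conv_exp by (intro continuous_intros) auto

lemma scaled_bernpoly_continuous: "continuous_on S (scaled_bernpoly r)"
  unfolding scaled_bernpoly_def[abs_def] bernpoly_def by (intro continuous_intros)

text \<open>Weierstrass test with the majorant $2/m^2$.\<close>
lemma bernoulli_fourier_uniformly_convergent:
  assumes r: "2 \<le> r"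
  shows "\<exists>V. uniform_limit S (bernoulli_fourier r) V sequentially"
proof -
  have "uniformly_convergent_on S (\<lambda>K x. \<Sum>m<K. (cis (2 * pi * real (Suc m) * x) + (-1) ^ r * cis (- (2 * pi * real (Suc m) * x))) / of_nat (Suc m) ^ r)"
  proof (rule Weierstrass_m_test'[of _ _ "\<lambda>m. 2 * inverse (real (Suc m) ^ 2)"])
    fix m x
    have "norm ((cis (2 * pi * real (Suc m) * x) + (-1) ^ r * cis (- (2 * pi * real (Suc m) * x))) / of_nat (Suc m) ^ r) \<le> 2 / real (Suc m) ^ r"
    proof -
      have "norm (cis (2 * pi * real (Suc m) * x) + (-1) ^ r * cis (- (2 * pi * real (Suc m) * x))) \<le> 1 + 1"
        by (rule norm_triangle_le) (simp add: norm_mult norm_power)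
      then show ?thesis unfolding norm_divide norm_power norm_of_nat by (intro divide_right_mono) auto
    qed
    also have "\<dots> \<le> 2 / real (Suc m) ^ 2"
      using r by (intro divide_left_mono power_increasing) auto
    finally show "norm ((cis (2 * pi * real (Suc m) * x) + (-1) ^ r * cis (- (2 * pi * real (Suc m) * x))) / of_nat (Suc m) ^ r) \<le> 2 * inverse (real (Suc m) ^ 2)"
      by (simp add: divide_inverse)
  next
    have "summable (\<lambda>m. inverse (real m ^ 2))" by (rule inverse_power_summable) simp
    then show "summable (\<lambda>m. 2 * inverse (real (Suc m) ^ 2))"
      by (intro summable_mult) (subst summable_Suc_iff)
  qed
  moreover have "(\<Sum>m<K. (cis (2 * pi * real (Suc m) * x) + (-1) ^ r * cis (- (2 * pi * real (Suc m) * x))) / of_nat (Suc m) ^ r) = bernoulli_fourier r K x" for K x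
    unfolding bernoulli_fourier_def
    by (rule sum.reindex_bij_witness[of _ "\<lambda>m. m - 1" Suc]) auto
  ultimately show ?thesis by (simp add: uniformly_convergent_on_def)
qed

lemma integral_bernoulli_fourier: "(bernoulli_fourier r K has_integral 0) {0..1}"
proof -
  have "(bernoulli_fourier (Suc r) K has_vector_derivative (2 * pi * \<i>) * bernoulli_fourier r K x) (at x within {0..1})" for x
    by (rule bernoulli_fourier_has_derivative)
  then have "((\<lambda>x. (2 * pi * \<i>) * bernoulli_fourier r K x) has_integral (bernoulli_fourier (Suc r) K 1 - bernoulli_fourier (Suc r) K 0)) {0..1}"
    by (intro fundamental_theorem_of_calculus) auto
  moreover have "bernoulli_fourier (Suc r) K 1 = bernoulli_fourier (Suc r) K 0"
  proof -
    have "cis (2 * pi * real m) = 1" "cis (- (2 * pi * real m)) = 1" for m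
      using cis_multiple_2pi[of "real m"] cis_multiple_2pi[of "- real m"] by auto
    then show ?thesis by (simp add: bernoulli_fourier_def)
  qed
  ultimately have "((\<lambda>x. (2 * pi * \<i>) * bernoulli_fourier r K x) has_integral 0) {0..1}" by simp
  from has_integral_mult_right[OF this, of "1 / (2 * pi * \<i>)"] show ?thesis by simp
qed

lemma integral_scaled_bernpoly:
  assumes "1 \<le> r"
  shows "(scaled_bernpoly r has_integral 0) {0..1}"
proof -
  have "(scaled_bernpoly (Suc r) has_vector_derivative (2 * pi * \<i>) * scaled_bernpoly r x) (at x within {0..1})" for x
    by (rule scaled_bernpoly_has_derivative)
  then have "((\<lambda>x. (2 * pi * \<i>) * scaled_bernpoly r x) has_integral (scaled_bernpoly (Suc r) 1 - scaled_bernpoly (Suc r) 0)) {0..1}"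
    by (intro fundamental_theorem_of_calculus) auto
  then have "((\<lambda>x. (2 * pi * \<i>) * scaled_bernpoly r x) has_integral 0) {0..1}"
    using bernpoly_at_1[of "Suc r"] assms by (simp add: scaled_bernpoly_def)
  from has_integral_mult_right[OF this, of "1 / (2 * pi * \<i>)"] show ?thesis by simp
qed

text \<open>Integrating the expansion for $r$ termwise over compact subintervals of the open unit interval
  identifies the limit for $r + 1$ up to a constant. Both sides have integral $0$ over the unit
  interval, so the constant is $0$.\<close>
lemma bernoulli_fourier_step:
  assumes r: "1 \<le> r" and IH: "\<And>a b. 0 < a \<Longrightarrow> b < 1 \<Longrightarrow> uniform_limit {a..b} (bernoulli_fourier r) (scaled_bernpoly r) sequentially"
  shows "uniform_limit {0..1} (bernoulli_fourier (Suc r)) (scaled_bernpoly (Suc r)) sequentially"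
proof -
  obtain V where V: "uniform_limit {0..1} (bernoulli_fourier (Suc r)) V sequentially"
    using bernoulli_fourier_uniformly_convergent[of "Suc r"] r by auto
  have Vlim: "(\<lambda>K. bernoulli_fourier (Suc r) K x) \<longlonglongrightarrow> V x" if "x \<in> {0..1}" for x
    using V that by (rule tendsto_uniform_limitI)
  \<comment> \<open>The limit function is not known yet; it is compared with the Bernoulli polynomial below.\<close>
  have Vcont: "continuous_on {0..1} V"
    by (rule uniform_limit_theorem[OF _ V]) (simp_all add: bernoulli_fourier_continuous)
  define D where "D = (\<lambda>x. V x - scaled_bernpoly (Suc r) x)"
  have Dcont: "continuous_on {0..1} D" unfolding D_def by (intro continuous_intros Vcont scaled_bernpoly_continuous)
  have Dconst': "D b = D a" if ab: "0 < a" "a \<le> b" "b < 1" for a b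
  proof -
    obtain I J where I: "\<And>K. (bernoulli_fourier r K has_integral I K) {a..b}" and J: "(scaled_bernpoly r has_integral J) {a..b}"
      and IJ: "I \<longlonglongrightarrow> J"
      using uniform_limit_integral[OF IH[OF ab(1,3)] bernoulli_fourier_continuous] by auto
    have "((\<lambda>x. (2 * pi * \<i>) * bernoulli_fourier r K x) has_integral (bernoulli_fourier (Suc r) K b - bernoulli_fourier (Suc r) K a)) {a..b}" for K
      using ab by (intro fundamental_theorem_of_calculus bernoulli_fourier_has_derivative) auto
    from has_integral_unique[OF this has_integral_mult_right[OF I, of "2 * pi * \<i>"]]
    have e1: "bernoulli_fourier (Suc r) K b - bernoulli_fourier (Suc r) K a = (2 * pi * \<i>) * I K" for K .
    have "((\<lambda>x. (2 * pi * \<i>) * scaled_bernpoly r x) has_integral (scaled_bernpoly (Suc r) b - scaled_bernpoly (Suc r) a)) {a..b}"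
      using ab by (intro fundamental_theorem_of_calculus scaled_bernpoly_has_derivative) auto
    from has_integral_unique[OF this has_integral_mult_right[OF J, of "2 * pi * \<i>"]]
    have e2: "scaled_bernpoly (Suc r) b - scaled_bernpoly (Suc r) a = (2 * pi * \<i>) * J" .
    have "(\<lambda>K. bernoulli_fourier (Suc r) K b - bernoulli_fourier (Suc r) K a) \<longlonglongrightarrow> V b - V a"
      using ab by (intro tendsto_intros Vlim) auto
    moreover have "(\<lambda>K. (2 * pi * \<i>) * I K) \<longlonglongrightarrow> (2 * pi * \<i>) * J" by (intro tendsto_intros IJ)
    ultimately have "V b - V a = (2 * pi * \<i>) * J" unfolding e1 using LIMSEQ_unique by blast
    then show ?thesis using e2 by (simp add: D_def algebra_simps)
  qed
  have Dconst: "D x = D (1/2)" if "x \<in> {0<..<1}" for x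
  proof (cases "x \<le> 1/2")
    case True
    show ?thesis by (rule Dconst'[of x "1/2", symmetric]) (use that True in auto)
  next
    case False
    show ?thesis by (rule Dconst'[of "1/2" x]) (use that False in auto)
  qed
  have Dc: "D x = D (1/2)" if "x \<in> {0..1}" for x
  proof (rule continuous_constant_on_closure[of "{0<..<1::real}" D])
    show "continuous_on (closure {0<..<1}) D" using Dcont by simp
    show "x \<in> closure {0<..<1}" using that by simp
  qed (rule Dconst)
  have "(D has_integral D (1/2)) {0..1}"
    using has_integral_const_real[of "D (1/2)" 0 1] has_integral_cong[of "{0..1}" D "\<lambda>_. D (1/2)", OF Dc] by simp
  moreover have "(D has_integral 0) {0..1}"
  proof -
    obtain I J where I: "\<And>K. (bernoulli_fourier (Suc r) K has_integral I K) {0..1}" and J: "(V has_integral J) {0..1}"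
      and IJ: "I \<longlonglongrightarrow> J"
      using uniform_limit_integral[OF V bernoulli_fourier_continuous] by auto
    have "I = (\<lambda>_. 0)" using has_integral_unique[OF I integral_bernoulli_fourier] by (rule ext)
    then have "J = 0" using LIMSEQ_unique[OF IJ] tendsto_const[of "0::complex" sequentially] by (simp only:)
    then show ?thesis using has_integral_diff[OF J integral_scaled_bernpoly[of "Suc r"]] r by (simp add: D_def)
  qed
  ultimately have "D (1/2) = 0" by (rule has_integral_unique)
  then have "V x = scaled_bernpoly (Suc r) x" if "x \<in> {0..1}" for x using Dc[OF that] by (simp add: D_def)
  then show ?thesis using V by (subst uniform_limit_cong'[where g = "bernoulli_fourier (Suc r)" and i = V]) auto
qed

text \<open>Only the first step $r = 1$ lacks uniform convergence up to the end points.\<close>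
theorem bernoulli_fourier_converges:
  assumes r: "1 \<le> r" and x: "0 < x" "x < 1 \<or> (2 \<le> r \<and> x \<le> 1)"
  shows "(\<lambda>K. bernoulli_fourier r K x) \<longlonglongrightarrow> scaled_bernpoly r x"
proof -
  have step: "(\<forall>a b. 0 < a \<longrightarrow> b < 1 \<longrightarrow> uniform_limit {a..b} (bernoulli_fourier (Suc q)) (scaled_bernpoly (Suc q)) sequentially) \<and>
      (1 \<le> q \<longrightarrow> uniform_limit {0..1} (bernoulli_fourier (Suc q)) (scaled_bernpoly (Suc q)) sequentially)" for q
  proof (induction q)
    case 0
    have "uniform_limit {a..b} (bernoulli_fourier (Suc 0)) (scaled_bernpoly (Suc 0)) sequentially" if "0 < a" "b < 1" for a b
      using bernoulli_fourier_1_uniform[OF that] by (simp only: One_nat_def)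
    then show ?case by simp
  next
    case (Suc q)
    have full: "uniform_limit {0..1} (bernoulli_fourier (Suc (Suc q))) (scaled_bernpoly (Suc (Suc q))) sequentially"
      by (rule bernoulli_fourier_step[OF _ conjunct1[OF Suc, rule_format]]) simp
    have "uniform_limit {a..b} (bernoulli_fourier (Suc (Suc q))) (scaled_bernpoly (Suc (Suc q))) sequentially"
      if "0 < a" "b < 1" for a b
      by (rule uniform_limit_on_subset[OF full]) (use that in auto)
    with full show ?case by blast
  qed
  obtain q where q: "r = Suc q" using r by (cases r) auto
  show ?thesis
  proof (cases "x < 1")
    case True
    have "uniform_limit {x..x} (bernoulli_fourier (Suc q)) (scaled_bernpoly (Suc q)) sequentially"
      by (rule conjunct1[OF step[of q], rule_format, OF x(1) True])
    from tendsto_uniform_limitI[OF this, of x] show ?thesis unfolding q by simp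
  next
    case False
    then have q1: "1 \<le> q" and x1: "x \<in> {0..1}" using x q by auto
    have "uniform_limit {0..1} (bernoulli_fourier (Suc q)) (scaled_bernpoly (Suc q)) sequentially"
      by (rule conjunct2[OF step[of q], rule_format, OF q1])
    from tendsto_uniform_limitI[OF this x1] show ?thesis unfolding q .
  qed
qed

section \<open>Orthogonality on the residues modulo a squarefree number\<close>

definition e_mod :: "nat \<Rightarrow> int \<Rightarrow> complex" where
  "e_mod n x = cis (2 * pi * real_of_int x / real n)"

lemma e_mod_add: "e_mod n (x + y) = e_mod n x * e_mod n y"
  by (simp add: e_mod_def cis_mult add_divide_distrib distrib_left)

lemma e_mod_power: "e_mod n x ^ k = e_mod n (int k * x)"
  unfolding e_mod_def Complex.DeMoivre by (simp add: mult_ac)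

lemma e_mod_multiple:
  assumes "0 < n"
  shows "e_mod n (int n * k) = 1"
proof -
  have "2 * pi * real_of_int (int n * k) / real n = 2 * pi * real_of_int k" using assms by simp
  then show ?thesis unfolding e_mod_def by (simp only: cis_multiple_2pi Ints_of_int)
qed

lemma e_mod_cong:
  assumes n: "0 < n" and xy: "[x = y] (mod int n)"
  shows "e_mod n x = e_mod n y"
proof -
  obtain k where "x = y + int n * k" using xy by (metis cong_iff_lin cong_sym)
  then show ?thesis using e_mod_multiple[OF n, of k] by (simp add: e_mod_add)
qed

lemma e_mod_eq_1:
  assumes n: "0 < n" and 1: "e_mod n x = 1"
  shows "int n dvd x"
proof -
  have "exp (\<i> * of_real (2 * pi * real_of_int x / real n)) = 1" using 1 by (simp add: e_mod_def cis_conv_exp)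
  then obtain k :: int where "2 * pi * real_of_int x / real n = real_of_int (2 * k) * pi" unfolding exp_eq_1 by auto
  then have "2 * pi * real_of_int x = 2 * pi * (real_of_int k * real n)" using n by (simp add: field_simps)
  then have "real_of_int x = real_of_int k * real n" by (simp only: mult_cancel_left) simp
  then have "real_of_int x = real_of_int (k * int n)" by simp
  then have "x = k * int n" by (simp only: of_int_eq_iff)
  then show ?thesis by simp
qed

lemma sum_e_mod:
  assumes n: "0 < n"
  shows "(\<Sum>x<n. e_mod n (int x * a)) = (if int n dvd a then of_nat n else 0)"
proof (cases "int n dvd a")
  case True
  then have "e_mod n (int x * a) = 1" for x using e_mod_multiple[OF n] by (auto elim!: dvdE simp: mult.left_commute)
  then show ?thesis using True by simp
next
  case False
  have q1: "e_mod n a \<noteq> 1" using e_mod_eq_1[OF n] False by blast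
  have "(\<Sum>x<n. e_mod n (int x * a)) = (\<Sum>x<n. e_mod n a ^ x)" by (simp add: e_mod_power)
  also have "\<dots> = (e_mod n a ^ n - 1) / (e_mod n a - 1)" using q1 by (rule geometric_sum)
  also have "e_mod n a ^ n = 1" using e_mod_multiple[OF n, of a] by (simp add: e_mod_power)
  finally show ?thesis using False by simp
qed

text \<open>The idempotent $w_d$ of the ring of residues mod $n$.\<close>
definition crt_idem :: "nat \<Rightarrow> nat \<Rightarrow> int" where
  "crt_idem n d = (SOME w. [w = 0] (mod int d) \<and> [w = 1] (mod int (n div d)))"

lemma squarefree_coprime_div:
  assumes "squarefree (n::nat)" "d dvd n"
  shows "coprime d (n div d)"
proof (rule coprimeI)
  fix c assume c: "c dvd d" "c dvd n div d"
  have "c ^ 2 dvd d * (n div d)" using mult_dvd_mono[OF c] by (simp add: power2_eq_square)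
  then have "c ^ 2 dvd n" using assms(2) by simp
  then show "is_unit c" by (rule squarefreeD[OF assms(1)])
qed

lemma crt_idem:
  assumes "squarefree n" "d dvd n"
  shows "int d dvd crt_idem n d" "[crt_idem n d = 1] (mod int (n div d))"
proof -
  have "coprime (int d) (int (n div d))" using squarefree_coprime_div[OF assms] by (simp only: coprime_int_iff)
  then have "\<exists>w. [w = 0] (mod int d) \<and> [w = 1] (mod int (n div d))" by (rule binary_chinese_remainder_int)
  from someI_ex[OF this] show "int d dvd crt_idem n d" "[crt_idem n d = 1] (mod int (n div d))"
    unfolding crt_idem_def by (auto simp: cong_0_iff)
qed

text \<open>The kernel $E$ of the introduction.\<close>
definition kern :: "nat \<Rightarrow> int \<Rightarrow> complex" where
  "kern n x = (\<Sum>d | d dvd n. of_int (moebius d) * e_mod n (x * crt_idem n d))"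

lemma kern_cong:
  assumes "0 < n" "[x = y] (mod int n)"
  shows "kern n x = kern n y"
  unfolding kern_def
  by (intro sum.cong refl arg_cong2[of _ _ _ _ "(*)"] e_mod_cong assms cong_mult cong_refl)

text \<open>Let $p$ be a common prime factor of $x$ and $n$. The terms of $d$ and $pd$, for $d \mid n/p$, cancel:
  $w_{pd} \equiv w_d$ mod $n/p$, so that $x w_{pd} \equiv x w_d$ mod $n$, while $\mu(pd) = -\mu(d)$.\<close>
lemma kern_eq_0:
  assumes sq: "squarefree n" and x: "\<not> coprime x (int n)"
  shows "kern n x = 0"
proof -
  have n: "0 < n" using sq by (cases "n = 0") auto
  define g where "g = nat (gcd x (int n))"
  have "g \<noteq> 1" using x by (auto simp: g_def coprime_iff_gcd_eq_1 nat_eq_iff)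
  then obtain p where p: "prime p" "p dvd g" using prime_factor_nat by blast
  have ig: "int g = gcd x (int n)" by (simp add: g_def)
  have "int p dvd gcd x (int n)" using p(2) unfolding ig[symmetric] by (simp only: int_dvd_int_iff)
  then have px: "int p dvd x" and pn: "p dvd n" by auto
  define m where "m = n div p"
  have nm: "n = p * m" using pn by (simp add: m_def)
  have cp: "coprime p m" unfolding m_def by (rule squarefree_coprime_div[OF sq pn])
  have pos: "0 < p" "0 < m" using n nm by auto
  have "kern n x = (\<Sum>u | u dvd p. \<Sum>y | y dvd m. of_int (moebius (u * y)) * e_mod n (x * crt_idem n (u * y)))"
    unfolding kern_def unfolding nm by (rule sum_divisors_coprime_mult[OF cp pos])
  also have "{u. u dvd p} = {1, p}" using p(1) by (auto simp: prime_nat_iff)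
  also have "(\<Sum>u\<in>{1, p}. \<Sum>y | y dvd m. of_int (moebius (u * y)) * e_mod n (x * crt_idem n (u * y)))
     = (\<Sum>y | y dvd m. of_int (moebius y) * e_mod n (x * crt_idem n y)) + (\<Sum>y | y dvd m. of_int (moebius (p * y)) * e_mod n (x * crt_idem n (p * y)))"
    using prime_gt_1_nat[OF p(1)] by simp
  also have "(\<Sum>y | y dvd m. of_int (moebius (p * y)) * e_mod n (x * crt_idem n (p * y))) = (\<Sum>y | y dvd m. - (of_int (moebius y) * e_mod n (x * crt_idem n y)))"
  proof (intro sum.cong refl)
    fix y assume "y \<in> {y. y dvd m}"
    then have y: "y dvd m" by simp
    then obtain z where z: "m = y * z" unfolding dvd_def by blast
    have ypos: "0 < y" "0 < z" using pos z by auto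
    have cpy: "coprime p y" using coprime_divisors[OF dvd_refl y cp] .
    have mu: "moebius (p * y) = - moebius y"
      using moebius_coprime_mult[OF pos(1) ypos(1) cpy] moebius_prime[OF p(1)] by simp
    have d1: "y dvd n" and d2: "p * y dvd n" unfolding nm z by auto
    have q1: "n div y = p * z" and q2: "n div (p * y) = z" unfolding nm z using pos ypos by (simp_all add: mult.assoc mult.left_commute)
    have "coprime y z" using squarefree_coprime_div[of m y] squarefree_mono[of m n] sq nm z ypos by auto
    then have cyz: "coprime (int y) (int z)" by (simp only: coprime_int_iff)
    have "int y dvd crt_idem n (p * y)" using crt_idem(1)[OF sq d2] by (metis dvd_mult_right of_nat_mult)
    then have 1: "int y dvd crt_idem n (p * y) - crt_idem n y" using crt_idem(1)[OF sq d1] by (rule dvd_diff)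
    have "[crt_idem n y = 1] (mod int p * int z)" using crt_idem(2)[OF sq d1] unfolding q1 by simp
    then have "[crt_idem n y = 1] (mod int z)" by (rule cong_dvd_modulus) simp
    then have "[crt_idem n (p * y) = crt_idem n y] (mod int z)"
      using crt_idem(2)[OF sq d2] unfolding q2 by (metis cong_sym cong_trans)
    then have 2: "int z dvd crt_idem n (p * y) - crt_idem n y" by (simp only: cong_iff_dvd_diff)
    have "int y * int z dvd crt_idem n (p * y) - crt_idem n y" by (rule divides_mult[OF 1 2 cyz])
    from mult_dvd_mono[OF px this] have "int n dvd x * crt_idem n (p * y) - x * crt_idem n y"
      unfolding nm z by (simp add: mult.assoc right_diff_distrib)
    then have "[x * crt_idem n (p * y) = x * crt_idem n y] (mod int n)" by (simp only: cong_iff_dvd_diff)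
    from e_mod_cong[OF n this] show "of_int (moebius (p * y)) * e_mod n (x * crt_idem n (p * y)) = - (of_int (moebius y) * e_mod n (x * crt_idem n y))"
      by (simp add: mu)
  qed
  finally show ?thesis by (simp add: sum_negf)
qed

text \<open>The sum over $x$ of $e(x(a w_d - b))$ is nonzero only if $n$ divides $a w_d - b$. Then $d$ divides $b$,
  hence $d = 1$ and $w_1 = 1$.\<close>
lemma sum_kern_e_mod:
  assumes sq: "squarefree n" and b: "coprime b (int n)"
  shows "(\<Sum>x<n. kern n (int x * a) * e_mod n (- (int x * b))) = (if [a = b] (mod int n) then of_nat n else 0)"
proof -
  have n: "0 < n" using sq by (cases "n = 0") auto
  have "(\<Sum>x<n. kern n (int x * a) * e_mod n (- (int x * b)))
      = (\<Sum>x<n. \<Sum>d | d dvd n. of_int (moebius d) * e_mod n (int x * (a * crt_idem n d - b)))"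
    unfolding kern_def sum_distrib_right
    by (intro sum.cong refl) (simp add: e_mod_add[symmetric] algebra_simps)
  also have "\<dots> = (\<Sum>d | d dvd n. of_int (moebius d) * (\<Sum>x<n. e_mod n (int x * (a * crt_idem n d - b))))"
    by (subst sum.swap) (simp add: sum_distrib_left)
  also have "\<dots> = (\<Sum>d | d dvd n. if d = 1 then (if [a = b] (mod int n) then of_nat n else 0) else 0)"
  proof (intro sum.cong refl)
    fix d assume "d \<in> {d. d dvd n}"
    then have d: "d dvd n" by simp
    show "of_int (moebius d) * (\<Sum>x<n. e_mod n (int x * (a * crt_idem n d - b))) = (if d = 1 then (if [a = b] (mod int n) then of_nat n else 0) else 0)"
    proof (cases "d = 1")
      case True
      have "[a * crt_idem n 1 = a * 1] (mod int n)" using crt_idem(2)[OF sq, of 1] by (intro cong_mult) auto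
      then have "[a * crt_idem n 1 = b] (mod int n) \<longleftrightarrow> [a = b] (mod int n)" by (metis cong_sym cong_trans mult.right_neutral)
      then have "int n dvd a * crt_idem n 1 - b \<longleftrightarrow> [a = b] (mod int n)" by (simp only: cong_iff_dvd_diff)
      then show ?thesis using True by (simp add: sum_e_mod[OF n])
    next
      case False
      have "\<not> int n dvd a * crt_idem n d - b"
      proof
        assume "int n dvd a * crt_idem n d - b"
        then have "int d dvd a * crt_idem n d - b" using d by (meson dvd_trans int_dvd_int_iff)
        moreover have "int d dvd a * crt_idem n d" using crt_idem(1)[OF sq d] by simp
        ultimately have "int d dvd b" using dvd_diff[of "int d" "a * crt_idem n d" "a * crt_idem n d - b"] by simp
        moreover have "int d dvd int n" using d by simp
        ultimately have "is_unit (int d)" using b by (rule coprime_common_divisor[rotated])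
        then show False using False by simp
      qed
      then show ?thesis using False by (simp add: sum_e_mod[OF n])
    qed
  qed
  also have "\<dots> = (if [a = b] (mod int n) then of_nat n else 0)"
    using n by (subst sum.delta) auto
  finally show ?thesis .
qed

section \<open>Convolution of the two series\<close>

text \<open>The parts of the kernel and of the exponential that have the parity of $r$.\<close>
definition kern_sym :: "nat \<Rightarrow> nat \<Rightarrow> int \<Rightarrow> complex" where
  "kern_sym n r x = kern n x + (-1) ^ r * kern n (- x)"

definition e_sym :: "nat \<Rightarrow> nat \<Rightarrow> int \<Rightarrow> complex" where
  "e_sym n r x = e_mod n (- x) + (-1) ^ r * e_mod n x"

lemma norm_e_mod: "norm (e_mod n x) = 1"
  by (simp add: e_mod_def)

lemma kern_sym_cong: "0 < n \<Longrightarrow> [x = y] (mod int n) \<Longrightarrow> kern_sym n r x = kern_sym n r y"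
  unfolding kern_sym_def by (intro arg_cong2[of _ _ _ _ "(+)"] arg_cong2[of _ _ _ _ "(*)"] refl kern_cong) (auto simp: cong_minus_minus_iff)

lemma e_sym_cong: "0 < n \<Longrightarrow> [x = y] (mod int n) \<Longrightarrow> e_sym n r x = e_sym n r y"
  unfolding e_sym_def by (intro arg_cong2[of _ _ _ _ "(+)"] arg_cong2[of _ _ _ _ "(*)"] refl e_mod_cong) (auto simp: cong_minus_minus_iff)

lemma sign_square: "(-1) ^ r * ((-1) ^ r * z) = (z::complex)"
  by (simp flip: mult.assoc power_mult_distrib)

lemma kern_sym_minus: "kern_sym n r (- x) = (-1) ^ r * kern_sym n r x"
  by (simp add: kern_sym_def distrib_left sign_square)

lemma e_sym_minus: "e_sym n r (- x) = (-1) ^ r * e_sym n r x"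
  by (simp add: e_sym_def distrib_left sign_square)

lemma kern_sym_eq_0: "squarefree n \<Longrightarrow> \<not> coprime x (int n) \<Longrightarrow> kern_sym n r x = 0"
  by (simp add: kern_sym_def kern_eq_0)

lemma norm_kern_sym_le: "norm (kern_sym n r x) \<le> 2 * real (card {d. d dvd n})"
proof -
  have kern: "norm (kern n y) \<le> real (card {d. d dvd n})" for y
  proof -
    have "norm (kern n y) \<le> (\<Sum>d | d dvd n. 1)"
      unfolding kern_def
    proof (rule sum_norm_le)
      fix d
      show "norm (of_int (moebius d) * e_mod n (y * crt_idem n d)) \<le> 1"
        using abs_moebius_le[of d] by (simp add: norm_mult norm_e_mod)
    qed
    then show ?thesis by simp
  qed
  have "norm (kern_sym n r x) \<le> norm (kern n x) + norm (kern n (- x))"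
    unfolding kern_sym_def by (rule order_trans[OF norm_triangle_ineq]) (simp add: norm_mult norm_power)
  then show ?thesis using kern[of x] kern[of "- x"] by simp
qed

lemma norm_e_sym_le: "norm (e_sym n r x) \<le> 2"
  unfolding e_sym_def by (rule order_trans[OF norm_triangle_ineq]) (simp add: norm_mult norm_power norm_e_mod)

definition sym_delta :: "nat \<Rightarrow> nat \<Rightarrow> int \<Rightarrow> int \<Rightarrow> complex" where
  "sym_delta n r a b = (if [a = b] (mod int n) then 1 else 0) + (-1) ^ r * (if [a = - b] (mod int n) then 1 else 0)"

lemma sum_kern_sym_e_sym:
  assumes sq: "squarefree n" and b: "coprime b (int n)"
  shows "(\<Sum>x<n. kern_sym n r (int x * a) * e_sym n r (int x * b)) = 2 * of_nat n * sym_delta n r a b"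
proof -
  let ?S = "\<lambda>a b. \<Sum>x<n. kern n (int x * a) * e_mod n (- (int x * b))"
  have b': "coprime (- b) (int n)" using b by simp
  have "kern_sym n r (int x * a) * e_sym n r (int x * b)
      = kern n (int x * a) * e_mod n (- (int x * b)) + (-1) ^ r * (kern n (int x * a) * e_mod n (- (int x * (- b))))
      + (-1) ^ r * (kern n (int x * (- a)) * e_mod n (- (int x * b))) + kern n (int x * (- a)) * e_mod n (- (int x * (- b)))" for x
    using sign_square[of r "kern n (int x * (- a)) * e_mod n (- (int x * (- b)))"]
    by (simp add: kern_sym_def e_sym_def algebra_simps)
  then have "(\<Sum>x<n. kern_sym n r (int x * a) * e_sym n r (int x * b))
      = ?S a b + (-1) ^ r * ?S a (- b) + (-1) ^ r * ?S (- a) b + ?S (- a) (- b)"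
    by (simp only: sum.distrib sum_distrib_left)
  moreover have "[- a = b] (mod int n) \<longleftrightarrow> [a = - b] (mod int n)" "[- a = - b] (mod int n) \<longleftrightarrow> [a = b] (mod int n)"
    using cong_minus_minus_iff[of "- a" b "int n"] cong_minus_minus_iff[of a b "int n"] by simp_all
  ultimately show ?thesis
    unfolding sum_kern_e_mod[OF sq b] sum_kern_e_mod[OF sq b'] sym_delta_def by (simp add: algebra_simps)
qed

lemma inv_mod_cong:
  assumes n: "1 < n" and m: "coprime m n"
  shows "[int (inv_mod n m) * int m = 1] (mod int n)"
proof -
  have "modular_inverse (int n) (int m) \<ge> 0" using n by (intro modular_inverse_int_nonneg) simp
  moreover have "coprime (int m) (int n)" using m by simp
  ultimately show ?thesis unfolding inv_mod_def using cong_modular_inverse2[of "int m" "int n"] by simp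
qed

lemma inv_mod_coprime:
  assumes n: "1 < n" and m: "coprime m n"
  shows "coprime (int (inv_mod n m)) (int n)"
proof -
  have "coprime (int (inv_mod n m) * int m) (int n)"
    by (rule cong_imp_coprime[OF cong_sym[OF inv_mod_cong[OF assms]]]) simp
  then show ?thesis by simp
qed

definition kern_series :: "nat \<Rightarrow> nat \<Rightarrow> real \<Rightarrow> int \<Rightarrow> complex" where
  "kern_series n r s y = (\<Sum>m. kern_sym n r (int m * y) * of_nat m powr (- of_real s))"

definition inv_exp :: "nat \<Rightarrow> nat \<Rightarrow> int \<Rightarrow> nat \<Rightarrow> complex" where
  "inv_exp n r y l = (if coprime l n then e_sym n r (int (inv_mod n l) * y) else 0)"

definition inv_series :: "nat \<Rightarrow> nat \<Rightarrow> real \<Rightarrow> int \<Rightarrow> complex" where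
  "inv_series n r s y = (\<Sum>l. of_int (moebius l) * inv_exp n r y l * of_nat l powr (- of_real s))"

lemma norm_inv_exp_le: "norm (inv_exp n r y l) \<le> 2"
  using norm_e_sym_le by (simp add: inv_exp_def)

lemma norm_moebius_inv_exp_le: "norm (of_int (moebius l) * inv_exp n r y l) \<le> 2"
  by (rule norm_moebius_mult_le[OF norm_inv_exp_le])

text \<open>The coefficient of $N^{-s}$ in the sum of products is a sum over $d \mid N$ of $\mu(N/d)$ times an
  orthogonality sum. The latter compares $da$ with $(N/d)^* b$, that is $Na$ with $b$, and so does not
  depend on $d$. Moebius inversion leaves only $N = 1$.\<close>
lemma series_convolution:
  assumes n: "3 \<le> n" and sq: "squarefree n" and b: "coprime b (int n)" and s: "1 < s"
  shows "(\<Sum>x<n. kern_series n r s (int x * a) * inv_series n r s (int x * b)) = 2 * of_nat n * sym_delta n r a b"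
proof -
  have n1: "1 < n" "0 < n" using n by auto
  have res: "1 < Re (complex_of_real s)" using s by simp
  let ?F = "\<lambda>x m. kern_sym n r (int m * (int x * a))"
  let ?H = "\<lambda>x l. of_int (moebius l) * inv_exp n r (int x * b) l"
  have sF: "summable (\<lambda>m. norm (?F x m * of_nat m powr (- of_real s)))" for x
    by (rule summable_bounded_dirichlet[OF norm_kern_sym_le res])
  have sH: "summable (\<lambda>m. norm (?H x m * of_nat m powr (- of_real s)))" for x
    by (rule summable_bounded_dirichlet[OF norm_moebius_inv_exp_le res])
  have inner: "(\<Sum>x<n. dirichlet_conv (?F x) (?H x) N) = (if N = 1 then 2 * of_nat n * sym_delta n r a b else 0)" for N
  proof (cases "N = 0")
    case False
    have trm: "(\<Sum>x<n. ?F x d * ?H x (N div d)) = (if coprime (N div d) n then of_int (moebius (N div d)) * (2 * of_nat n * sym_delta n r (int N * a) b) else 0)"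
      if d: "d dvd N" for d
    proof (cases "coprime (N div d) n")
      case True
      define q where "q = N div d"
      define v where "v = int (inv_mod n q)"
      have Nq: "N = d * q" using d by (simp add: q_def)
      have cq: "coprime q n" using True by (simp add: q_def)
      have vq: "[v * int q = 1] (mod int n)" unfolding v_def by (rule inv_mod_cong[OF n1(1) cq])
      have cv: "coprime v (int n)" unfolding v_def by (rule inv_mod_coprime[OF n1(1) cq])
      have cvb: "coprime (v * b) (int n)" using cv b by simp
      have eqv: "[int d * a = v * c] (mod int n) \<longleftrightarrow> [int N * a = c] (mod int n)" for c
      proof
        assume H: "[int d * a = v * c] (mod int n)"
        have "[int q * (int d * a) = int q * (v * c)] (mod int n)" by (rule cong_mult[OF cong_refl H])
        moreover have "[(v * int q) * c = 1 * c] (mod int n)" by (rule cong_mult[OF vq cong_refl])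
        moreover have "int q * (v * c) = (v * int q) * c" "int q * (int d * a) = int N * a" by (simp_all add: Nq)
        ultimately show "[int N * a = c] (mod int n)" using cong_trans by (simp only: mult_1)
      next
        assume H: "[int N * a = c] (mod int n)"
        have "[v * (int N * a) = v * c] (mod int n)" by (rule cong_mult[OF cong_refl H])
        moreover have "[1 * (int d * a) = (v * int q) * (int d * a)] (mod int n)" by (rule cong_mult[OF cong_sym[OF vq] cong_refl])
        moreover have "(v * int q) * (int d * a) = v * (int N * a)" by (simp add: Nq)
        ultimately show "[int d * a = v * c] (mod int n)" using cong_trans by (simp only: mult_1)
      qed
      have "(\<Sum>x<n. ?F x d * ?H x q) = of_int (moebius q) * (\<Sum>x<n. kern_sym n r (int x * (int d * a)) * e_sym n r (int x * (v * b)))"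
        unfolding sum_distrib_left using cq by (intro sum.cong refl) (simp add: inv_exp_def v_def mult_ac)
      also have "\<dots> = of_int (moebius q) * (2 * of_nat n * sym_delta n r (int d * a) (v * b))"
        by (simp only: sum_kern_sym_e_sym[OF sq cvb])
      also have "sym_delta n r (int d * a) (v * b) = sym_delta n r (int N * a) b"
        unfolding sym_delta_def using eqv[of b] eqv[of "- b"] by simp
      finally show ?thesis using cq by (simp add: q_def)
    qed (simp add: inv_exp_def)
    have "(\<Sum>x<n. dirichlet_conv (?F x) (?H x) N) = (\<Sum>d | d dvd N. \<Sum>x<n. ?F x d * ?H x (N div d))"
      unfolding dirichlet_conv_def by (rule sum.swap)
    also have "\<dots> = (\<Sum>d | d dvd N. (if coprime (N div d) n then of_int (moebius (N div d)) * (2 * of_nat n * sym_delta n r (int N * a) b) else 0))"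
      by (intro sum.cong refl trm) simp
    also have "\<dots> = (if N = 1 then 2 * of_nat n * sym_delta n r a b else 0)"
    proof (cases "coprime N n")
      case True
      have "coprime (N div d) n" if "d dvd N" for d
        using coprime_divisors[OF _ dvd_refl True, of "N div d"] that by (metis dvd_mult_div_cancel dvd_triv_right)
      then have "(\<Sum>d | d dvd N. (if coprime (N div d) n then of_int (moebius (N div d)) * (2 * of_nat n * sym_delta n r (int N * a) b) else 0))
          = (\<Sum>d | d dvd N. of_int (moebius (N div d))) * (2 * of_nat n * sym_delta n r (int N * a) b)"
        unfolding sum_distrib_right by (intro sum.cong refl) simp
      also have "(\<Sum>d | d dvd N. of_int (moebius (N div d))) = (\<Sum>d | d dvd N. of_int (moebius d) * (1::complex))"
        by (rule sum.reindex_bij_witness[of _ "\<lambda>d. N div d" "\<lambda>d. N div d"]) (use False in \<open>auto simp: div_div_eq_right\<close>)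
      also have "\<dots> = (if N = 1 then 1 else 0)" using moebius_inversion[of N] False by (simp add: dirichlet_conv_def)
      finally show ?thesis by simp
    next
      case nc: False
      have "N \<noteq> 1" using nc by auto
      have ncN: "\<not> [int N * a = c] (mod int n)" if "coprime c (int n)" for c
      proof
        assume "[int N * a = c] (mod int n)"
        then have "coprime (int N * a) (int n)" using that by (metis cong_imp_coprime cong_sym)
        then show False using nc by simp
      qed
      have "sym_delta n r (int N * a) b = 0" unfolding sym_delta_def using ncN[of b] ncN[of "- b"] b by simp
      then show ?thesis using \<open>N \<noteq> 1\<close> by (simp cong: if_cong)
    qed
    finally show ?thesis .
  qed (simp add: dirichlet_conv_def)
  have "(\<Sum>x<n. kern_series n r s (int x * a) * inv_series n r s (int x * b)) = (\<Sum>x<n. \<Sum>N. dirichlet_conv (?F x) (?H x) N * of_nat N powr (- of_real s))"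
    unfolding kern_series_def inv_series_def by (intro sum.cong refl dirichlet_series_mult(2)[symmetric] sF sH)
  also have "\<dots> = (\<Sum>N. \<Sum>x<n. dirichlet_conv (?F x) (?H x) N * of_nat N powr (- of_real s))"
    by (rule suminf_sum[symmetric]) (rule summable_norm_cancel[OF dirichlet_series_mult(1)[OF sF sH]])
  also have "\<dots> = (\<Sum>N. if N = 1 then 2 * of_nat n * sym_delta n r a b else 0)"
  proof (intro arg_cong[of _ _ suminf] ext)
    fix N
    have "(\<Sum>x<n. dirichlet_conv (?F x) (?H x) N * of_nat N powr (- of_real s)) = (\<Sum>x<n. dirichlet_conv (?F x) (?H x) N) * of_nat N powr (- of_real s)"
      by (simp only: sum_distrib_right)
    also have "\<dots> = (if N = 1 then 2 * of_nat n * sym_delta n r a b else 0)" unfolding inner by simp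
    finally show "(\<Sum>x<n. dirichlet_conv (?F x) (?H x) N * of_nat N powr (- of_real s)) = (if N = 1 then 2 * of_nat n * sym_delta n r a b else 0)" .
  qed
  also have "\<dots> = 2 * of_nat n * sym_delta n r a b"
    using sums_single[of 1 "\<lambda>_. 2 * of_nat n * sym_delta n r a b"] by (simp add: sums_iff)
  finally show ?thesis .
qed

lemma index_set_iff: "j \<in> index_set n \<longleftrightarrow> 1 \<le> j \<and> 2 * j \<le> n \<and> coprime j n"
  unfolding index_set_def by auto

lemma finite_index_set: "finite (index_set n)"
  by (rule finite_subset[of _ "{..n}"]) (auto simp: index_set_iff)

text \<open>The units mod $n$ are the disjoint union of the index set and its image under $x \mapsto n - x$. The
  two parts do not meet because $n/2$ is not a unit for $n \ge 3$.\<close>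
lemma half_range_sum:
  fixes F :: "int \<Rightarrow> complex"
  assumes n: "3 \<le> n" and per: "\<And>x y. [x = y] (mod int n) \<Longrightarrow> F x = F y"
    and even: "\<And>x. F (- x) = F x" and supp: "\<And>x. \<not> coprime x (int n) \<Longrightarrow> F x = 0"
  shows "(\<Sum>x<n. F (int x)) = 2 * (\<Sum>x\<in>index_set n. F (int x))"
proof -
  let ?U = "{x. x < n \<and> coprime x n}" and ?R = "index_set n"
  have RU: "?R \<subseteq> ?U" using n by (auto simp: index_set_iff)
  \<comment> \<open>The middle point $n/2$ would be counted only once.\<close>
  have half: "2 * x \<noteq> n" if "coprime x n" for x
  proof
    assume "2 * x = n"
    then have "x dvd n" by auto
    then have "x = 1" using that by (metis coprime_common_divisor dvd_refl nat_dvd_1_iff_1)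
    then show False using \<open>2 * x = n\<close> n by simp
  qed
  have cpl: "coprime (n - x) n \<longleftrightarrow> coprime x n" if "x \<le> n" for x
    unfolding coprime_iff_gcd_eq_1 gcd_diff2_nat[OF that] ..
  have "(\<Sum>x<n. F (int x)) = (\<Sum>x\<in>?U. F (int x))"
    by (rule sum.mono_neutral_right) (auto simp: supp)
  also have "\<dots> = (\<Sum>x\<in>?R. F (int x)) + (\<Sum>x\<in>?U - ?R. F (int x))"
    using sum.subset_diff[OF RU] by (simp add: add.commute)
  also have "(\<Sum>x\<in>?U - ?R. F (int x)) = (\<Sum>x\<in>?R. F (int x))"
  proof (rule sum.reindex_bij_witness[of _ "\<lambda>x. n - x" "\<lambda>x. n - x"])
    fix x assume x: "x \<in> ?U - ?R"
    then have "x \<noteq> 0" using n by (intro notI) auto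
    then show "n - x \<in> ?R" using x cpl[of x] by (auto simp: index_set_iff)
    show "n - (n - x) = x" using x by auto
    have "[int (n - x) = - int x] (mod int n)" using x by (simp add: cong_iff_dvd_diff of_nat_diff)
    then have "F (int (n - x)) = F (- int x)" by (rule per)
    then show "F (int (n - x)) = F (int x)" by (simp only: even)
  next
    fix x assume x: "x \<in> ?R"
    then show "n - (n - x) = x" by (auto simp: index_set_iff)
    show "n - x \<in> ?U - ?R" using x half[of x] cpl[of x] by (auto simp: index_set_iff)
  qed
  finally show ?thesis by simp
qed

section \<open>The numbers B_tilde as limits of kernel sums\<close>

lemma inv_mod_unique:
  assumes n: "1 < n" and l: "coprime l n" and v: "[v * int l = 1] (mod int n)"
  shows "[v = int (inv_mod n l)] (mod int n)"
proof -
  have "[v * int l = int (inv_mod n l) * int l] (mod int n)"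
    by (rule cong_trans[OF v cong_sym[OF inv_mod_cong[OF n l]]])
  moreover have "coprime (int l) (int n)" using l by simp
  ultimately show ?thesis by (simp add: cong_mult_rcancel)
qed

lemma kern_series_cong: "0 < n \<Longrightarrow> [x = y] (mod int n) \<Longrightarrow> kern_series n r s x = kern_series n r s y"
  unfolding kern_series_def by (intro arg_cong[of _ _ suminf] ext arg_cong2[of _ _ _ _ "(*)"] refl kern_sym_cong cong_mult cong_refl)

lemma inv_exp_cong: "0 < n \<Longrightarrow> [x = y] (mod int n) \<Longrightarrow> inv_exp n r x l = inv_exp n r y l"
  unfolding inv_exp_def by (intro if_cong refl e_sym_cong cong_mult cong_refl)

lemma inv_series_cong: "0 < n \<Longrightarrow> [x = y] (mod int n) \<Longrightarrow> inv_series n r s x = inv_series n r s y"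
  unfolding inv_series_def by (intro arg_cong[of _ _ suminf] ext arg_cong2[of _ _ _ _ "(*)"] refl inv_exp_cong)

lemma inv_exp_minus: "inv_exp n r (- y) l = (-1) ^ r * inv_exp n r y l"
  by (simp add: inv_exp_def e_sym_minus)

lemma series_minus:
  assumes "1 < s"
  shows "kern_series n r s (- y) = (-1) ^ r * kern_series n r s y" "inv_series n r s (- y) = (-1) ^ r * inv_series n r s y"
proof -
  have s: "1 < Re (complex_of_real s)" using assms by simp
  have 1: "summable (\<lambda>m. kern_sym n r (int m * y) * of_nat m powr (- of_real s))"
    by (rule summable_norm_cancel[OF summable_bounded_dirichlet[OF norm_kern_sym_le s]])
  show "kern_series n r s (- y) = (-1) ^ r * kern_series n r s y"
    unfolding kern_series_def suminf_mult[OF 1, symmetric] by (simp add: kern_sym_minus mult.assoc)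
  have 2: "summable (\<lambda>l. of_int (moebius l) * inv_exp n r y l * of_nat l powr (- of_real s))"
    by (rule summable_norm_cancel[OF summable_bounded_dirichlet[OF norm_moebius_inv_exp_le s]])
  show "inv_series n r s (- y) = (-1) ^ r * inv_series n r s y"
    unfolding inv_series_def suminf_mult[OF 2, symmetric] by (simp add: inv_exp_minus mult_ac)
qed

lemma half_series_convolution:
  assumes n: "3 \<le> n" and sq: "squarefree n" and a: "coprime a (int n)" and b: "coprime b (int n)" and s: "1 < s"
  shows "(\<Sum>x\<in>index_set n. kern_series n r s (int x * a) * inv_series n r s (int x * b)) = of_nat n * sym_delta n r a b"
proof -
  have n0: "0 < n" using n by simp
  let ?F = "\<lambda>x. kern_series n r s (x * a) * inv_series n r s (x * b)"
  have "(\<Sum>x<n. ?F (int x)) = 2 * (\<Sum>x\<in>index_set n. ?F (int x))"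
  proof (rule half_range_sum[OF n])
    show "?F x = ?F y" if "[x = y] (mod int n)" for x y
      by (intro arg_cong2[of _ _ _ _ "(*)"] kern_series_cong inv_series_cong n0 cong_mult that cong_refl)
    show "?F (- x) = ?F x" for x
      using sign_square[of r "?F x"] by (simp add: series_minus[OF s] mult_ac)
    show "?F x = 0" if "\<not> coprime x (int n)" for x
    proof -
      have "kern_sym n r (int m * (x * a)) = 0" for m using that by (intro kern_sym_eq_0 sq) simp
      then show ?thesis by (simp add: kern_series_def)
    qed
  qed
  then show ?thesis using series_convolution[OF n sq b s, of r a] by simp
qed

text \<open>Identifies the unique summand that the divisor $d$ contributes to $\widetilde B_j$.\<close>
lemma crt_representative:
  assumes sq: "squarefree n" and d: "d dvd n" and j: "coprime j n"
  shows "gcd k n = d \<and> [k = j] (mod (n div d)) \<longleftrightarrow> [int k = int j * crt_idem n d] (mod int n)"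
proof -
  have n: "0 < n" using sq by (cases "n = 0") auto
  define q where "q = n div d"
  have nd: "n = d * q" using d by (simp add: q_def)
  have cdq: "coprime (int d) (int q)" using squarefree_coprime_div[OF sq d] unfolding q_def by (simp only: coprime_int_iff)
  have w: "int d dvd crt_idem n d" "[crt_idem n d = 1] (mod int q)" using crt_idem[OF sq d] by (auto simp: q_def)
  have wj: "[int j * crt_idem n d = int j] (mod int q)" using cong_mult[OF cong_refl w(2), of "int j"] by simp
  show ?thesis
  proof
    assume k: "gcd k n = d \<and> [k = j] (mod (n div d))"
    then have "d dvd k" by auto
    then have "int d dvd int k" by simp
    moreover have "int d dvd int j * crt_idem n d" using w(1) by simp
    ultimately have 1: "int d dvd int k - int j * crt_idem n d" by (rule dvd_diff)
    have "[int k = int j] (mod int q)" using k unfolding q_def by (simp add: cong_int_iff)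
    then have "[int k = int j * crt_idem n d] (mod int q)" using wj by (meson cong_sym cong_trans)
    then have 2: "int q dvd int k - int j * crt_idem n d" by (simp only: cong_iff_dvd_diff)
    have "int d * int q dvd int k - int j * crt_idem n d" by (rule divides_mult[OF 1 2 cdq])
    then show "[int k = int j * crt_idem n d] (mod int n)" unfolding nd by (simp add: cong_iff_dvd_diff)
  next
    assume k: "[int k = int j * crt_idem n d] (mod int n)"
    have "[int k = int j * crt_idem n d] (mod int q)" by (rule cong_dvd_modulus[OF k]) (simp add: nd)
    then have "[int k = int j] (mod int q)" using wj by (meson cong_trans)
    then have kj: "[k = j] (mod q)" by (simp only: cong_int_iff)
    have "[int k = int j * crt_idem n d] (mod int d)" by (rule cong_dvd_modulus[OF k]) (simp add: nd)
    then have "int d dvd int k" using w(1) by (metis cong_dvd_iff dvd_mult)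
    then have dk: "d dvd k" by simp
    have "coprime j q" using coprime_divisors[OF dvd_refl _ j, of q] by (simp add: nd)
    then have "coprime k q" using cong_imp_coprime[OF cong_sym[OF kj]] by simp
    then have "gcd k (d * q) = gcd k d" by (rule gcd_mult_right_right_cancel)
    then have "gcd k n = d" using dk by (simp add: nd gcd_nat.absorb2)
    then show "gcd k n = d \<and> [k = j] (mod (n div d))" using kj by (simp add: q_def)
  qed
qed

lemma bernoulli_fourier_e_mod:
  assumes n: "0 < n" and k: "[int k = y] (mod int n)"
  shows "bernoulli_fourier r K (real k / real n) = (\<Sum>m=1..K. (e_mod n (int m * y) + (-1) ^ r * e_mod n (- (int m * y))) / of_nat m ^ r)"
proof -
  have "cis (2 * pi * real m * (real k / real n)) = e_mod n (int m * y)" for m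
  proof -
    have "cis (2 * pi * real m * (real k / real n)) = e_mod n (int m * int k)" by (simp add: e_mod_def mult_ac)
    also have "\<dots> = e_mod n (int m * y)" by (rule e_mod_cong[OF n cong_mult[OF cong_refl k]])
    finally show ?thesis .
  qed
  moreover have "cis (- (2 * pi * real m * (real k / real n))) = e_mod n (- (int m * y))" for m
  proof -
    have "cis (- (2 * pi * real m * (real k / real n))) = e_mod n (- (int m * int k))" by (simp add: e_mod_def mult_ac)
    also have "\<dots> = e_mod n (- (int m * y))"
      by (rule e_mod_cong[OF n]) (use cong_mult[OF cong_refl k, of "int m"] in \<open>simp add: cong_minus_minus_iff\<close>)
    finally show ?thesis .
  qed
  ultimately show ?thesis unfolding bernoulli_fourier_def by simp
qed

text \<open>$\widetilde B_j$ without its prefactor.\<close>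
definition bernoulli_moebius_sum :: "nat \<Rightarrow> nat \<Rightarrow> nat \<Rightarrow> real" where
  "bernoulli_moebius_sum n r j = (\<Sum>d | d dvd n. of_int (moebius d) *
        (\<Sum>k | k \<in> {1..n_tilde n r} \<and> gcd k n = d \<and> [k = j] (mod (n div d)).
           bernpoly r (real k / real n)))"

text \<open>For each $d$ the inner sum has at most one term $k \equiv j w_d$ mod $n$. If it is empty then $r$ is odd and
  $k = n$, and the Fourier series vanishes at $1$ in agreement.\<close>
lemma kern_sym_partial_sums:
  assumes n: "1 < n" and sq: "squarefree n" and r: "1 \<le> r" and j: "coprime j n"
  shows "(\<lambda>K. \<Sum>m=1..K. kern_sym n r (int m * int j) / of_nat m ^ r) \<longlonglongrightarrow> - ((2 * pi * \<i>) ^ r / fact r) * of_real (bernoulli_moebius_sum n r j)"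
proof -
  have n0: "0 < n" using n by simp
  let ?c = "- ((2 * pi * \<i>) ^ r / fact r)"
  let ?S = "\<lambda>d. \<Sum>k | k \<in> {1..n_tilde n r} \<and> gcd k n = d \<and> [k = j] (mod (n div d)). bernpoly r (real k / real n)"
  let ?T = "\<lambda>d K. \<Sum>m=1..K. (e_mod n (int m * (int j * crt_idem n d)) + (-1) ^ r * e_mod n (- (int m * (int j * crt_idem n d)))) / of_nat m ^ r"
  have part: "(\<lambda>K. ?T d K) \<longlonglongrightarrow> ?c * of_real (?S d)" if d: "d dvd n" for d
  proof -
    define y where "y = int j * crt_idem n d"
    \<comment> \<open>The representative of $y$ in $\{1,\dots,n\}$: residue $0$ is represented by $n$.\<close>
    define k0 where "k0 = (if y mod int n = 0 then n else nat (y mod int n))"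
    have mod0: "0 \<le> y mod int n" "y mod int n < int n" using n0 by auto
    have "1 \<le> k0 \<and> k0 \<le> n"
    proof (cases "y mod int n = 0")
      case False
      then have "0 < y mod int n" using mod0(1) by linarith
      moreover have "k0 = nat (y mod int n)" using False by (simp only: k0_def if_False)
      ultimately show ?thesis using mod0(2) by linarith
    next
      case True
      then have "k0 = n" by (simp add: k0_def)
      then show ?thesis using n0 by simp
    qed
    then have k0: "1 \<le> k0" "k0 \<le> n" by auto
    have k0y: "[int k0 = y] (mod int n)"
      using mod0 by (auto simp: k0_def unique_euclidean_semiring_class.cong_def)
    have uniq: "k = k0" if "k \<in> {1..n}" "[int k = y] (mod int n)" for k
    proof -
      have "[int k = int k0] (mod int n)" using that(2) k0y by (meson cong_sym cong_trans)
      then have "[k = k0] (mod n)" by (simp only: cong_int_iff)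
      then have km: "k mod n = k0 mod n" by (simp add: unique_euclidean_semiring_class.cong_def)
      show ?thesis
      proof (cases "k = n \<or> k0 = n")
        case True
        then show ?thesis using km that(1) k0 by (cases "k = n"; cases "k0 = n") auto
      next
        case False
        then show ?thesis using km that(1) k0 by simp
      qed
    qed
    have set_eq: "{k. k \<in> {1..n_tilde n r} \<and> gcd k n = d \<and> [k = j] (mod (n div d))} = (if k0 \<le> n_tilde n r then {k0} else {})"
    proof -
      have "{k. k \<in> {1..n_tilde n r} \<and> gcd k n = d \<and> [k = j] (mod (n div d))} = {k. k \<in> {1..n_tilde n r} \<and> [int k = y] (mod int n)}"
        unfolding y_def crt_representative[OF sq d j] ..
      also have "\<dots> = (if k0 \<le> n_tilde n r then {k0} else {})"
      proof -
        have ntl: "n_tilde n r \<le> n" by (simp add: n_tilde_def)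
        have "k = k0" if "k \<in> {1..n_tilde n r}" "[int k = y] (mod int n)" for k
          by (rule uniq) (use that ntl in auto)
        then have "{k. k \<in> {1..n_tilde n r} \<and> [int k = y] (mod int n)} \<subseteq> {k0}" by blast
        moreover have "k0 \<in> {k. k \<in> {1..n_tilde n r} \<and> [int k = y] (mod int n)} \<longleftrightarrow> k0 \<le> n_tilde n r"
          using k0(1) k0y by simp
        ultimately show ?thesis by (simp split: if_split) blast
      qed
      finally show ?thesis .
    qed
    have Teq: "?T d K = bernoulli_fourier r K (real k0 / real n)" for K
      unfolding y_def[symmetric] by (rule bernoulli_fourier_e_mod[OF n0 k0y, symmetric])
    show ?thesis
    proof (cases "k0 \<le> n_tilde n r")
      case True
      have "(\<lambda>K. bernoulli_fourier r K (real k0 / real n)) \<longlonglongrightarrow> scaled_bernpoly r (real k0 / real n)"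
      proof (rule bernoulli_fourier_converges[OF r])
        show "0 < real k0 / real n" using k0 n0 by simp
        show "real k0 / real n < 1 \<or> 2 \<le> r \<and> real k0 / real n \<le> 1"
        proof (cases "odd r")
          case True
          then have "k0 < n" using \<open>k0 \<le> n_tilde n r\<close> n0 by (simp add: n_tilde_def)
          then show ?thesis by simp
        next
          case False
          then have "r \<noteq> 1" by auto
          then have "2 \<le> r" using r by linarith
          then show ?thesis using k0 n0 by simp
        qed
      qed
      moreover have "?S d = bernpoly r (real k0 / real n)" unfolding set_eq using True by simp
      ultimately show ?thesis unfolding Teq by (simp only: scaled_bernpoly_def)
    next
      case False
      then have o: "odd r" "k0 = n" using k0 by (auto simp: n_tilde_def split: if_splits)
      have "bernoulli_fourier r K 1 = 0" for K
      proof -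
        have "cis (2 * pi * real m) = 1" "cis (- (2 * pi * real m)) = 1" for m
          using cis_multiple_2pi[of "real m"] cis_multiple_2pi[of "- real m"] by auto
        then show ?thesis using o(1) by (simp add: bernoulli_fourier_def)
      qed
      moreover have "?S d = 0" unfolding set_eq using False by simp
      moreover have "real k0 / real n = 1" using o n0 by simp
      ultimately show ?thesis unfolding Teq by (simp only: of_real_0 mult_zero_right tendsto_const)
    qed
  qed
  have "(\<lambda>K. \<Sum>d | d dvd n. of_int (moebius d) * ?T d K) \<longlonglongrightarrow> (\<Sum>d | d dvd n. of_int (moebius d) * (?c * of_real (?S d)))"
    by (intro tendsto_sum tendsto_mult tendsto_const part) simp
  also have "(\<Sum>d | d dvd n. of_int (moebius d) * (?c * of_real (?S d))) = ?c * of_real (bernoulli_moebius_sum n r j)"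
    by (simp add: bernoulli_moebius_sum_def sum_distrib_left mult_ac)
  also have "(\<lambda>K. \<Sum>d | d dvd n. of_int (moebius d) * ?T d K) = (\<lambda>K. \<Sum>m=1..K. kern_sym n r (int m * int j) / of_nat m ^ r)"
  proof
    fix K
    have "(\<Sum>d | d dvd n. of_int (moebius d) * ?T d K)
        = (\<Sum>m=1..K. \<Sum>d | d dvd n. of_int (moebius d) * ((e_mod n (int m * (int j * crt_idem n d)) + (-1) ^ r * e_mod n (- (int m * (int j * crt_idem n d)))) / of_nat m ^ r))"
      unfolding sum_distrib_left by (rule sum.swap)
    also have "\<dots> = (\<Sum>m=1..K. kern_sym n r (int m * int j) / of_nat m ^ r)"
    proof (rule sum.cong[OF refl])
      fix m
      have alg: "u * ((v + e * w) / z) = (u * v + e * (u * w)) / z" for u v w e z :: complex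
        by (simp add: algebra_simps)
      have "kern_sym n r (int m * int j) / of_nat m ^ r
          = (\<Sum>d | d dvd n. (of_int (moebius d) * e_mod n ((int m * int j) * crt_idem n d) + (-1) ^ r * (of_int (moebius d) * e_mod n (- (int m * int j) * crt_idem n d))) / of_nat m ^ r)"
        unfolding kern_sym_def kern_def sum_distrib_left sum.distrib[symmetric] sum_divide_distrib ..
      then show "(\<Sum>d | d dvd n. of_int (moebius d) * ((e_mod n (int m * (int j * crt_idem n d)) + (-1) ^ r * e_mod n (- (int m * (int j * crt_idem n d)))) / of_nat m ^ r))
          = kern_sym n r (int m * int j) / of_nat m ^ r"
        unfolding alg by (simp only: mult.assoc mult_minus_left)
    qed
    finally show "(\<Sum>d | d dvd n. of_int (moebius d) * ?T d K) = (\<Sum>m=1..K. kern_sym n r (int m * int j) / of_nat m ^ r)" .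
  qed
  finally show ?thesis .
qed

section \<open>The convolution identity at the exponent r\<close>

definition kern_lim :: "nat \<Rightarrow> nat \<Rightarrow> int \<Rightarrow> complex" where
  "kern_lim n r y = lim (\<lambda>K. \<Sum>m=1..K. kern_sym n r (int m * y) / of_nat m ^ r)"

definition inv_lim :: "nat \<Rightarrow> nat \<Rightarrow> int \<Rightarrow> complex" where
  "inv_lim n r y = lim (\<lambda>K. \<Sum>m=1..K. of_int (moebius m) * inv_exp n r y m / of_nat m ^ r)"

lemma of_nat_powr_neg_nat: "0 < m \<Longrightarrow> (of_nat m :: complex) powr (- of_nat r) = 1 / of_nat m ^ r"
  by (simp add: powr_minus divide_inverse)

lemma sum_powr_eq:
  fixes c :: "nat \<Rightarrow> complex"
  shows "(\<Sum>m=1..K. c m * of_nat m powr (- of_nat r)) = (\<Sum>m=1..K. c m / of_nat m ^ r)"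
  by (intro sum.cong refl) (simp add: of_nat_powr_neg_nat)

lemma sum_powr_eq_1:
  fixes c :: "nat \<Rightarrow> complex"
  shows "(\<Sum>m=1..K. c m * of_nat m powr (- 1)) = (\<Sum>m=1..K. c m / of_nat m ^ 1)"
  using sum_powr_eq[of c 1 K] by (simp only: of_nat_1)

lemma kern_lim_tendsto:
  assumes n: "1 < n" and sq: "squarefree n" and r: "1 \<le> r" and y: "coprime y (int n)"
  shows "(\<lambda>K. \<Sum>m=1..K. kern_sym n r (int m * y) / of_nat m ^ r) \<longlonglongrightarrow> kern_lim n r y"
proof -
  have n0: "0 < n" using n by simp
  define j where "j = nat (y mod int n)"
  have ij: "int j = y mod int n" using n0 by (simp add: j_def)
  then have jy: "[int j = y] (mod int n)" by (simp add: unique_euclidean_semiring_class.cong_def)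
  have "coprime (int j) (int n)" using cong_imp_coprime[OF cong_sym[OF jy] y] .
  then have cj: "coprime j n" by (simp only: coprime_int_iff)
  have "kern_sym n r (int m * int j) = kern_sym n r (int m * y)" for m
    by (rule kern_sym_cong[OF n0 cong_mult[OF cong_refl jy]])
  then have "convergent (\<lambda>K. \<Sum>m=1..K. kern_sym n r (int m * y) / of_nat m ^ r)"
    using kern_sym_partial_sums[OF n sq r cj] by (auto simp: convergent_def)
  then show ?thesis unfolding kern_lim_def by (simp only: convergent_LIMSEQ_iff)
qed

lemma kern_lim_bernoulli:
  assumes n: "1 < n" and sq: "squarefree n" and r: "1 \<le> r" and j: "coprime j n"
  shows "kern_lim n r (int j) = - ((2 * pi * \<i>) ^ r / fact r) * of_real (bernoulli_moebius_sum n r j)"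
  unfolding kern_lim_def by (rule limI[OF kern_sym_partial_sums[OF assms]])

lemma kern_lim_cong:
  assumes "0 < n" "[x = y] (mod int n)"
  shows "kern_lim n r x = kern_lim n r y"
proof -
  have "kern_sym n r (int m * x) = kern_sym n r (int m * y)" for m
    by (rule kern_sym_cong[OF assms(1) cong_mult[OF cong_refl assms(2)]])
  then show ?thesis by (simp add: kern_lim_def)
qed

lemma inv_lim_cong:
  assumes "0 < n" "[x = y] (mod int n)"
  shows "inv_lim n r x = inv_lim n r y"
  using inv_exp_cong[OF assms] by (simp add: inv_lim_def)

lemma inv_exp_periodic:
  assumes n: "1 < n"
  shows "inv_exp n r y (l + n) = inv_exp n r y l"
proof (cases "coprime l n")
  case True
  have shift: "coprime (l + n) n" using True unfolding coprime_iff_gcd_eq_1 gcd_add1 .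
  have "[int (inv_mod n (l + n)) * int (l + n) = 1] (mod int n)" by (rule inv_mod_cong[OF n shift])
  moreover have "[int (inv_mod n (l + n)) * int (l + n) = int (inv_mod n (l + n)) * int l] (mod int n)"
    by (rule cong_mult[OF cong_refl]) (simp add: unique_euclidean_semiring_class.cong_def)
  ultimately have "[int (inv_mod n (l + n)) * int l = 1] (mod int n)" using cong_trans cong_sym by blast
  from inv_mod_unique[OF n True this] have "[int (inv_mod n (l + n)) = int (inv_mod n l)] (mod int n)" .
  then have "e_sym n r (int (inv_mod n (l + n)) * y) = e_sym n r (int (inv_mod n l) * y)"
    using n by (intro e_sym_cong cong_mult cong_refl) auto
  then show ?thesis using True shift by (simp add: inv_exp_def)
next
  case False
  then have "\<not> coprime (l + n) n" unfolding coprime_iff_gcd_eq_1 gcd_add1 .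
  then show ?thesis using False by (simp add: inv_exp_def)
qed

lemma inv_exp_odd:
  assumes n: "1 < n"
  shows "inv_exp n 1 y (l * (n - 1)) = - inv_exp n 1 y l"
proof -
  have n1: "coprime (n - 1) n" 
    unfolding coprime_iff_gcd_eq_1 using gcd_diff2_nat[of 1 n] n by simp
  show ?thesis
  proof (cases "coprime l n")
    case True
    have c: "coprime (l * (n - 1)) n" using True n1 by simp
    have "[int (n - 1) = -1] (mod int n)" using n by (simp add: cong_iff_dvd_diff of_nat_diff)
    from cong_mult[OF cong_minus_minus_iff[THEN iffD2, OF inv_mod_cong[OF n True]] this]
    have "[(- int (inv_mod n l)) * int (l * (n - 1)) = 1] (mod int n)" by (simp add: mult_ac)
    from inv_mod_unique[OF n c this]
    have "[int (inv_mod n (l * (n - 1))) * y = - int (inv_mod n l) * y] (mod int n)"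
      by (intro cong_mult cong_refl) (rule cong_sym)
    then have "e_sym n 1 (int (inv_mod n (l * (n - 1))) * y) = e_sym n 1 (- (int (inv_mod n l) * y))"
      using n by (intro e_sym_cong) auto
    then show ?thesis using True c by (simp add: inv_exp_def e_sym_minus)
  next
    case False
    then show ?thesis by (simp add: inv_exp_def)
  qed
qed

lemma inv_lim_1:
  assumes n: "3 \<le> n" and sq: "squarefree n"
  shows "(\<lambda>K. \<Sum>m=1..K. of_int (moebius m) * inv_exp n 1 y m / of_nat m ^ 1) \<longlonglongrightarrow> inv_lim n 1 y"
    and "((\<lambda>s. inv_series n 1 s y) \<longlongrightarrow> inv_lim n 1 y) (at_right 1)"
proof -
  have n1: "1 < n" using n by simp
  have "moebius_series_regular (inv_exp n 1 y)"
  proof (rule moebius_series_regular_odd[OF sq])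
    show "2 \<le> n" using n by simp
    show "inv_exp n 1 y (m + n) = inv_exp n 1 y m" for m by (rule inv_exp_periodic[OF n1])
    show "inv_exp n 1 y (m * (n - 1)) = - inv_exp n 1 y m" for m by (rule inv_exp_odd[OF n1])
  qed (simp add: inv_exp_def)
  then obtain l where l: "(\<lambda>N. \<Sum>m=1..N. of_int (moebius m) * inv_exp n 1 y m * of_nat m powr (-1)) \<longlonglongrightarrow> l"
      "((\<lambda>s. \<Sum>m. of_int (moebius m) * inv_exp n 1 y m * of_nat m powr (- of_real s)) \<longlongrightarrow> l) (at_right (1::real))"
    unfolding moebius_series_regular_def by blast
  have 1: "(\<lambda>K. \<Sum>m=1..K. of_int (moebius m) * inv_exp n 1 y m / of_nat m ^ 1) \<longlonglongrightarrow> l"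
    using l(1) unfolding sum_powr_eq_1 .
  then have "inv_lim n 1 y = l" unfolding inv_lim_def by (rule limI)
  then show "(\<lambda>K. \<Sum>m=1..K. of_int (moebius m) * inv_exp n 1 y m / of_nat m ^ 1) \<longlonglongrightarrow> inv_lim n 1 y"
    "((\<lambda>s. inv_series n 1 s y) \<longlongrightarrow> inv_lim n 1 y) (at_right 1)"
    using 1 l(2) by (simp_all only: inv_series_def)
qed

text \<open>The coefficients $m \mapsto E(my) - E(-my)$ are odd with period $n$, so their mean is zero and the
  Dirichlet series is continuous at $s = 1$.\<close>
lemma kern_lim_1:
  assumes n: "3 \<le> n" and sq: "squarefree n" and y: "coprime y (int n)"
  shows "((\<lambda>s. kern_series n 1 s y) \<longlongrightarrow> kern_lim n 1 y) (at_right 1)"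
proof -
  have n0: "0 < n" "1 < n" using n by auto
  let ?h = "\<lambda>m. kern_sym n 1 (int m * y)"
  have per: "?h (m + n) = ?h m" for m
    by (rule kern_sym_cong[OF n0(1) cong_mult[OF _ cong_refl]]) (simp add: unique_euclidean_semiring_class.cong_def)
  have mean: "(\<Sum>j=1..n. ?h j) = 0"
  proof (rule odd_mean_zero)
    show "1 \<le> n" using n by simp
    show "?h n = 0" using n0 by (intro kern_sym_eq_0[OF sq]) simp
    fix j assume j: "1 \<le> j" "j < n"
    have "[int (n - j) = - int j] (mod int n)" using j by (simp add: cong_iff_dvd_diff of_nat_diff)
    from cong_mult[OF this cong_refl, of y] have "?h (n - j) = kern_sym n 1 (- (int j * y))"
      using n0 by (intro kern_sym_cong) auto
    then show "?h (n - j) = - ?h j" by (simp add: kern_sym_minus)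
  qed
  have "(\<lambda>N. \<Sum>m=1..N. ?h m * of_nat m powr (- 1)) \<longlonglongrightarrow> kern_lim n 1 y"
    unfolding sum_powr_eq_1 by (rule kern_lim_tendsto[OF n0(2) sq order_refl y])
  then have L1: "periodic_L ?h n 1 = kern_lim n 1 y"
    by (rule periodic_L_eq_limit[where h = ?h, OF n0(1) per])
  have "isCont (periodic_L ?h n) 1"
  proof -
    have "continuous_on {s. 0 < Re s} (periodic_L ?h n)"
      by (rule holomorphic_on_imp_continuous_on[OF periodic_L_sums_holomorphic(2)[OF n0(1) mean]])
    then show ?thesis by (simp add: continuous_on_eq_continuous_at open_halfspace_Re_gt)
  qed
  then have "(periodic_L ?h n \<longlongrightarrow> kern_lim n 1 y) (at 1)" unfolding isCont_def L1 .
  moreover have "filterlim (\<lambda>s::real. complex_of_real s) (at 1) (at_right 1)"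
    by (auto simp: filterlim_at eventually_at_filter intro!: tendsto_eq_intros)
  ultimately have "((\<lambda>s. periodic_L ?h n (of_real s)) \<longlongrightarrow> kern_lim n 1 y) (at_right 1)" by (rule filterlim_compose)
  then show ?thesis
  proof (rule Lim_transform_eventually)
    show "\<forall>\<^sub>F s in at_right 1. periodic_L ?h n (of_real s) = kern_series n 1 s y"
      using eventually_at_right_less[of "1::real"]
    proof eventually_elim
      case (elim s)
      then show ?case unfolding kern_series_def by (intro periodic_L_eq_suminf[where h = ?h, OF n0(1) per]) simp
    qed
  qed
qed

lemma series_eq_lim:
  assumes r: "2 \<le> r"
  shows "kern_series n r (real r) y = kern_lim n r y" "inv_series n r (real r) y = inv_lim n r y"
    and "(\<lambda>K. \<Sum>m=1..K. of_int (moebius m) * inv_exp n r y m / of_nat m ^ r) \<longlonglongrightarrow> inv_lim n r y"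
proof -
  have s: "1 < Re (of_nat r :: complex)" using r by simp
  have "summable (\<lambda>m. kern_sym n r (int m * y) * of_nat m powr (- of_nat r))"
    by (rule summable_norm_cancel[OF summable_bounded_dirichlet[OF norm_kern_sym_le s]])
  from sums_imp_LIMSEQ_1[OF summable_sums[OF this]]
  have "(\<lambda>K. \<Sum>m=1..K. kern_sym n r (int m * y) / of_nat m ^ r) \<longlonglongrightarrow> kern_series n r (real r) y"
    unfolding sum_powr_eq by (simp add: kern_series_def)
  then show "kern_series n r (real r) y = kern_lim n r y" unfolding kern_lim_def by (rule limI[symmetric])
  have "summable (\<lambda>m. of_int (moebius m) * inv_exp n r y m * of_nat m powr (- of_nat r))"
    by (rule summable_norm_cancel[OF summable_bounded_dirichlet[OF norm_moebius_inv_exp_le s]])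
  from sums_imp_LIMSEQ_1[OF summable_sums[OF this]]
  have B: "(\<lambda>K. \<Sum>m=1..K. of_int (moebius m) * inv_exp n r y m / of_nat m ^ r) \<longlonglongrightarrow> inv_series n r (real r) y"
    unfolding sum_powr_eq by (simp add: inv_series_def)
  then show eq: "inv_series n r (real r) y = inv_lim n r y" unfolding inv_lim_def by (rule limI[symmetric])
  show "(\<lambda>K. \<Sum>m=1..K. of_int (moebius m) * inv_exp n r y m / of_nat m ^ r) \<longlonglongrightarrow> inv_lim n r y"
    using B unfolding eq .
qed

lemma inv_lim_tendsto:
  assumes n: "3 \<le> n" and sq: "squarefree n" and r: "1 \<le> r"
  shows "(\<lambda>K. \<Sum>m=1..K. of_int (moebius m) * inv_exp n r y m / of_nat m ^ r) \<longlonglongrightarrow> inv_lim n r y"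
proof (cases "r = 1")
  case True
  show ?thesis unfolding True by (rule inv_lim_1(1)[OF n sq])
next
  case False
  then show ?thesis using r by (intro series_eq_lim(3)) simp
qed

text \<open>For $r \ge 2$ this is the series identity at $s = r$; for $r = 1$ it is its limit as $s$ decreases
  to $1$.\<close>
lemma half_lim_convolution:
  assumes n: "3 \<le> n" and sq: "squarefree n" and r: "1 \<le> r" and a: "coprime a (int n)" and b: "coprime b (int n)"
  shows "(\<Sum>x\<in>index_set n. kern_lim n r (int x * a) * inv_lim n r (int x * b)) = of_nat n * sym_delta n r a b"
proof (cases "r = 1")
  case False
  then have r2: "2 \<le> r" using r by simp
  show ?thesis using half_series_convolution[OF n sq a b, of "real r" r] r2 unfolding series_eq_lim[OF r2] by simp
next
  case True
  have cop: "coprime (int x * a) (int n)" if "x \<in> index_set n" for x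
    using that a by (simp add: index_set_iff)
  have "((\<lambda>s. \<Sum>x\<in>index_set n. kern_series n 1 s (int x * a) * inv_series n 1 s (int x * b))
      \<longlongrightarrow> (\<Sum>x\<in>index_set n. kern_lim n 1 (int x * a) * inv_lim n 1 (int x * b))) (at_right 1)"
    by (intro tendsto_sum tendsto_mult kern_lim_1 inv_lim_1(2) n sq cop)
  moreover have "((\<lambda>s. \<Sum>x\<in>index_set n. kern_series n 1 s (int x * a) * inv_series n 1 s (int x * b))
      \<longlongrightarrow> of_nat n * sym_delta n 1 a b) (at_right 1)"
  proof (rule Lim_transform_eventually[OF tendsto_const])
    show "\<forall>\<^sub>F s in at_right 1. of_nat n * sym_delta n 1 a b = (\<Sum>x\<in>index_set n. kern_series n 1 s (int x * a) * inv_series n 1 s (int x * b))"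
      using eventually_at_right_less[of "1::real"]
      by eventually_elim (rule half_series_convolution[OF n sq a b, symmetric])
  qed
  ultimately show ?thesis unfolding True by (rule tendsto_unique[OF trivial_limit_at_right_real])
qed

text \<open>The inverse mod $n$ need not map the index set to itself, so the sum is first extended to all units, which
  inversion permutes.\<close>
lemma half_range_inverse_sum:
  fixes F :: "int \<Rightarrow> complex"
  assumes n: "3 \<le> n" and per: "\<And>x y. [x = y] (mod int n) \<Longrightarrow> F x = F y"
    and even: "\<And>x. F (- x) = F x" and supp: "\<And>x. \<not> coprime x (int n) \<Longrightarrow> F x = 0"
  shows "(\<Sum>x\<in>index_set n. F (int (inv_mod n x))) = (\<Sum>x\<in>index_set n. F (int x))"
proof -
  have n1: "1 < n" "0 < n" using n by auto
  let ?U = "{x. x < n \<and> coprime x n}"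
  define rep where "rep = (\<lambda>x. nat (x mod int n))"
  have rep: "int (rep x) = x mod int n" for x using n1 by (simp add: rep_def)
  have rep_cong: "[int (rep x) = x] (mod int n)" for x unfolding rep by (simp add: unique_euclidean_semiring_class.cong_def)
  have rep_cop: "coprime (rep x) n \<longleftrightarrow> coprime x (int n)" for x
    using cong_imp_coprime[OF rep_cong] cong_imp_coprime[OF cong_sym[OF rep_cong]] coprime_int_iff[of "rep x" n] by blast
  have rep_int: "x < n \<Longrightarrow> rep (int x) = x" for x by (simp add: rep_def)
  \<comment> \<open>Extends $x \mapsto F(x^*)$ from units to all integers.\<close>
  define G where "G = (\<lambda>x. if coprime x (int n) then F (int (inv_mod n (rep x))) else 0)"
  have "(\<Sum>x<n. G (int x)) = 2 * (\<Sum>x\<in>index_set n. G (int x))"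
  proof (rule half_range_sum[OF n])
    show "G x = G y" if "[x = y] (mod int n)" for x y
    proof -
      have "rep x = rep y" using that by (simp add: rep_def unique_euclidean_semiring_class.cong_def)
      moreover have "coprime x (int n) \<longleftrightarrow> coprime y (int n)" using that cong_imp_coprime cong_sym by blast
      ultimately show ?thesis by (simp add: G_def)
    qed
    show "G (- x) = G x" for x
    proof (cases "coprime x (int n)")
      case True
      have c: "coprime (rep x) n" "coprime (rep (- x)) n" using True rep_cop by simp_all
      have "[- int (rep x) = - x] (mod int n)" using rep_cong[of x] by (simp only: cong_minus_minus_iff)
      then have e: "[int (rep (- x)) = - int (rep x)] (mod int n)" using rep_cong[of "- x"] cong_trans cong_sym by blast
      have "[(- int (inv_mod n (rep x))) * int (rep (- x)) = (- int (inv_mod n (rep x))) * (- int (rep x))] (mod int n)"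
        by (rule cong_mult[OF cong_refl e])
      moreover have "(- int (inv_mod n (rep x))) * (- int (rep x)) = int (inv_mod n (rep x)) * int (rep x)" by simp
      ultimately have "[(- int (inv_mod n (rep x))) * int (rep (- x)) = 1] (mod int n)"
        using inv_mod_cong[OF n1(1) c(1)] cong_trans by metis
      from inv_mod_unique[OF n1(1) c(2) this] have "F (- int (inv_mod n (rep x))) = F (int (inv_mod n (rep (- x))))" by (rule per)
      then show ?thesis using True by (simp add: G_def even)
    qed (simp add: G_def)
  qed (simp add: G_def)
  moreover have "(\<Sum>x<n. G (int x)) = (\<Sum>x<n. F (int x))"
  proof -
    have inv_less: "inv_mod n x < n" for x
      using modular_inverse_int_less[of "int n" "int x"] modular_inverse_int_nonneg[of "int n" "int x"] n1
      by (simp add: inv_mod_def nat_less_iff)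
    have inv_cop: "coprime (inv_mod n x) n" if "coprime x n" for x
      using inv_mod_coprime[OF n1(1) that] by (simp only: coprime_int_iff)
    have inv_inv: "inv_mod n (inv_mod n x) = x" if "x \<in> ?U" for x
    proof -
      have x: "x < n" "coprime x n" using that by auto
      have "[int x * int (inv_mod n x) = 1] (mod int n)" using inv_mod_cong[OF n1(1) x(2)] by (simp only: mult.commute)
      from inv_mod_unique[OF n1(1) inv_cop[OF x(2)] this] have "[x = inv_mod n (inv_mod n x)] (mod n)" by (simp only: cong_int_iff)
      then show ?thesis using x(1) inv_less by (simp add: unique_euclidean_semiring_class.cong_def)
    qed
    have "(\<Sum>x<n. G (int x)) = (\<Sum>x\<in>?U. G (int x))" by (rule sum.mono_neutral_right) (auto simp: G_def)
    also have "\<dots> = (\<Sum>x\<in>?U. F (int (inv_mod n x)))" by (intro sum.cong refl) (auto simp: G_def rep_int)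
    also have "\<dots> = (\<Sum>x\<in>?U. F (int x))"
      by (rule sum.reindex_bij_witness[of _ "inv_mod n" "inv_mod n"]) (use inv_less inv_cop inv_inv in auto)
    also have "\<dots> = (\<Sum>x<n. F (int x))" by (rule sum.mono_neutral_left) (auto simp: supp)
    finally show ?thesis .
  qed
  moreover have "(\<Sum>x<n. F (int x)) = 2 * (\<Sum>x\<in>index_set n. F (int x))"
    by (rule half_range_sum[where F = F, OF n per even supp])
  moreover have "(\<Sum>x\<in>index_set n. G (int x)) = (\<Sum>x\<in>index_set n. F (int (inv_mod n x)))"
    using n1 by (intro sum.cong refl) (auto simp: G_def index_set_iff rep_int)
  ultimately show ?thesis by simp
qed

lemma half_lim_convolution_inverse:
  assumes n: "3 \<le> n" and sq: "squarefree n" and r: "1 \<le> r" and a: "coprime a (int n)" and b: "coprime b (int n)"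
  shows "(\<Sum>x\<in>index_set n. kern_lim n r (int (inv_mod n x) * a) * inv_lim n r (int (inv_mod n x) * b)) = of_nat n * sym_delta n r a b"
proof -
  have n1: "1 < n" "0 < n" using n by auto
  define F where "F = (\<lambda>x. if coprime x (int n) then kern_lim n r (x * a) * inv_lim n r (x * b) else 0)"
  have Aminus: "kern_lim n r (- y) = (-1) ^ r * kern_lim n r y" if "coprime y (int n)" for y
  proof -
    have "(\<lambda>K. (-1) ^ r * (\<Sum>m=1..K. kern_sym n r (int m * y) / of_nat m ^ r)) \<longlonglongrightarrow> (-1) ^ r * kern_lim n r y"
      by (intro tendsto_mult tendsto_const kern_lim_tendsto[OF n1(1) sq r that])
    then show ?thesis unfolding kern_lim_def[of n r "- y"]
      by (intro limI) (simp add: kern_sym_minus sum_distrib_left)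
  qed
  have Bminus: "inv_lim n r (- y) = (-1) ^ r * inv_lim n r y" for y
  proof -
    have "(\<lambda>K. (-1) ^ r * (\<Sum>m=1..K. of_int (moebius m) * inv_exp n r y m / of_nat m ^ r)) \<longlonglongrightarrow> (-1) ^ r * inv_lim n r y"
      by (intro tendsto_mult tendsto_const inv_lim_tendsto[OF n sq r])
    then show ?thesis unfolding inv_lim_def[of n r "- y"]
      by (intro limI) (simp add: inv_exp_minus sum_distrib_left mult.left_commute)
  qed
  have "(\<Sum>x\<in>index_set n. F (int (inv_mod n x))) = (\<Sum>x\<in>index_set n. F (int x))"
  proof (rule half_range_inverse_sum[OF n])
    show "F x = F y" if "[x = y] (mod int n)" for x y
    proof -
      have "coprime x (int n) \<longleftrightarrow> coprime y (int n)" using that cong_imp_coprime cong_sym by blast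
      moreover have "kern_lim n r (x * a) = kern_lim n r (y * a)" by (rule kern_lim_cong[OF n1(2) cong_mult[OF that cong_refl]])
      moreover have "inv_lim n r (x * b) = inv_lim n r (y * b)" by (rule inv_lim_cong[OF n1(2) cong_mult[OF that cong_refl]])
      ultimately show ?thesis by (simp add: F_def)
    qed
    show "F (- x) = F x" for x
    proof (cases "coprime x (int n)")
      case True
      then have "coprime (x * a) (int n)" using a by simp
      then show ?thesis using True Aminus[of "x * a"] Bminus[of "x * b"] sign_square[of r "kern_lim n r (x * a) * inv_lim n r (x * b)"]
        by (simp add: F_def mult_ac)
    qed (simp add: F_def)
  qed (simp add: F_def)
  moreover have "F (int x) = kern_lim n r (int x * a) * inv_lim n r (int x * b)" if "x \<in> index_set n" for x
    using that by (simp add: F_def index_set_iff)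
  moreover have "F (int (inv_mod n x)) = kern_lim n r (int (inv_mod n x) * a) * inv_lim n r (int (inv_mod n x) * b)" if "x \<in> index_set n" for x
    using that inv_mod_coprime[OF n1(1), of x] by (simp only: F_def index_set_iff if_True)
  ultimately show ?thesis using half_lim_convolution[OF n sq r a b] by simp
qed

section \<open>The inverse matrix\<close>

text \<open>A left inverse and a right inverse agree.\<close>
lemma is_mat_inverse_on_unique:
  assumes S: "finite S" and M: "is_mat_inverse_on S A M" and N: "is_mat_inverse_on S A N"
    and jk: "j \<in> S" "k \<in> S"
  shows "M j k = N j k"
proof -
  have "M j k = (\<Sum>l\<in>S. M j l * (if l = k then 1 else 0))"
    using S jk by (simp add: if_distrib cong: if_cong)
  also have "\<dots> = (\<Sum>l\<in>S. M j l * (\<Sum>p\<in>S. A l p * N p k))"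
    using N jk unfolding is_mat_inverse_on_def by (intro sum.cong refl) simp
  also have "\<dots> = (\<Sum>p\<in>S. (\<Sum>l\<in>S. M j l * A l p) * N p k)"
    unfolding sum_distrib_left sum_distrib_right by (subst sum.swap) (simp add: mult.assoc)
  also have "\<dots> = (\<Sum>p\<in>S. (if j = p then 1 else 0) * N p k)"
    using M jk unfolding is_mat_inverse_on_def by (intro sum.cong refl) simp
  also have "\<dots> = (\<Sum>p\<in>S. if j = p then N p k else 0)" by (intro sum.cong refl) simp
  also have "\<dots> = N j k" using S jk by simp
  finally show ?thesis .
qed

lemma mat_inverse_on_eq:
  assumes S: "finite S" and M: "is_mat_inverse_on S A M" and out: "\<And>j k. j \<notin> S \<or> k \<notin> S \<Longrightarrow> M j k = 0"
  shows "mat_inverse_on S A = M"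
  unfolding mat_inverse_on_def
proof (rule the_equality)
  show "is_mat_inverse_on S A M \<and> (\<forall>j k. j \<notin> S \<or> k \<notin> S \<longrightarrow> M j k = 0)" using M out by blast
  fix N assume N: "is_mat_inverse_on S A N \<and> (\<forall>j k. j \<notin> S \<or> k \<notin> S \<longrightarrow> N j k = 0)"
  show "N = M"
  proof (intro ext)
    fix j k
    show "N j k = M j k"
    proof (cases "j \<in> S \<and> k \<in> S")
      case True
      then show ?thesis using is_mat_inverse_on_unique[OF S conjunct1[OF N] M] by blast
    next
      case False
      then show ?thesis using N out[of j k] by auto
    qed
  qed
qed

definition trig :: "nat \<Rightarrow> real \<Rightarrow> real" where
  "trig r = (if odd r then sin else cos)"

definition trig_partial_sum :: "nat \<Rightarrow> nat \<Rightarrow> int \<Rightarrow> nat \<Rightarrow> real" where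
  "trig_partial_sum n r y K = (\<Sum>m | 0 < m \<and> m \<le> K \<and> coprime m n.
     of_int (moebius m) * (trig r (2 * pi * real_of_int (int (inv_mod n m) * y) / real n) / real m ^ r))"

text \<open>$e(-x) + \varepsilon e(x)$ is this factor times $\sin(2\pi x/n)$ or $\cos(2\pi x/n)$.\<close>
definition trig_factor :: "nat \<Rightarrow> complex" where
  "trig_factor r = (if odd r then - 2 * \<i> else 2)"

lemma e_sym_trig: "e_sym n r x = trig_factor r * of_real (trig r (2 * pi * real_of_int x / real n))"
  by (auto simp: e_sym_def e_mod_def trig_factor_def trig_def complex_eq_iff)

lemma trig_partial_sum_complex:
  "(\<Sum>m=1..K. of_int (moebius m) * inv_exp n r y m / of_nat m ^ r) = trig_factor r * of_real (trig_partial_sum n r y K)"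
proof -
  have "(\<Sum>m=1..K. of_int (moebius m) * inv_exp n r y m / of_nat m ^ r)
      = (\<Sum>m | 0 < m \<and> m \<le> K \<and> coprime m n. of_int (moebius m) * inv_exp n r y m / of_nat m ^ r)"
    by (rule sum.mono_neutral_right) (auto simp: inv_exp_def)
  also have "\<dots> = (\<Sum>m | 0 < m \<and> m \<le> K \<and> coprime m n. trig_factor r * of_real (of_int (moebius m) * (trig r (2 * pi * real_of_int (int (inv_mod n m) * y) / real n) / real m ^ r)))"
    by (intro sum.cong refl) (simp add: inv_exp_def e_sym_trig)
  finally show ?thesis by (simp add: trig_partial_sum_def sum_distrib_left)
qed

definition trig_lim :: "nat \<Rightarrow> nat \<Rightarrow> int \<Rightarrow> real" where
  "trig_lim n r y = lim (trig_partial_sum n r y)"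

lemma trig_lim:
  assumes n: "3 \<le> n" and sq: "squarefree n" and r: "1 \<le> r"
  shows "trig_partial_sum n r y \<longlonglongrightarrow> trig_lim n r y" and "inv_lim n r y = trig_factor r * of_real (trig_lim n r y)"
proof -
  have nz: "trig_factor r \<noteq> 0" by (simp add: trig_factor_def)
  have B: "(\<lambda>K. trig_factor r * of_real (trig_partial_sum n r y K)) \<longlonglongrightarrow> inv_lim n r y"
    using inv_lim_tendsto[OF n sq r] unfolding trig_partial_sum_complex .
  then have "(\<lambda>K. 1 / trig_factor r * (trig_factor r * of_real (trig_partial_sum n r y K))) \<longlonglongrightarrow> 1 / trig_factor r * inv_lim n r y"
    by (intro tendsto_mult tendsto_const)
  then have "(\<lambda>K. complex_of_real (trig_partial_sum n r y K)) \<longlonglongrightarrow> 1 / trig_factor r * inv_lim n r y" using nz by simp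
  from tendsto_Re[OF this] have "(\<lambda>K. trig_partial_sum n r y K) \<longlonglongrightarrow> Re (1 / trig_factor r * inv_lim n r y)" by simp
  then have "convergent (trig_partial_sum n r y)" by (auto simp: convergent_def)
  then show L: "trig_partial_sum n r y \<longlonglongrightarrow> trig_lim n r y" unfolding trig_lim_def by (simp only: convergent_LIMSEQ_iff)
  have "(\<lambda>K. trig_factor r * of_real (trig_partial_sum n r y K)) \<longlonglongrightarrow> trig_factor r * of_real (trig_lim n r y)"
    by (intro tendsto_mult tendsto_const tendsto_of_real L)
  from LIMSEQ_unique[OF B this] show "inv_lim n r y = trig_factor r * of_real (trig_lim n r y)" .
qed

definition inverse_factor :: "nat \<Rightarrow> nat \<Rightarrow> real" where
  "inverse_factor n r = (-1) ^ (if odd r then (r - 1) div 2 else r div 2 - 1) * (2 * pi ^ r / (real n ^ r * fact (r - 1)))"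

text \<open>The prefactors of $A$, $B$ and $\widetilde B$ combine to the constant of the theorem. The signs
  agree because $i^{r+1} = -(-1)^{(r-1)/2}$ for odd $r$ and $i^r = -(-1)^{r/2-1}$ for even $r$.\<close>
lemma constants_match:
  assumes n: "0 < n" and r: "1 \<le> r"
  shows "of_real ((-1) ^ r * 2 ^ r * real n ^ (r - 1) / real r * inverse_factor n r * real n)
       = - ((2 * pi * \<i>) ^ r / fact r) * trig_factor r"
proof -
  obtain q where q: "r = Suc q" using r by (cases r) auto
  have fr: "fact r = real r * fact (r - 1)" unfolding q by simp
  have nr: "real n ^ r = real n * real n ^ (r - 1)" unfolding q by simp
  have rpos: "real r \<noteq> 0" using r by simp
  define \<sigma> :: real where "\<sigma> = (-1) ^ (if odd r then (r - 1) div 2 else r div 2 - 1)"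
  have "(-1) ^ r * 2 ^ r * real n ^ (r - 1) / real r * inverse_factor n r * real n = (-1) ^ r * \<sigma> * (2 * (2 * pi) ^ r / fact r)"
  proof -
    have alg: "e * t * N / \<rho> * (s * (2 * P / (m * N * F))) * m = e * s * (2 * (t * P) / (\<rho> * F))"
      if "m \<noteq> 0" "N \<noteq> 0" "\<rho> \<noteq> 0" "F \<noteq> 0" for e t N \<rho> s P m F :: real
      using that by simp
    show ?thesis unfolding inverse_factor_def \<sigma>_def[symmetric] fr nr power_mult_distrib
      by (rule alg) (use n rpos in auto)
  qed
  moreover have "of_real ((-1) ^ r * \<sigma>) * 2 = - (\<i> ^ r) * trig_factor r"
  proof (cases "odd r")
    case True
    then obtain k where k: "r = 2 * k + 1" by (elim oddE)
    have f: "\<sigma> = (-1) ^ k" "(-1 :: real) ^ r = - 1" "trig_factor r = - 2 * \<i>" using k by (simp_all add: \<sigma>_def trig_factor_def)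
    have g: "\<i> ^ r = of_real ((-1) ^ k) * \<i>" unfolding k power_add power_mult by simp
    have "complex_of_real (- 1 * x) * 2 = - (of_real x * \<i>) * (- 2 * \<i>)" for x by (simp add: complex_eq_iff)
    then show ?thesis unfolding f g .
  next
    case False
    then obtain k where k: "r = 2 * k" unfolding not_not by (rule evenE)
    then obtain l where l: "k = Suc l" using r by (cases k) auto
    have f: "\<sigma> = (-1) ^ l" "(-1 :: real) ^ r = 1" "trig_factor r = 2" using k l by (simp_all add: \<sigma>_def trig_factor_def)
    have g: "\<i> ^ r = - of_real ((-1) ^ l)" unfolding k power_mult l by simp
    have "complex_of_real (1 * x) * 2 = - (- of_real x) * 2" for x by simp
    then show ?thesis unfolding f g .
  qed
  ultimately have "of_real ((-1) ^ r * 2 ^ r * real n ^ (r - 1) / real r * inverse_factor n r * real n)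
      = (- (\<i> ^ r) * trig_factor r) * of_real ((2 * pi) ^ r / fact r)"
  proof -
    assume 1: "(-1) ^ r * 2 ^ r * real n ^ (r - 1) / real r * inverse_factor n r * real n = (-1) ^ r * \<sigma> * (2 * (2 * pi) ^ r / fact r)"
      and 2: "of_real ((-1) ^ r * \<sigma>) * 2 = - (\<i> ^ r) * trig_factor r"
    have "complex_of_real ((-1) ^ r * \<sigma> * (2 * (2 * pi) ^ r / fact r)) = (of_real ((-1) ^ r * \<sigma>) * 2) * of_real ((2 * pi) ^ r / fact r)"
      by simp
    then show ?thesis unfolding 1 2 .
  qed
  also have "\<dots> = - ((2 * pi * \<i>) ^ r / fact r) * trig_factor r"
    by (simp add: power_mult_distrib)
  finally show ?thesis .
qed

lemma B_tilde_eq: "B_tilde n r j = (-1) ^ r * 2 ^ r * real n ^ (r - 1) / real r * bernoulli_moebius_sum n r j"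
  by (simp add: B_tilde_def bernoulli_moebius_sum_def)

text \<open>Relates the matrix entry to $A(k^* j)$; the factors are kept on the sides where no division is
  needed.\<close>
lemma B_tilde_kern_lim:
  assumes n: "3 \<le> n" and sq: "squarefree n" and r: "1 \<le> r" and j: "coprime j n" and k: "coprime k n"
  shows "- ((2 * pi * \<i>) ^ r / fact r) * of_real (B_tilde_mat n r j k)
    = of_real ((-1) ^ r * 2 ^ r * real n ^ (r - 1) / real r) * kern_lim n r (int (inv_mod n k) * int j)"
proof -
  have n1: "1 < n" "0 < n" using n by auto
  define p where "p = (j * inv_mod n k) mod n"
  have "coprime (inv_mod n k) n" using inv_mod_coprime[OF n1(1) k] by (simp only: coprime_int_iff)
  then have cp: "coprime p n" using j n1 unfolding p_def by simp
  have "[p = j * inv_mod n k] (mod n)" unfolding p_def by (simp add: unique_euclidean_semiring_class.cong_def)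
  then have "[int p = int (j * inv_mod n k)] (mod int n)" by (simp only: cong_int_iff)
  from kern_lim_cong[OF n1(2) this] have "kern_lim n r (int p) = kern_lim n r (int (inv_mod n k) * int j)" by (simp add: mult.commute)
  moreover have "B_tilde_mat n r j k = (-1) ^ r * 2 ^ r * real n ^ (r - 1) / real r * bernoulli_moebius_sum n r p"
    unfolding B_tilde_mat_def p_def[symmetric] B_tilde_eq ..
  ultimately show ?thesis using kern_lim_bernoulli[OF n1(1) sq r cp]
    by (metis (no_types, lifting) mult.left_commute of_real_mult)
qed

definition B_inverse :: "nat \<Rightarrow> nat \<Rightarrow> nat \<Rightarrow> nat \<Rightarrow> real" where
  "B_inverse n r j k = (if j \<in> index_set n \<and> k \<in> index_set n
     then inverse_factor n r * trig_lim n r (int (inv_mod n j) * int k) else 0)"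

text \<open>Distinct elements of the index set are distinct mod $n$ up to sign.\<close>
lemma index_set_sym_delta:
  assumes n: "3 \<le> n" and j: "j \<in> index_set n" and k: "k \<in> index_set n"
  shows "sym_delta n r (int j) (int k) = (if j = k then 1 else 0)"
proof -
  have jk: "1 \<le> j" "2 * j \<le> n" "coprime j n" "1 \<le> k" "2 * k \<le> n" using j k by (auto simp: index_set_iff)
  have "j < n" "k < n" using jk n by auto
  then have 1: "[int j = int k] (mod int n) \<longleftrightarrow> j = k"
    by (simp add: cong_int_iff unique_euclidean_semiring_class.cong_def)
  have "\<not> [int j = - int k] (mod int n)"
  proof
    assume "[int j = - int k] (mod int n)"
    then have "int n dvd int (j + k)" by (simp add: cong_iff_dvd_diff)
    then have d: "n dvd j + k" by (simp only: int_dvd_int_iff)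
    then have "n \<le> j + k" using jk(1) by (intro dvd_imp_le) auto
    then have "n = 2 * j" using jk by simp
    then have "j dvd n" by simp
    then have "j = 1" using jk(3) by (metis coprime_common_divisor dvd_refl nat_dvd_1_iff_1)
    then show False using \<open>n = 2 * j\<close> n by simp
  qed
  then show ?thesis using 1 by (simp add: sym_delta_def)
qed

lemma sym_delta_inv:
  assumes n: "1 < n" and j: "coprime j n" and k: "coprime k n"
  shows "sym_delta n r (int (inv_mod n k)) (int (inv_mod n j)) = sym_delta n r (int j) (int k)"
proof -
  have flip: "[int (inv_mod n k) = e * int (inv_mod n j)] (mod int n) \<longleftrightarrow> [int j = e * int k] (mod int n)" if e: "e * e = 1" for e
  proof -
    let ?u = "int (inv_mod n k)" and ?v = "int (inv_mod n j)"
    have u: "[?u * int k = 1] (mod int n)" and v: "[?v * int j = 1] (mod int n)"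
      using inv_mod_cong[OF n k] inv_mod_cong[OF n j] by auto
    show ?thesis
    proof
      assume "[?u = e * ?v] (mod int n)"
      then have "[?u * (int k * int j) = e * ?v * (int k * int j)] (mod int n)" by (rule cong_mult[OF _ cong_refl])
      moreover have "[?u * int k * int j = 1 * int j] (mod int n)" by (rule cong_mult[OF u cong_refl])
      moreover have "[?v * int j * (e * int k) = 1 * (e * int k)] (mod int n)" by (rule cong_mult[OF v cong_refl])
      moreover have "?u * (int k * int j) = ?u * int k * int j" "e * ?v * (int k * int j) = ?v * int j * (e * int k)" by simp_all
      ultimately show "[int j = e * int k] (mod int n)" by (metis cong_sym cong_trans mult_1)
    next
      assume "[int j = e * int k] (mod int n)"
      then have "[int j * (?u * (e * ?v)) = e * int k * (?u * (e * ?v))] (mod int n)" by (rule cong_mult[OF _ cong_refl])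
      moreover have "e * int k * (?u * (e * ?v)) = e * e * (?u * int k * ?v)" "int j * (?u * (e * ?v)) = ?v * int j * (e * ?u)" by simp_all
      moreover have "[?u * int k * ?v = 1 * ?v] (mod int n)" by (rule cong_mult[OF u cong_refl])
      moreover have "[?v * int j * (e * ?u) = 1 * (e * ?u)] (mod int n)" by (rule cong_mult[OF v cong_refl])
      ultimately have "[e * ?u = ?v] (mod int n)" using e by (metis cong_sym cong_trans mult_1)
      then have "[e * (e * ?u) = e * ?v] (mod int n)" by (rule cong_mult[OF cong_refl])
      moreover have "e * (e * ?u) = ?u" using e by (simp flip: mult.assoc)
      ultimately show "[?u = e * ?v] (mod int n)" by simp
    qed
  qed
  show ?thesis unfolding sym_delta_def using flip[of 1] flip[of "-1"] by simp
qed

text \<open>The product in one order is a sum over $l$ of $A(l^*j)B(l^*k)$ and needs inversion of the summation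
  variable; in the other order it is a sum of $A(lk^*)B(lj^*)$.\<close>
lemma B_inverse_is_inverse:
  assumes n: "3 \<le> n" and sq: "squarefree n" and r: "1 \<le> r"
  shows "is_mat_inverse_on (index_set n) (B_tilde_mat n r) (B_inverse n r)"
proof -
  have n1: "1 < n" "0 < n" using n by auto
  let ?R = "index_set n"
  define c0 where "c0 = - ((2 * pi * \<i>) ^ r / fact r)"
  define \<tau> where "\<tau> = trig_factor r"
  define p where "p = (-1) ^ r * 2 ^ r * real n ^ (r - 1) / real r"
  define \<kappa> where "\<kappa> = inverse_factor n r"
  have nz: "c0 * \<tau> \<noteq> 0" by (simp add: c0_def \<tau>_def trig_factor_def)
  have const: "of_real (p * \<kappa> * real n) = c0 * \<tau>"
    using constants_match[OF n1(2) r] by (simp only: c0_def \<tau>_def p_def \<kappa>_def)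
  have cop: "coprime j n" "coprime (int j) (int n)" "coprime (int (inv_mod n j)) (int n)" if "j \<in> ?R" for j
    using that inv_mod_coprime[OF n1(1), of j] by (auto simp: index_set_iff)
  have A: "c0 * of_real (B_tilde_mat n r j k) = of_real p * kern_lim n r (int (inv_mod n k) * int j)" if "j \<in> ?R" "k \<in> ?R" for j k
    using B_tilde_kern_lim[OF n sq r cop(1)[OF that(1)] cop(1)[OF that(2)]] by (simp only: c0_def p_def)
  have B: "\<tau> * of_real (B_inverse n r j k) = of_real \<kappa> * inv_lim n r (int (inv_mod n j) * int k)" if "j \<in> ?R" "k \<in> ?R" for j k
    using that trig_lim(2)[OF n sq r] by (simp add: B_inverse_def \<tau>_def \<kappa>_def)
  have AB: "(c0 * \<tau>) * of_real (B_tilde_mat n r j k * B_inverse n r j' k')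
      = of_real (p * \<kappa>) * (kern_lim n r (int (inv_mod n k) * int j) * inv_lim n r (int (inv_mod n j') * int k'))"
    if "j \<in> ?R" "k \<in> ?R" "j' \<in> ?R" "k' \<in> ?R" for j k j' k'
  proof -
    have "(c0 * \<tau>) * of_real (B_tilde_mat n r j k * B_inverse n r j' k')
        = (c0 * of_real (B_tilde_mat n r j k)) * (\<tau> * of_real (B_inverse n r j' k'))" by simp
    also have "\<dots> = (of_real p * kern_lim n r (int (inv_mod n k) * int j)) * (of_real \<kappa> * inv_lim n r (int (inv_mod n j') * int k'))"
      unfolding A[OF that(1,2)] B[OF that(3,4)] ..
    finally show ?thesis by simp
  qed
  \<comment> \<open>The nonzero complex constant is cancelled at the end; the entries are real.\<close>
  have finish: "X = (if j = k then 1 else 0)"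
    if "(c0 * \<tau>) * of_real X = of_real (p * \<kappa>) * (of_nat n * (if j = k then 1 else 0))" for X :: real and j k :: nat
  proof -
    have "(c0 * \<tau>) * of_real X = (c0 * \<tau>) * of_real (if j = k then 1 else 0)"
      using that const by (simp split: if_splits)
    then have "complex_of_real X = of_real (if j = k then 1 else 0)" using nz by (simp only: mult_cancel_left) simp
    then show ?thesis by (simp only: of_real_eq_iff)
  qed
  show ?thesis unfolding is_mat_inverse_on_def
  proof (intro conjI ballI)
    fix j k assume jk: "j \<in> ?R" "k \<in> ?R"
    show "(\<Sum>l\<in>?R. B_tilde_mat n r j l * B_inverse n r l k) = (if j = k then 1 else 0)"
    proof (rule finish)
      have "(c0 * \<tau>) * of_real (\<Sum>l\<in>?R. B_tilde_mat n r j l * B_inverse n r l k)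
          = (\<Sum>l\<in>?R. (c0 * \<tau>) * of_real (B_tilde_mat n r j l * B_inverse n r l k))"
        by (simp only: of_real_sum sum_distrib_left)
      also have "\<dots> = (\<Sum>l\<in>?R. of_real (p * \<kappa>) * (kern_lim n r (int (inv_mod n l) * int j) * inv_lim n r (int (inv_mod n l) * int k)))"
        using jk by (intro sum.cong refl AB)
      also have "\<dots> = of_real (p * \<kappa>) * (of_nat n * sym_delta n r (int j) (int k))"
        unfolding sum_distrib_left[symmetric] half_lim_convolution_inverse[OF n sq r cop(2)[OF jk(1)] cop(2)[OF jk(2)]] ..
      finally show "(c0 * \<tau>) * of_real (\<Sum>l\<in>?R. B_tilde_mat n r j l * B_inverse n r l k) = of_real (p * \<kappa>) * (of_nat n * (if j = k then 1 else 0))"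
        unfolding index_set_sym_delta[OF n jk] .
    qed
    show "(\<Sum>l\<in>?R. B_inverse n r j l * B_tilde_mat n r l k) = (if j = k then 1 else 0)"
    proof (rule finish)
      have "(c0 * \<tau>) * of_real (\<Sum>l\<in>?R. B_inverse n r j l * B_tilde_mat n r l k)
          = (\<Sum>l\<in>?R. (c0 * \<tau>) * of_real (B_tilde_mat n r l k * B_inverse n r j l))"
        by (simp only: of_real_sum sum_distrib_left mult.commute)
      also have "\<dots> = (\<Sum>l\<in>?R. of_real (p * \<kappa>) * (kern_lim n r (int (inv_mod n k) * int l) * inv_lim n r (int (inv_mod n j) * int l)))"
        using jk by (intro sum.cong refl AB)
      also have "\<dots> = (\<Sum>l\<in>?R. of_real (p * \<kappa>) * (kern_lim n r (int l * int (inv_mod n k)) * inv_lim n r (int l * int (inv_mod n j))))"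
        by (simp only: mult.commute[of "int (inv_mod n _)" "int _"])
      also have "\<dots> = of_real (p * \<kappa>) * (of_nat n * sym_delta n r (int (inv_mod n k)) (int (inv_mod n j)))"
        unfolding sum_distrib_left[symmetric] half_lim_convolution[OF n sq r cop(3)[OF jk(2)] cop(3)[OF jk(1)]] ..
      finally show "(c0 * \<tau>) * of_real (\<Sum>l\<in>?R. B_inverse n r j l * B_tilde_mat n r l k) = of_real (p * \<kappa>) * (of_nat n * (if j = k then 1 else 0))"
        unfolding sym_delta_inv[OF n1(1) cop(1)[OF jk(1)] cop(1)[OF jk(2)]] index_set_sym_delta[OF n jk] .
    qed
  qed
qed

theorem proposition5:
  fixes n r :: nat
  assumes "n \<ge> 3" and "squarefree n" and "r \<ge> 1"
  shows "mat_invertible_on (index_set n) (B_tilde_mat n r) \<and>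
    (odd r \<longrightarrow>
       convergent (sin_partial_sum n r) \<and>
       (-1) ^ ((r - 1) div 2) * (2 * pi ^ r / (real n ^ r * fact (r - 1))) *
         lim (sin_partial_sum n r) = B_hat n r 1 1) \<and>
    (even r \<longrightarrow>
       convergent (cos_partial_sum n r) \<and>
       (-1) ^ (r div 2 - 1) * (2 * pi ^ r / (real n ^ r * fact (r - 1))) *
         lim (cos_partial_sum n r) = B_hat n r 1 1)"
proof -
  have inv: "is_mat_inverse_on (index_set n) (B_tilde_mat n r) (B_inverse n r)"
    by (rule B_inverse_is_inverse[OF assms])
  then have "mat_invertible_on (index_set n) (B_tilde_mat n r)" by (auto simp: mat_invertible_on_def)
  have "B_hat n r = B_inverse n r"
    unfolding B_hat_def by (rule mat_inverse_on_eq[OF finite_index_set inv]) (auto simp: B_inverse_def)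
  moreover have "(1::nat) \<in> index_set n" using assms(1) by (simp add: index_set_iff)
  moreover have "inv_mod n 1 = 1"
  proof -
    have "modular_inverse (int n) 1 = 1" using assms(1) by (intro modular_inverse_int_eqI) auto
    then show ?thesis by (simp add: inv_mod_def)
  qed
  ultimately have hat: "B_hat n r 1 1 = inverse_factor n r * trig_lim n r 1" by (simp add: B_inverse_def)
  have s: "sin_partial_sum n r = trig_partial_sum n r 1" if "odd r"
    using that by (auto simp: sin_partial_sum_def trig_partial_sum_def trig_def)
  have c: "cos_partial_sum n r = trig_partial_sum n r 1" if "even r"
    using that by (auto simp: cos_partial_sum_def trig_partial_sum_def trig_def)
  have "convergent (trig_partial_sum n r 1)" using trig_lim(1)[OF assms] by (auto simp: convergent_def)
  then show ?thesis
    using \<open>mat_invertible_on (index_set n) (B_tilde_mat n r)\<close> s c hat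
    by (auto simp: inverse_factor_def trig_lim_def)
qed

end
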